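(* Let $m\ge 1$ and let $d_1,\dots,d_m$ be positive integers. Put $s_0:=0$, $s_j:=d_1+d_2+\dots+d_j$ for $1\le j\le m$, and $S:=\sum_{j=1}^m\min(s_j,\,s_m-s_j)$. Let $F(d_1,\dots,d_m)$ and $\overline{F}(d_1,\dots,d_m)$ be the generalized fortresses defined in the context, and let $\operatorname{T}(R)$ denote the number of tilings of a region $R$. (a) If $d_1+\dots+d_m=2k$, then $$\operatorname{T}(F(d_1,\dots,d_m))=\operatorname{T}(\overline{F}(d_1,\dots,d_m))=2^{2k^2-2S}\,5^{S}.$$ (b) If $d_1+\dots+d_m=2k+1$, then $$\operatorname{T}(F(d_1,\dots,d_m))=2^{\alpha}\,5^{S},\qquad \operatorname{T}(\overline{F}(d_1,\dots,d_m))=2^{(2k+1)^2-4S-\alpha}\,5^{S},$$ where $\alpha=k(2k+2)-2S$ if $s_{2j}<k+1\le s_{2j+1}$ for some $j\ge 0$ with $2j+1\le m$, and $\alpha=k(2k+2)+1-2S$ otherwise.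
   Context: Tilings: given a subdivision of the plane into elementary regions, a region is a finite connected union of elementary regions; a tile is the union of two elementary regions sharing an edge; a tiling of a region is a covering of it by tiles without gaps or overlaps; $\operatorname{T}(R)$ is the number of tilings of $R$. Generalized fortresses. Let $n=s_m=d_1+\dots+d_m$. Subdivide the plane by the lines of the unit square lattice ($x\in\mathbb{Z}$, $y\in\mathbb{Z}$), together with all the lines $y-x=2c$ ($c\in\mathbb{Z}$) and the $m+1$ lines $x+y=2s_j$ ($0\le j\le m$). The elementary regions are the cells of this subdivision. Let $Q$ be the diamond with vertices $A=(0,0)$, $B=(n,-n)$, $C=(2n,0)$, $D=(n,n)$, i.e. $Q=\{0\le x+y\le 2n,\ -2n\le y-x\le 0\}$. For $1\le i\le n$, $1\le j\le m$ let the block $R_{i,j}$ be the rectangle $\{2s_{j-1}\le x+y\le 2s_j,\ -2i\le y-x\le -2(i-1)\}$; the blocks tile $Q$, and each elementary region inside $Q$ lies in exactly one block. Then $F(d_1,\dots,d_m)$ is the union of all elementary regions contained in $Q$ and all elementary regions outside $Q$ that share an edge with an elementary region contained in some block $R_{i,j}$ with $i+j$ even. The region $\overline{F}(d_1,\dots,d_m)$ is defined in the same way with "$i+j$ even" replaced by "$i+j$ odd". *)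

theory Defs
  imports "HOL-Analysis.Analysis"
begin

section \<open>Tilings with respect to a subdivision of the plane\<close>

text \<open>A subdivision is given by the point set covered by its lines. Elementary regions are taken
  to be closed, so that regions and tiles are literally unions of elementary regions, and
  overlaps are measured on interiors.\<close>

definition elementary_regions :: "(real \<times> real) set \<Rightarrow> (real \<times> real) set set" where
  "elementary_regions L = closure ` components (- L)"

definition share_edge :: "(real \<times> real) set \<Rightarrow> (real \<times> real) set \<Rightarrow> bool" where
  "share_edge c c' \<longleftrightarrow> c \<noteq> c' \<and> (\<exists>e. e edge_of c \<and> e edge_of c')"

definition tiles :: "(real \<times> real) set \<Rightarrow> (real \<times> real) set set" where
  "tiles L = {c \<union> c' | c c'. c \<in> elementary_regions L \<and> c' \<in> elementary_regions L \<and> share_edge c c'}"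

definition tilings :: "(real \<times> real) set \<Rightarrow> (real \<times> real) set \<Rightarrow> (real \<times> real) set set set" where
  "tilings L R = {\<T>. \<T> \<subseteq> tiles L \<and> \<Union>\<T> = R \<and>
     pairwise (\<lambda>t u. interior t \<inter> interior u = {}) \<T>}"

text \<open>For a bounded region of a locally finite line arrangement there are only finitely many
  tilings, so \<^term>\<open>card\<close> counts them.\<close>

definition num_tilings :: "(real \<times> real) set \<Rightarrow> (real \<times> real) set \<Rightarrow> nat" where
  "num_tilings L R = card (tilings L R)"

section \<open>Generalized fortresses\<close>

text \<open>The tuple of distances is a function \<open>d\<close> of which only the values at \<open>1, \<dots>, m\<close> are used.\<close>

definition psum :: "(nat \<Rightarrow> nat) \<Rightarrow> nat \<Rightarrow> nat" where
  "psum d j = (\<Sum>i = 1..j. d i)"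

definition fortress_lines :: "nat \<Rightarrow> (nat \<Rightarrow> nat) \<Rightarrow> (real \<times> real) set" where
  "fortress_lines m d = {(x, y). x \<in> \<int> \<or> y \<in> \<int> \<or> (\<exists>c::int. y - x = 2 * of_int c) \<or>
     (\<exists>j\<le>m. x + y = 2 * real (psum d j))}"

definition diamond :: "nat \<Rightarrow> (real \<times> real) set" where
  "diamond n = {(x, y). 0 \<le> x + y \<and> x + y \<le> 2 * real n \<and> - 2 * real n \<le> y - x \<and> y - x \<le> 0}"

definition block :: "(nat \<Rightarrow> nat) \<Rightarrow> nat \<Rightarrow> nat \<Rightarrow> (real \<times> real) set" where
  "block d i j = {(x, y). 2 * real (psum d (j - 1)) \<le> x + y \<and> x + y \<le> 2 * real (psum d j) \<and>
     - 2 * real i \<le> y - x \<and> y - x \<le> - 2 * (real i - 1)}"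

text \<open>The predicate \<open>P\<close> selects the parity of \<open>i + j\<close>. The sides of the diamond lie on lines of the
  subdivision, so an elementary region not contained in the diamond lies outside it.\<close>

definition fortress_of :: "(nat \<Rightarrow> bool) \<Rightarrow> nat \<Rightarrow> (nat \<Rightarrow> nat) \<Rightarrow> (real \<times> real) set" where
  "fortress_of P m d = (let n = psum d m; E = elementary_regions (fortress_lines m d) in
     \<Union>{c \<in> E. c \<subseteq> diamond n} \<union>
     \<Union>{c \<in> E. \<not> c \<subseteq> diamond n \<and>
         (\<exists>c' \<in> E. share_edge c c' \<and>
           (\<exists>i \<in> {1..n}. \<exists>j \<in> {1..m}. P (i + j) \<and> c' \<subseteq> block d i j))})"

definition fortress :: "nat \<Rightarrow> (nat \<Rightarrow> nat) \<Rightarrow> (real \<times> real) set" where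
  "fortress = fortress_of even"

definition fortress_bar :: "nat \<Rightarrow> (nat \<Rightarrow> nat) \<Rightarrow> (real \<times> real) set" where
  "fortress_bar = fortress_of odd"

end

theory Submission
  imports Defs
begin

text \<open>
  Tilings are perfect matchings of the adjacency graph of the elementary regions. The four right triangles
  around each lattice point with odd coordinate sum form a cell of an \<open>n \<times> n\<close> array, and every unit
  lattice edge in the diamond belongs to exactly one cell. The matching is determined by the tiles that
  straddle lattice edges: two of them in a cell must not meet in a region, and across a cut (uncut)
  square the regions on the two sides are covered from their cells both or neither (exactly one).
  Flipping the cells of the selected parity turns this rule into ``exactly one side'' everywhere, so
  urban renewal of the remaining cells yields a weighted Aztec diamond of order \<open>n - 1\<close>.
  Its weights are \<open>2\<close>-periodic in the vertical direction and, up to rescaling all edges at one column of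
  vertices, urban renewal only exchanges neighbouring half-columns. A factor \<open>5/4\<close> appears exactly at the
  positions \<open>s\<^sub>j\<close>, \<open>min s\<^sub>j (n - s\<^sub>j)\<close> times each.
\<close>

section \<open>Urban renewal\<close>

text \<open>The number 5/4 comes from the weights 1 and 1/2 left by the first renewal, which
  alternate along every half-column. In a cell the two products of opposite edges are 1/2 and 1/2 if
  its two half-columns are in phase, and 1 and 1/4 otherwise; so \<open>Delta\<close> is 1 or 5/4,
  and the phase changes exactly at the cuts.

  The powers of two are the delicate point. A round on weights that are constant on each half of a
  cell multiplies rows of opposite parity to 1, so it leaves a factor only in odd order, from the
  unpaired row. A diamond of corner weights of odd order therefore has a closed form for arbitrary
  phases, whereas in even order factors depending on the phases accumulate. They telescope because
  both half-column sequences are shifts of one sequence; in the end only the middle position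
  survives. This is why (b) asks which block contains column \<open>k + 1\<close>, and (a) contains
  no such case.\<close>

type_synonym pos = "int \<times> int"

text \<open>Cells \<open>(s, i)\<close> are indexed by column and row, rows counted downwards. The four edges of a cell
  carry positions \<open>(h, r)\<close>, \<open>h\<close> being the half-column and \<open>r\<close> the half-row; they join the consecutive sides
  North, East, South, West of the cell, e.g. \<open>(2s - 1, 2i - 1)\<close> joins West and North.\<close>

definition grid :: "int \<Rightarrow> pos set" where
  "grid n = {1..n} \<times> {1..n}"

fun cell_edges :: "pos \<Rightarrow> pos set" where
  "cell_edges (s, i) = {(2 * s-1, 2 * i-1), (2 * s, 2 * i-1), (2 * s, 2 * i), (2 * s-1, 2 * i)}"

fun cell_of :: "pos \<Rightarrow> pos" where
  "cell_of (h, r) = ((h + 1) div 2, (r + 1) div 2)"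

text \<open>The central reflection of an edge within its own cell: the half-columns
  \<open>2 * s - 1\<close> and \<open>2 * s\<close> add up to \<open>4 * s - 1\<close>, and likewise
  for half-rows.\<close>

fun opposite :: "pos \<Rightarrow> pos" where
  "opposite (h, r) = (4 * ((h + 1) div 2) - 1 - h, 4 * ((r + 1) div 2) - 1 - r)"

fun covN :: "pos set \<Rightarrow> pos \<Rightarrow> bool" where
  "covN M (s, i) \<longleftrightarrow> (2 * s-1, 2 * i-1) \<in> M \<or> (2 * s, 2 * i-1) \<in> M"
fun covE :: "pos set \<Rightarrow> pos \<Rightarrow> bool" where
  "covE M (s, i) \<longleftrightarrow> (2 * s, 2 * i-1) \<in> M \<or> (2 * s, 2 * i) \<in> M"
fun covS :: "pos set \<Rightarrow> pos \<Rightarrow> bool" where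
  "covS M (s, i) \<longleftrightarrow> (2 * s-1, 2 * i) \<in> M \<or> (2 * s, 2 * i) \<in> M"
fun covW :: "pos set \<Rightarrow> pos \<Rightarrow> bool" where
  "covW M (s, i) \<longleftrightarrow> (2 * s-1, 2 * i-1) \<in> M \<or> (2 * s-1, 2 * i) \<in> M"

fun cell_matching :: "pos set \<Rightarrow> pos \<Rightarrow> bool" where
  "cell_matching M (s, i) \<longleftrightarrow>
     \<not> ((2 * s-1, 2 * i-1) \<in> M \<and> (2 * s, 2 * i-1) \<in> M) \<and> \<not> ((2 * s, 2 * i-1) \<in> M \<and> (2 * s, 2 * i) \<in> M) \<and>
     \<not> ((2 * s, 2 * i) \<in> M \<and> (2 * s-1, 2 * i) \<in> M) \<and> \<not> ((2 * s-1, 2 * i) \<in> M \<and> (2 * s-1, 2 * i-1) \<in> M)"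

definition edge_box :: "int \<Rightarrow> pos set" where
  "edge_box n = {1..2 * n} \<times> {1..2 * n}"

text \<open>\<open>P\<close> is the set of flipped cells. For \<open>P = {}\<close> these are the perfect matchings of the Aztec diamond
  of order \<open>n\<close>. Cells outside the grid contain no edges of \<open>M\<close> and are not in \<open>P\<close>, which encodes the
  boundary conditions.\<close>

definition compatible :: "int \<Rightarrow> pos set \<Rightarrow> pos set \<Rightarrow> bool" where
  "compatible n P M \<longleftrightarrow> M \<subseteq> edge_box n \<and> (\<forall>c\<in>grid n. cell_matching M c) \<and>
     (\<forall>s\<in>{0..n}. \<forall>i\<in>{1..n}. (covE M (s, i) \<noteq> ((s, i) \<in> P)) \<noteq> (covW M (s+1, i) \<noteq> ((s+1, i) \<in> P))) \<and>
     (\<forall>s\<in>{1..n}. \<forall>i\<in>{0..n}. (covS M (s, i) \<noteq> ((s, i) \<in> P)) \<noteq> (covN M (s, i+1) \<noteq> ((s, i+1) \<in> P)))"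

definition dimer_sum :: "int \<Rightarrow> pos set \<Rightarrow> (pos \<Rightarrow> real) \<Rightarrow> real" where
  "dimer_sum n P w = (\<Sum>M | compatible n P M. prod w M)"

fun Delta :: "(pos \<Rightarrow> real) \<Rightarrow> pos \<Rightarrow> real" where
  "Delta w (s, i) = w (2 * s-1, 2 * i-1) * w (2 * s, 2 * i) + w (2 * s, 2 * i-1) * w (2 * s-1, 2 * i)"

text \<open>Each cell of \<open>Q\<close> changes only through its own four weights, so different
  cells can be renewed in any order or all at once.\<close>

definition renewal :: "pos set \<Rightarrow> (pos \<Rightarrow> real) \<Rightarrow> pos \<Rightarrow> real" where
  "renewal Q w e = (if cell_of e \<in> Q then w (opposite e) / Delta w (cell_of e) else w e)"

lemma finite_edge_box [simp]: "finite (edge_box n)" and finite_grid [simp]: "finite (grid n)"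
  by (auto simp: edge_box_def grid_def)

lemma finite_compatible [simp]: "finite {M. compatible n P M}"
  by (rule finite_subset[of _ "Pow (edge_box n)"]) (auto simp: compatible_def)

lemma cell_edges_iff: "e \<in> cell_edges c \<longleftrightarrow> cell_of e = c"
proof -
  obtain h r s i where "e = (h, r)" "c = (s, i)" by fastforce
  moreover have "(h + 1) div 2 = s \<longleftrightarrow> h = 2 * s-1 \<or> h = 2 * s" "(r + 1) div 2 = i \<longleftrightarrow> r = 2 * i-1
    \<or> r = 2 * i"
    by presburger+
  ultimately show ?thesis by auto
qed

lemma cell_edges_subset_edge_box: "c \<in> grid n \<Longrightarrow> cell_edges c \<subseteq> edge_box n"
  by (auto simp: grid_def edge_box_def)

lemma covered_cong:
  assumes "M \<inter> cell_edges c = M' \<inter> cell_edges c"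
  shows "covN M c = covN M' c" "covE M c = covE M' c" "covS M c = covS M' c" "covW M c = covW M' c"
    "cell_matching M c = cell_matching M' c"
proof -
  obtain s i where c: "c = (s, i)" by fastforce
  have "e \<in> M \<longleftrightarrow> e \<in> M'" if "e \<in> cell_edges c" for e using assms that by blast
  then have *: "(2 * s - 1, 2 * i - 1) \<in> M \<longleftrightarrow> (2 * s - 1, 2 * i - 1) \<in> M'"
    "(2 * s, 2 * i - 1) \<in> M \<longleftrightarrow> (2 * s, 2 * i - 1) \<in> M'"
    "(2 * s, 2 * i) \<in> M \<longleftrightarrow> (2 * s, 2 * i) \<in> M'"
    "(2 * s - 1, 2 * i) \<in> M \<longleftrightarrow> (2 * s - 1, 2 * i) \<in> M'" unfolding c by simp_all
  show "covN M c = covN M' c" "covE M c = covE M' c" "covS M c = covS M' c" "covW M c = covW M' c"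
    "cell_matching M c = cell_matching M' c"
    unfolding c covN.simps covE.simps covS.simps covW.simps cell_matching.simps * by (rule refl)+
qed

lemma compatible_cong:
  assumes "M \<subseteq> edge_box n" "M' \<subseteq> edge_box n" "\<And>c. cell_matching M c = cell_matching M' c"
    and "\<And>c. (covN M c \<noteq> (c \<in> P)) = (covN M' c \<noteq> (c \<in> P'))"
    and "\<And>c. (covE M c \<noteq> (c \<in> P)) = (covE M' c \<noteq> (c \<in> P'))"
    and "\<And>c. (covS M c \<noteq> (c \<in> P)) = (covS M' c \<noteq> (c \<in> P'))"
    and "\<And>c. (covW M c \<noteq> (c \<in> P)) = (covW M' c \<noteq> (c \<in> P'))"
  shows "compatible n P M \<longleftrightarrow> compatible n P' M'"
  unfolding compatible_def assms(3-7) using assms(1,2) by simp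

text \<open>The local symmetry behind urban renewal.\<close>

lemma compatible_flip:
  assumes c: "c \<in> grid n" "c \<notin> P" and A: "A \<subseteq> edge_box n - cell_edges c"
    and B: "B \<subseteq> cell_edges c" "B' \<subseteq> cell_edges c" "cell_matching B c" "cell_matching B' c"
    and N: "covN B' c = (\<not> covN B c)" and E: "covE B' c = (\<not> covE B c)"
    and S: "covS B' c = (\<not> covS B c)" and W: "covW B' c = (\<not> covW B c)"
  shows "compatible n P (A \<union> B) \<longleftrightarrow> compatible n (insert c P) (A \<union> B')"
proof -
  have 1: "(A \<union> B) \<inter> cell_edges x = (A \<union> B') \<inter> cell_edges x" if "x \<noteq> c" for x
    using B that by (auto simp: cell_edges_iff)
  have 2: "(A \<union> B) \<inter> cell_edges c = B \<inter> cell_edges c" "(A \<union> B') \<inter> cell_edges c = B' \<inter> cell_edges c"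
    using A by auto
  note * = covered_cong[OF 1] covered_cong[OF 2(1)] covered_cong[OF 2(2)]
  show ?thesis
  proof (rule compatible_cong)
    show "A \<union> B \<subseteq> edge_box n" "A \<union> B' \<subseteq> edge_box n"
      using A B cell_edges_subset_edge_box[OF c(1)] by auto
    show "cell_matching (A \<union> B) x = cell_matching (A \<union> B') x" for x
      using * B by (cases "x = c") auto
    show "(covN (A \<union> B) x \<noteq> (x \<in> P)) = (covN (A \<union> B') x \<noteq> (x \<in> insert c P))" for x
      using * N c by (cases "x = c") auto
    show "(covE (A \<union> B) x \<noteq> (x \<in> P)) = (covE (A \<union> B') x \<noteq> (x \<in> insert c P))" for x
      using * E c by (cases "x = c") auto
    show "(covS (A \<union> B) x \<noteq> (x \<in> P)) = (covS (A \<union> B') x \<noteq> (x \<in> insert c P))" for x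
      using * S c by (cases "x = c") auto
    show "(covW (A \<union> B) x \<noteq> (x \<in> P)) = (covW (A \<union> B') x \<noteq> (x \<in> insert c P))" for x
      using * W c by (cases "x = c") auto
  qed
qed

section \<open>Renewal of a single cell\<close>

fun cell_matchings :: "pos \<Rightarrow> pos set set" where
  "cell_matchings (s, i) = {{}, {(2 * s-1, 2 * i-1)}, {(2 * s, 2 * i-1)}, {(2 * s, 2 * i)}, {(2 * s-1, 2 * i)},
     {(2 * s-1, 2 * i-1), (2 * s, 2 * i)}, {(2 * s, 2 * i-1), (2 * s-1, 2 * i)}}"

lemma cell_matching_in_cell_matchings:
  assumes "cell_matching M c"
  shows "M \<inter> cell_edges c \<in> cell_matchings c"
proof -
  obtain s i where c: "c = (s, i)" by fastforce
  have "M \<inter> cell_edges c = (if (2 * s-1, 2 * i-1) \<in> M then {(2 * s-1, 2 * i-1)} else {}) \<union>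
      (if (2 * s, 2 * i-1) \<in> M then {(2 * s, 2 * i-1)} else {}) \<union>
      (if (2 * s, 2 * i) \<in> M then {(2 * s, 2 * i)} else {}) \<union>
      (if (2 * s-1, 2 * i) \<in> M then {(2 * s-1, 2 * i)} else {})"
    unfolding c by auto
  then show ?thesis using assms unfolding c by (auto split: if_splits)
qed

text \<open>Isolates the cell whose weights are about to change. A matching of its 4-cycle is one of
  seven sets, tied to the edges outside the cell only through \<open>compatible\<close>.\<close>

lemma dimer_sum_split:
  assumes "c \<in> grid n"
  shows "dimer_sum n P w = (\<Sum>A\<in>Pow (edge_box n - cell_edges c). \<Sum>B\<in>cell_matchings c.
           (if compatible n P (A \<union> B) then prod w A * prod w B else 0))"
proof -
  have sub: "\<And>B. B \<in> cell_matchings c \<Longrightarrow> B \<subseteq> cell_edges c" by (cases c) auto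
  have fin: "finite (cell_matchings c)" by (cases c) auto
  have "(\<Sum>A\<in>Pow (edge_box n - cell_edges c). \<Sum>B\<in>cell_matchings c.
           (if compatible n P (A \<union> B) then prod w A * prod w B else 0))
      = (\<Sum>x\<in>Pow (edge_box n - cell_edges c) \<times> cell_matchings c.
           (if compatible n P (fst x \<union> snd x) then prod w (fst x) * prod w (snd x) else 0))"
    by (simp add: sum.cartesian_product case_prod_beta)
  also have "\<dots> = (\<Sum>x\<in>{x \<in> Pow (edge_box n - cell_edges c) \<times> cell_matchings c. compatible n P (fst x \<union> snd x)}.
           prod w (fst x) * prod w (snd x))"
    using fin by (intro sum.inter_filter[symmetric]) simp
  also have "\<dots> = dimer_sum n P w" unfolding dimer_sum_def
  proof (rule sum.reindex_bij_witness[where i = "\<lambda>M. (M - cell_edges c, M \<inter> cell_edges c)" and j = "\<lambda>x. fst x \<union> snd x"])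
    fix x assume x: "x \<in> {x \<in> Pow (edge_box n - cell_edges c) \<times> cell_matchings c. compatible n P (fst x \<union> snd x)}"
    obtain A B where AB: "x = (A, B)" by fastforce
    have *: "A \<subseteq> edge_box n - cell_edges c" "B \<subseteq> cell_edges c" using x AB sub by auto
    then show "((fst x \<union> snd x) - cell_edges c, (fst x \<union> snd x) \<inter> cell_edges c) = x"
      using AB by auto
    show "fst x \<union> snd x \<in> {M. compatible n P M}" using x by simp
    have "finite A" "finite B" using * finite_subset[OF _ finite_edge_box] cell_edges_subset_edge_box[OF assms] by blast+
    then show "prod w (fst x \<union> snd x) = prod w (fst x) * prod w (snd x)"
      unfolding AB fst_conv snd_conv by (intro prod.union_disjoint) (use * in auto)
  next
    fix M assume "M \<in> {M. compatible n P M}"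
    then have M: "compatible n P M" "M \<subseteq> edge_box n" "cell_matching M c" using assms by (auto simp: compatible_def)
    have eq: "(M - cell_edges c) \<union> (M \<inter> cell_edges c) = M" by blast
    then show "fst (M - cell_edges c, M \<inter> cell_edges c) \<union> snd (M - cell_edges c, M \<inter> cell_edges c) = M" by simp
    show "(M - cell_edges c, M \<inter> cell_edges c)
        \<in> {x \<in> Pow (edge_box n - cell_edges c) \<times> cell_matchings c. compatible n P (fst x \<union> snd x)}"
      using cell_matching_in_cell_matchings[OF M(3)] M(1,2) eq by (simp del: cell_edges.simps) blast
  qed
  finally show ?thesis ..
qed

text \<open>The seven terms are the local matchings before and after the flip. \<open>v0\<close>
  says that the outside is completed by no edge, \<open>v2\<close> by two opposite edges; the flip
  exchanges these roles. The two pairs of opposite edges together weigh \<open>D\<close> before and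
  \<open>1 / D\<close> after, and a single edge trades its weight for that weight divided by
  \<open>D\<close>.\<close>

lemma renew_identity:
  fixes a b c d X D :: real
  assumes D: "D = a * c + b * d" and nz: "D \<noteq> 0"
  shows "(if v0 then X * 1 else 0) + (if va then X * a else 0) + (if vb then X * b else 0) +
      (if vc then X * c else 0) + (if vd then X * d else 0) + (if v2 then X * (a * c) else 0) +
      (if v2 then X * (b * d) else 0)
    = D * ((if v2 then X * 1 else 0) + (if vc then X * (c / D) else 0) + (if vd then X * (d / D) else 0) +
      (if va then X * (a / D) else 0) + (if vb then X * (b / D) else 0) + (if v0 then X * (c / D * (a / D)) else 0) +
      (if v0 then X * (d / D * (b / D)) else 0))"
proof -
  have "(if v0 then X * 1 else 0) =
      D * ((if v0 then X * (c / D * (a / D)) else 0) + (if v0 then X * (d / D * (b / D)) else 0))"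
  proof (cases v0)
    case True
    have "D * (X * (c / D * (a / D)) + X * (d / D * (b / D))) = X * (a * c + b * d) / D"
      using nz by (simp add: field_simps)
    also have "\<dots> = X" using nz by (simp flip: D)
    finally show ?thesis using True by simp
  qed simp
  moreover have "(if v2 then X * (a * c) else 0) + (if v2 then X * (b * d) else 0) = D * (if v2 then X * 1 else 0)"
    unfolding D by (simp add: algebra_simps)
  moreover have "(if v then X * x else 0) = D * (if v then X * (x / D) else 0)" for v x
    using nz by simp
  from this[of va a] this[of vb b] this[of vc c] this[of vd d]
  have "(if va then X * a else 0) + (if vb then X * b else 0) + (if vc then X * c else 0) + (if vd then X * d else 0)
    = D * ((if vc then X * (c / D) else 0) + (if vd then X * (d / D) else 0) +
      (if va then X * (a / D) else 0) + (if vb then X * (b / D) else 0))"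
    by (simp only: distrib_left)
  ultimately show ?thesis by (simp only: distrib_left)
qed

text \<open>A local matching and its flip cover complementary sets of sides: a single edge becomes
  the opposite edge, and the empty set corresponds to either pair of opposite edges. This is also
  why renewed weights are those of opposite edges.\<close>

lemma renew_cell:
  assumes c: "c \<in> grid n" "c \<notin> P" and nz: "Delta w c \<noteq> 0"
  shows "dimer_sum n P w = Delta w c * dimer_sum n (insert c P) (renewal {c} w)"
proof -
  obtain s i where si: "c = (s, i)" by fastforce
  define ea eb ec ed where e: "ea = (2 * s - 1, 2 * i - 1)" "eb = (2 * s, 2 * i - 1)" "ec = (2 * s, 2 * i)" "ed = (2 * s - 1, 2 * i)"
  define D where "D = Delta w c"
  define w' where "w' = renewal {c} w"
  have D: "D = w ea * w ec + w eb * w ed" by (simp add: si e D_def)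
  have op: "opposite ea = ec" "opposite eb = ed" "opposite ec = ea" "opposite ed = eb"
    "cell_of ea = c" "cell_of eb = c" "cell_of ec = c" "cell_of ed = c"
    unfolding si e by simp_all
  have w': "w' ea = w ec / D" "w' eb = w ed / D" "w' ec = w ea / D" "w' ed = w eb / D"
    by (simp_all only: renewal_def op insertI1 if_True w'_def D_def)
  have dist: "ea \<noteq> eb" "ea \<noteq> ec" "ea \<noteq> ed" "eb \<noteq> ec" "eb \<noteq> ed" "ec \<noteq> ed"
    unfolding e by simp_all
  have cm: "cell_matchings c = {{}, {ea}, {eb}, {ec}, {ed}, {ea, ec}, {eb, ed}}"
    unfolding si e by simp
  have "(\<Sum>B\<in>cell_matchings c. (if compatible n P (A \<union> B) then prod w A * prod w B else 0))
      = D * (\<Sum>B\<in>cell_matchings c. (if compatible n (insert c P) (A \<union> B) then prod w' A * prod w' B else 0))"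
    if A: "A \<subseteq> edge_box n - cell_edges c" for A
  proof -
    let ?v = "\<lambda>B. compatible n P (A \<union> B)" and ?v' = "\<lambda>B. compatible n (insert c P) (A \<union> B)"
    have cell_weight: "prod w' A = prod w A"
      by (rule prod.cong) (use A in \<open>auto simp: renewal_def w'_def cell_edges_iff simp del: cell_edges.simps cell_of.simps\<close>)
    note f = compatible_flip[OF c A]
    have v: "?v {} = ?v' {ea, ec}" "?v {} = ?v' {eb, ed}" "?v {ea} = ?v' {ec}" "?v {eb} = ?v' {ed}"
      "?v {ec} = ?v' {ea}" "?v {ed} = ?v' {eb}" "?v {ea, ec} = ?v' {}" "?v {eb, ed} = ?v' {}"
      by (rule f; simp add: si e)+
    have s: "(\<Sum>B\<in>cell_matchings c. F B) = F {} + F {ea} + F {eb} + F {ec} + F {ed} + F {ea, ec} + F {eb, ed}"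
      for F :: "pos set \<Rightarrow> real"
      unfolding cm using dist by (simp add: doubleton_eq_iff)
    have p: "prod u {ea, ec} = u ea * u ec" "prod u {eb, ed} = u eb * u ed" "prod u {ea} = u ea"
      "prod u {eb} = u eb" "prod u {ec} = u ec" "prod u {ed} = u ed" "prod u {} = 1"
      for u :: "pos \<Rightarrow> real"
      using dist by simp_all
    \<comment> \<open>Both pairs of opposite edges cover all four sides, so the outside cannot tell
      them apart.\<close>
    have v8: "?v {eb, ed} = ?v {ea, ec}" using v by simp
    show ?thesis unfolding s cell_weight p w' v8 v(3-7)[symmetric] v(1,2)[symmetric]
      by (rule renew_identity[OF D]) (use nz D_def in simp)
  qed
  then have "dimer_sum n P w = (\<Sum>A\<in>Pow (edge_box n - cell_edges c). D * (\<Sum>B\<in>cell_matchings c.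
      (if compatible n (insert c P) (A \<union> B) then prod w' A * prod w' B else 0)))"
    unfolding dimer_sum_split[OF c(1)] by (intro sum.cong[OF refl]) (simp only: Pow_iff)
  also have "\<dots> = D * dimer_sum n (insert c P) w'"
    unfolding dimer_sum_split[OF c(1)] by (rule sum_distrib_left[symmetric])
  finally show ?thesis unfolding w'_def D_def .
qed

section \<open>Simultaneous renewal of several cells\<close>

lemma Delta_renew: "c \<notin> Q \<Longrightarrow> Delta (renewal Q w) c = Delta w c"
  by (cases c) (simp add: renewal_def)

lemma cell_of_opposite [simp]: "cell_of (opposite e) = cell_of e"
proof -
  obtain h r where "e = (h, r)" by fastforce
  moreover have "(4 * ((h + 1) div 2) - 1 - h + 1) div 2 = (h + 1) div 2" for h :: int
  proof -
    define q where "q = (h + 1) div 2"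
    then have "h = 2 * q \<or> h = 2 * q - 1" by presburger
    then show ?thesis unfolding q_def[symmetric] by auto
  qed
  ultimately show ?thesis by simp
qed

lemma renew_insert:
  assumes "c \<notin> Q"
  shows "renewal {c} (renewal Q w) = renewal (insert c Q) w"
proof
  fix e
  have "Delta (renewal Q w) c = Delta w c" using assms by (rule Delta_renew)
  then show "renewal {c} (renewal Q w) e = renewal (insert c Q) w e"
    using assms by (auto simp: renewal_def simp del: cell_of.simps opposite.simps Delta.simps)
qed

lemma renew_cells:
  assumes "finite Q" "Q \<subseteq> grid n" "Q \<inter> P = {}" "\<And>c. c \<in> Q \<Longrightarrow> Delta w c \<noteq> 0"
  shows "dimer_sum n P w = (\<Prod>c\<in>Q. Delta w c) * dimer_sum n (P \<union> Q) (renewal Q w)"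
  using assms
proof (induction Q)
  case empty
  have "renewal {} w = w" by (auto simp: renewal_def)
  then show ?case by simp
next
  case (insert c Q)
  have "dimer_sum n P w = (\<Prod>c\<in>Q. Delta w c) * dimer_sum n (P \<union> Q) (renewal Q w)"
    using insert by auto
  also have "dimer_sum n (P \<union> Q) (renewal Q w) = Delta w c * dimer_sum n (insert c (P \<union> Q)) (renewal (insert c Q) w)"
    using renew_cell[of c n "P \<union> Q" "renewal Q w"] insert
    by (simp add: Delta_renew renew_insert)
  finally show ?case using insert by (simp add: mult_ac)
qed

section \<open>Unflipped and completely flipped grids as Aztec diamonds\<close>

declare covN.simps [simp del] covE.simps [simp del] covS.simps [simp del] covW.simps [simp del]
  cell_matching.simps [simp del]

text \<open>A vertex of the diamond is a side shared by two neighbouring cells. The four positions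
  are the edges that meet there, two from each cell.\<close>

definition exactly_one :: "pos set \<Rightarrow> int \<Rightarrow> int \<Rightarrow> bool" where
  "exactly_one M h r \<longleftrightarrow> (\<exists>!e. e \<in> {h, h + 1} \<times> {r, r + 1} \<and> e \<in> M)"

definition perfect_matching :: "int \<Rightarrow> pos set \<Rightarrow> bool" where
  "perfect_matching n M \<longleftrightarrow> M \<subseteq> edge_box n
    \<and> (\<forall>s\<in>{0..n}. \<forall>i\<in>{1..n}. exactly_one M (2 * s) (2 * i - 1)) \<and>
     (\<forall>s\<in>{1..n}. \<forall>i\<in>{0..n}. exactly_one M (2 * s - 1) (2 * i))"

lemma ex1_four:
  assumes "a \<noteq> b" "a \<noteq> c" "a \<noteq> d" "b \<noteq> c" "b \<noteq> d" "c \<noteq> d"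
  shows "(\<exists>!e. e \<in> {a, b, c, d} \<and> e \<in> M) \<longleftrightarrow> (a \<in> M \<or> b \<in> M \<or> c \<in> M \<or> d \<in> M) \<and>
    \<not> (a \<in> M \<and> b \<in> M) \<and> \<not> (a \<in> M \<and> c \<in> M) \<and> \<not> (a \<in> M \<and> d \<in> M) \<and>
    \<not> (b \<in> M \<and> c \<in> M) \<and> \<not> (b \<in> M \<and> d \<in> M) \<and> \<not> (c \<in> M \<and> d \<in> M)"
  using assms unfolding Ex1_def insert_iff empty_iff by (smt (verit, del_insts))

lemma exactly_one_iff:
  "exactly_one M h r \<longleftrightarrow> ((h, r) \<in> M \<or> (h + 1, r) \<in> M \<or> (h, r + 1) \<in> M \<or> (h + 1, r + 1) \<in> M) \<and>
     \<not> ((h, r) \<in> M \<and> (h + 1, r) \<in> M) \<and> \<not> ((h, r) \<in> M \<and> (h, r + 1) \<in> M) \<and> \<not> ((h, r) \<in> M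
       \<and> (h + 1, r + 1) \<in> M) \<and>
     \<not> ((h + 1, r) \<in> M \<and> (h, r + 1) \<in> M) \<and> \<not> ((h + 1, r) \<in> M \<and> (h + 1, r + 1) \<in> M) \<and>
     \<not> ((h, r + 1) \<in> M \<and> (h + 1, r + 1) \<in> M)"
proof -
  have "{h, h + 1} \<times> {r, r + 1} = {(h, r), (h + 1, r), (h, r + 1), (h + 1, r + 1)}" by auto
  then show ?thesis unfolding exactly_one_def
    using ex1_four[of "(h, r)" "(h + 1, r)" "(h, r + 1)" "(h + 1, r + 1)" M] by simp
qed

lemma exactly_one_E: "exactly_one M (2 * s) (2 * i - 1) \<longleftrightarrow>
    \<not> ((2 * s, 2 * i - 1) \<in> M \<and> (2 * s, 2 * i) \<in> M) \<and> \<not> ((2 * (s + 1) - 1, 2 * i - 1) \<in> M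
      \<and> (2 * (s + 1) - 1, 2 * i) \<in> M) \<and>
    covE M (s, i) \<noteq> covW M (s + 1, i)"
proof -
  have e: "2 * (s + 1) - 1 = 2 * s + 1" "2 * i - 1 + 1 = 2 * i" by simp_all
  show ?thesis unfolding exactly_one_iff covE.simps covW.simps e by argo
qed

lemma exactly_one_S: "exactly_one M (2 * s - 1) (2 * i) \<longleftrightarrow>
    \<not> ((2 * s - 1, 2 * i) \<in> M \<and> (2 * s, 2 * i) \<in> M) \<and> \<not> ((2 * s - 1, 2 * (i + 1) - 1) \<in> M
      \<and> (2 * s, 2 * (i + 1) - 1) \<in> M) \<and>
    covS M (s, i) \<noteq> covN M (s, i + 1)"
proof -
  have e: "2 * (i + 1) - 1 = 2 * i + 1" "2 * s - 1 + 1 = 2 * s" by simp_all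
  show ?thesis unfolding exactly_one_iff covS.simps covN.simps e by argo
qed

lemma outside_grid:
  assumes "M \<subseteq> edge_box n" "c \<notin> grid n"
  shows "\<not> covN M c" "\<not> covE M c" "\<not> covS M c" "\<not> covW M c" "cell_matching M c"
proof -
  obtain s i where c: "c = (s, i)" by fastforce
  have "e \<notin> M" if "e \<in> cell_edges c" for e
    using that assms unfolding c grid_def edge_box_def by auto
  then show "\<not> covN M c" "\<not> covE M c" "\<not> covS M c" "\<not> covW M c" "cell_matching M c"
    unfolding c covN.simps covE.simps covS.simps covW.simps cell_matching.simps by simp_all
qed

text \<open>With nothing flipped, the gluing rule says that a vertex is reached from exactly one of
  its two cells, and \<open>cell_matching\<close> forbids two edges from that cell. At the border
  the missing cell counts as one that never reaches the vertex.\<close>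

lemma compatible_empty_iff: "compatible n {} M \<longleftrightarrow> perfect_matching n M"
proof
  assume v: "compatible n {} M"
  have box: "M \<subseteq> edge_box n" and "\<forall>c\<in>grid n. cell_matching M c"
    and E: "\<And>s i. s \<in> {0..n} \<Longrightarrow> i \<in> {1..n} \<Longrightarrow> covE M (s, i) \<noteq> covW M (s + 1, i)"
    and S: "\<And>s i. s \<in> {1..n} \<Longrightarrow> i \<in> {0..n} \<Longrightarrow> covS M (s, i) \<noteq> covN M (s, i + 1)"
    using v unfolding compatible_def by simp_all
  then have cm: "cell_matching M c" for c using outside_grid(5) by blast
  have "exactly_one M (2 * s) (2 * i - 1)" if "s \<in> {0..n}" "i \<in> {1..n}" for s i
    unfolding exactly_one_E using E[OF that] cm[of "(s, i)"] cm[of "(s + 1, i)"] unfolding cell_matching.simps by blast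
  moreover have "exactly_one M (2 * s - 1) (2 * i)" if "s \<in> {1..n}" "i \<in> {0..n}" for s i
    unfolding exactly_one_S using S[OF that] cm[of "(s, i)"] cm[of "(s, i + 1)"] unfolding cell_matching.simps by blast
  ultimately show "perfect_matching n M" unfolding perfect_matching_def using box by blast
next
  assume p: "perfect_matching n M"
  have box: "M \<subseteq> edge_box n"
    and E: "\<And>s i. s \<in> {0..n} \<Longrightarrow> i \<in> {1..n} \<Longrightarrow> exactly_one M (2 * s) (2 * i - 1)"
    and S: "\<And>s i. s \<in> {1..n} \<Longrightarrow> i \<in> {0..n} \<Longrightarrow> exactly_one M (2 * s - 1) (2 * i)"
    using p unfolding perfect_matching_def by simp_all
  have "cell_matching M (s, i)" if "s \<in> {1..n}" "i \<in> {1..n}" for s i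
    using E[of s i, unfolded exactly_one_E] E[of "s - 1" i, unfolded exactly_one_E] S[of s i, unfolded exactly_one_S]
      S[of s "i - 1", unfolded exactly_one_S] that by (simp add: cell_matching.simps) blast
  then show "compatible n {} M"
    unfolding compatible_def grid_def using box E[unfolded exactly_one_E] S[unfolded exactly_one_S] by simp
qed

definition inner_matching :: "int \<Rightarrow> pos set \<Rightarrow> bool" where
  "inner_matching n M \<longleftrightarrow> M \<subseteq> {2..2 * n - 1} \<times> {2..2 * n - 1} \<and>
     (\<forall>s\<in>{1..n-1}. \<forall>i\<in>{1..n}. exactly_one M (2 * s) (2 * i - 1)) \<and>
     (\<forall>s\<in>{1..n}. \<forall>i\<in>{1..n-1}. exactly_one M (2 * s - 1) (2 * i))"

text \<open>Two flipped cells are glued like two unflipped ones. Along the border, however, a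
  flipped cell faces an empty unflipped one, so its outward side must stay uncovered. This removes
  all edges in the outermost half-columns and half-rows.\<close>

lemma compatible_grid_iff:
  assumes "n \<ge> 1"
  shows "compatible n (grid n) M \<longleftrightarrow> inner_matching n M"
proof
  assume v: "compatible n (grid n) M"
  have box: "M \<subseteq> edge_box n" and "\<forall>c\<in>grid n. cell_matching M c"
    and E: "\<And>s i. s \<in> {0..n} \<Longrightarrow> i \<in> {1..n} \<Longrightarrow> (covE M (s, i) \<noteq> ((s, i)
      \<in> grid n)) \<noteq> (covW M (s + 1, i) \<noteq> ((s + 1, i) \<in> grid n))"
    and S: "\<And>s i. s \<in> {1..n} \<Longrightarrow> i \<in> {0..n} \<Longrightarrow> (covS M (s, i) \<noteq> ((s, i)
      \<in> grid n)) \<noteq> (covN M (s, i + 1) \<noteq> ((s, i + 1) \<in> grid n))"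
    using v unfolding compatible_def by blast+
  then have cm: "cell_matching M c" for c using outside_grid(5) by blast
  have g: "(s, i) \<in> grid n \<longleftrightarrow> 1 \<le> s \<and> s \<le> n \<and> 1 \<le> i \<and> i \<le> n" for s i by (auto simp: grid_def)
  have W1: "\<not> covW M (1, i)" if "i \<in> {1..n}" for i
    using E[of 0 i] outside_grid(2)[OF box, of "(0, i)"] that assms by (simp add: g)
  have En: "\<not> covE M (n, i)" if "i \<in> {1..n}" for i
    using E[of n i] outside_grid(4)[OF box, of "(n + 1, i)"] that assms by (simp add: g)
  have N1: "\<not> covN M (s, 1)" if "s \<in> {1..n}" for s
    using S[of s 0] outside_grid(3)[OF box, of "(s, 0)"] that assms by (simp add: g)
  have Sn: "\<not> covS M (s, n)" if "s \<in> {1..n}" for s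
    using S[of s n] outside_grid(1)[OF box, of "(s, n + 1)"] that assms by (simp add: g)
  have "M \<subseteq> {2..2 * n - 1} \<times> {2..2 * n - 1}"
  proof
    fix e assume e: "e \<in> M"
    obtain h r where hr: "e = (h, r)" by fastforce
    have b: "1 \<le> h" "h \<le> 2 * n" "1 \<le> r" "r \<le> 2 * n" using e box hr by (auto simp: edge_box_def)
    have "1 \<le> (r + 1) div 2 \<and> (r + 1) div 2 \<le> n" "1 \<le> (h + 1) div 2 \<and> (h + 1) div 2 \<le> n"
      using b by presburger+
    then have r: "r = 2 * ((r + 1) div 2) - 1 \<or> r = 2 * ((r + 1) div 2)" "(r + 1) div 2 \<in> {1..n}"
      and h: "h = 2 * ((h + 1) div 2) - 1 \<or> h = 2 * ((h + 1) div 2)" "(h + 1) div 2 \<in> {1..n}"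
      by (presburger, simp, presburger, simp)
    have "h \<noteq> 1" using W1[OF r(2)] e r(1) unfolding hr covW.simps by auto
    moreover have "h \<noteq> 2 * n" using En[OF r(2)] e r(1) unfolding hr covE.simps by auto
    moreover have "r \<noteq> 1" using N1[OF h(2)] e h(1) unfolding hr covN.simps by auto
    moreover have "r \<noteq> 2 * n" using Sn[OF h(2)] e h(1) unfolding hr covS.simps by auto
    ultimately show "e \<in> {2..2 * n - 1} \<times> {2..2 * n - 1}" using b hr by auto
  qed
  moreover have "exactly_one M (2 * s) (2 * i - 1)" if "s \<in> {1..n-1}" "i \<in> {1..n}" for s i
    unfolding exactly_one_E using E[of s i] cm[of "(s, i)"] cm[of "(s + 1, i)"] that
    by (simp add: g cell_matching.simps) blast
  moreover have "exactly_one M (2 * s - 1) (2 * i)" if "s \<in> {1..n}" "i \<in> {1..n-1}" for s i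
    unfolding exactly_one_S using S[of s i] cm[of "(s, i)"] cm[of "(s, i + 1)"] that
    by (simp add: g cell_matching.simps) blast
  ultimately show "inner_matching n M" by (simp add: inner_matching_def)
next
  assume p: "inner_matching n M"
  have sub: "M \<subseteq> {2..2 * n - 1} \<times> {2..2 * n - 1}"
    and E: "\<And>s i. s \<in> {1..n-1} \<Longrightarrow> i \<in> {1..n} \<Longrightarrow> exactly_one M (2 * s) (2 * i - 1)"
    and S: "\<And>s i. s \<in> {1..n} \<Longrightarrow> i \<in> {1..n-1} \<Longrightarrow> exactly_one M (2 * s - 1) (2 * i)"
    using p unfolding inner_matching_def by blast+
  have box: "M \<subseteq> edge_box n" using sub unfolding edge_box_def by fastforce
  have g: "(s, i) \<in> grid n \<longleftrightarrow> 1 \<le> s \<and> s \<le> n \<and> 1 \<le> i \<and> i \<le> n" for s i by (auto simp: grid_def)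
  have out: "(h, r) \<notin> M" if "h \<le> 1 \<or> h \<ge> 2 * n \<or> r \<le> 1 \<or> r \<ge> 2 * n" for h r using sub that by auto
  have "cell_matching M (s, i)" if "s \<in> {1..n}" "i \<in> {1..n}" for s i
  proof -
    have 1: "\<not> ((2 * s, 2 * i - 1) \<in> M \<and> (2 * s, 2 * i) \<in> M)"
      using E[of s i, unfolded exactly_one_E] that out[of "2 * s"] by (cases "s = n") auto
    have 2: "\<not> ((2 * s - 1, 2 * i - 1) \<in> M \<and> (2 * s - 1, 2 * i) \<in> M)"
      using E[of "s - 1" i, unfolded exactly_one_E] that out[of "2 * s - 1"] by (cases "s = 1") auto
    have 3: "\<not> ((2 * s - 1, 2 * i) \<in> M \<and> (2 * s, 2 * i) \<in> M)"
      using S[of s i, unfolded exactly_one_S] that out[of _ "2 * i"] by (cases "i = n") auto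
    have 4: "\<not> ((2 * s - 1, 2 * i - 1) \<in> M \<and> (2 * s, 2 * i - 1) \<in> M)"
      using S[of s "i - 1", unfolded exactly_one_S] that out[of _ "2 * i - 1"] by (cases "i = 1") auto
    show ?thesis unfolding cell_matching.simps using 1 2 3 4 by blast
  qed
  moreover have "(covE M (s, i) \<noteq> ((s, i) \<in> grid n)) \<noteq> (covW M (s + 1, i) \<noteq> ((s + 1, i) \<in> grid n))"
    if "s \<in> {0..n}" "i \<in> {1..n}" for s i
  proof -
    have "s = 0 \<or> s = n \<or> s \<in> {1..n-1}" using that by auto
    then consider "s = 0" | "s = n" | "s \<in> {1..n-1}" by blast
    then show ?thesis
    proof cases
      case 1
      then show ?thesis using that assms out by (simp add: g covE.simps covW.simps)
    next
      case 2
      then show ?thesis using that assms out by (simp add: g covE.simps covW.simps)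
    next
      case 3
      then show ?thesis using that E[of s i, unfolded exactly_one_E] by (simp add: g)
    qed
  qed
  moreover have "(covS M (s, i) \<noteq> ((s, i) \<in> grid n)) \<noteq> (covN M (s, i + 1) \<noteq> ((s, i + 1) \<in> grid n))"
    if "s \<in> {1..n}" "i \<in> {0..n}" for s i
  proof -
    have "i = 0 \<or> i = n \<or> i \<in> {1..n-1}" using that by auto
    then consider "i = 0" | "i = n" | "i \<in> {1..n-1}" by blast
    then show ?thesis
    proof cases
      case 1
      then show ?thesis using that assms out by (simp add: g covS.simps covN.simps)
    next
      case 2
      then show ?thesis using that assms out by (simp add: g covS.simps covN.simps)
    next
      case 3
      then show ?thesis using that S[of s i, unfolded exactly_one_S] by (simp add: g)
    qed
  qed
  ultimately show "compatible n (grid n) M"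
    unfolding compatible_def using box by (simp add: grid_def)
qed

definition diag_shift :: "pos \<Rightarrow> pos" where "diag_shift e = (fst e + 1, snd e + 1)"

lemma inj_diag_shift: "inj diag_shift"
  by (auto simp: inj_def diag_shift_def prod_eq_iff)

lemma diag_shift_in_iff: "(h, r) \<in> diag_shift ` M \<longleftrightarrow> (h - 1, r - 1) \<in> M"
proof
  assume "(h - 1, r - 1) \<in> M"
  then have "diag_shift (h - 1, r - 1) \<in> diag_shift ` M" by (rule imageI)
  then show "(h, r) \<in> diag_shift ` M" by (simp add: diag_shift_def)
qed (auto simp: diag_shift_def)

lemma exactly_one_diag_shift: "exactly_one (diag_shift ` M) h r \<longleftrightarrow> exactly_one M (h - 1) (r - 1)"
proof -
  have e: "h - 1 + 1 = h + 1 - 1" "r - 1 + 1 = r + 1 - 1" by simp_all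
  show ?thesis unfolding exactly_one_iff diag_shift_in_iff e by (rule refl)
qed

text \<open>Once the outer ring is gone, the four edges around a corner between four cells form a
  cell of the smaller diamond. The two kinds of vertices thereby exchange their roles, and
  \<open>diag_shift\<close> realigns the parities.\<close>

lemma inner_perfect_shift: "inner_matching n (diag_shift ` M) \<longleftrightarrow> perfect_matching (n - 1) M"
proof -
  have 1: "diag_shift ` M \<subseteq> {2..2 * n - 1} \<times> {2..2 * n - 1} \<longleftrightarrow> M \<subseteq> edge_box (n - 1)"
  proof -
    have "diag_shift e \<in> {2..2 * n - 1} \<times> {2..2 * n - 1} \<longleftrightarrow> e \<in> edge_box (n - 1)" for e
      by (cases e) (auto simp: diag_shift_def edge_box_def)
    then show ?thesis by (simp add: image_subset_iff subset_eq del: mem_Times_iff)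
  qed
  have 2: "(\<forall>s\<in>{1..n-1}. \<forall>i\<in>{1..n}. exactly_one (diag_shift ` M) (2 * s) (2 * i - 1)) \<longleftrightarrow>
      (\<forall>s\<in>{1..n-1}. \<forall>i\<in>{0..n-1}. exactly_one M (2 * s - 1) (2 * i))" (is "?l \<longleftrightarrow> ?r")
  proof
    assume l: ?l
    show ?r
    proof (intro ballI)
      fix s i assume "s \<in> {1..n-1}" "i \<in> {0..n-1}"
      then have "exactly_one (diag_shift ` M) (2 * s) (2 * (i + 1) - 1)" by (intro l[rule_format]) auto
      then show "exactly_one M (2 * s - 1) (2 * i)" unfolding exactly_one_diag_shift by simp
    qed
  next
    assume r: ?r
    show ?l
    proof (intro ballI)
      fix s i assume "s \<in> {1..n-1}" "i \<in> {1..n}"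
      then have "exactly_one M (2 * s - 1) (2 * (i - 1))" by (intro r[rule_format]) auto
      then show "exactly_one (diag_shift ` M) (2 * s) (2 * i - 1)" unfolding exactly_one_diag_shift by (simp add: algebra_simps)
    qed
  qed
  have 3: "(\<forall>s\<in>{1..n}. \<forall>i\<in>{1..n-1}. exactly_one (diag_shift ` M) (2 * s - 1) (2 * i)) \<longleftrightarrow>
      (\<forall>s\<in>{0..n-1}. \<forall>i\<in>{1..n-1}. exactly_one M (2 * s) (2 * i - 1))" (is "?l \<longleftrightarrow> ?r")
  proof
    assume l: ?l
    show ?r
    proof (intro ballI)
      fix s i assume "s \<in> {0..n-1}" "i \<in> {1..n-1}"
      then have "exactly_one (diag_shift ` M) (2 * (s + 1) - 1) (2 * i)" by (intro l[rule_format]) auto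
      then show "exactly_one M (2 * s) (2 * i - 1)" unfolding exactly_one_diag_shift by simp
    qed
  next
    assume r: ?r
    show ?l
    proof (intro ballI)
      fix s i assume "s \<in> {1..n}" "i \<in> {1..n-1}"
      then have "exactly_one M (2 * (s - 1)) (2 * i - 1)" by (intro r[rule_format]) auto
      then show "exactly_one (diag_shift ` M) (2 * s - 1) (2 * i)" unfolding exactly_one_diag_shift by (simp add: algebra_simps)
    qed
  qed
  show ?thesis unfolding inner_matching_def perfect_matching_def 1 2 3 by blast
qed

lemma dimer_sum_grid:
  assumes "n \<ge> 1"
  shows "dimer_sum n (grid n) w = dimer_sum (n - 1) {} (w \<circ> diag_shift)"
  unfolding dimer_sum_def compatible_grid_iff[OF assms] compatible_empty_iff
proof (rule sum.reindex_bij_witness[where i = "image diag_shift" and j = "vimage diag_shift"])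
  have surj: "surj diag_shift"
    by (rule surjI[where f = "\<lambda>e. (fst e - 1, snd e - 1)"]) (simp add: diag_shift_def)
  fix M
  show *: "diag_shift ` (diag_shift -` M) = M" by (rule surj_image_vimage_eq[OF surj])
  show "diag_shift -` M \<in> {M. perfect_matching (n - 1) M}" if "M \<in> {M. inner_matching n M}"
    using that inner_perfect_shift[of n "diag_shift -` M"] * by simp
  show "prod (w \<circ> diag_shift) (diag_shift -` M) = prod w M"
    using prod.reindex[of diag_shift "diag_shift -` M" w] inj_diag_shift * by (simp add: inj_on_subset)
qed (use inner_perfect_shift inj_diag_shift in \<open>auto simp: inj_vimage_image_eq\<close>)

lemma dimer_sum_step:
  assumes "n \<ge> 1" "\<And>c. c \<in> grid n \<Longrightarrow> Delta w c \<noteq> 0"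
  shows "dimer_sum n {} w = (\<Prod>c\<in>grid n. Delta w c) * dimer_sum (n - 1) {} (renewal (grid n) w \<circ> diag_shift)"
  using renew_cells[of "grid n" n "{}" w] assms dimer_sum_grid[OF assms(1)] by simp

text \<open>Each vertex between two columns is matched exactly once, so rescaling all edges at such a column of
  vertices only contributes a power of the scale.\<close>

lemma dimer_sum_gauge:
  "dimer_sum n {} (\<lambda>e. f (fst e div 2) * w e) = (\<Prod>s\<in>{0..n}. f s ^ nat n) * dimer_sum n {} w"
  unfolding dimer_sum_def sum_distrib_left compatible_empty_iff
proof (rule sum.cong[OF refl])
  fix M assume "M \<in> {M. perfect_matching n M}"
  then have box: "M \<subseteq> edge_box n" and one: "\<And>s i. s \<in> {0..n} \<Longrightarrow> i \<in> {1..n}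
    \<Longrightarrow> exactly_one M (2 * s) (2 * i - 1)"
    unfolding perfect_matching_def by blast+
  \<comment> \<open>\<open>?g\<close> names the end of an edge that lies between columns
    \<open>s\<close> and \<open>s + 1\<close>; every edge has exactly one such end.\<close>
  let ?g = "\<lambda>e::pos. (fst e div 2, (snd e + 1) div 2)"
  have mem: "e \<in> {2 * s, 2 * s + 1} \<times> {2 * i - 1, 2 * i - 1 + 1} \<longleftrightarrow> ?g e = (s, i)" for e s i
  proof -
    have "fst e div 2 = s \<longleftrightarrow> fst e = 2 * s \<or> fst e = 2 * s + 1" by presburger
    moreover have "(snd e + 1) div 2 = i \<longleftrightarrow> snd e = 2 * i - 1 \<or> snd e = 2 * i - 1 + 1" by presburger
    ultimately show ?thesis unfolding mem_Times_iff insert_iff empty_iff prod.inject by simp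
  qed
  have u: "\<exists>!e. ?g e = p \<and> e \<in> M" if p: "p \<in> {0..n} \<times> {1..n}" for p
  proof -
    obtain s i where si: "p = (s, i)" "s \<in> {0..n}" "i \<in> {1..n}" using p by blast
    show ?thesis using one[OF si(2,3)] unfolding exactly_one_def mem si(1) .
  qed
  have g: "?g e \<in> {0..n} \<times> {1..n}" if "e \<in> M" for e
  proof -
    obtain h r where e: "e = (h, r)" by fastforce
    then have "1 \<le> h" "h \<le> 2 * n" "1 \<le> r" "r \<le> 2 * n" using that box by (auto simp: edge_box_def)
    then show ?thesis unfolding e by auto
  qed
  have "bij_betw ?g M ({0..n} \<times> {1..n})"
    unfolding bij_betw_def
  proof
    show "inj_on ?g M" by (rule inj_onI) (metis (no_types, lifting) u g)
    show "?g ` M = {0..n} \<times> {1..n}"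
    proof
      show "?g ` M \<subseteq> {0..n} \<times> {1..n}" using g by blast
      show "{0..n} \<times> {1..n} \<subseteq> ?g ` M" using ex1_implies_ex[OF u] by (metis (no_types, lifting) image_eqI subsetI)
    qed
  qed
  then have "(\<Prod>e\<in>M. f (fst e div 2)) = (\<Prod>p\<in>{0..n} \<times> {1..n}. f (fst p))"
    using prod.reindex_bij_betw[of ?g M "{0..n} \<times> {1..n}" "\<lambda>p. f (fst p)"] by simp
  also have "\<dots> = (\<Prod>s\<in>{0..n}. \<Prod>i\<in>{1..n}. f s)"
    by (subst prod.cartesian_product) (simp add: case_prod_beta)
  finally show "(\<Prod>e\<in>M. f (fst e div 2) * w e) = (\<Prod>s\<in>{0..n}. f s ^ nat n) * prod w M"
    by (simp add: prod.distrib)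
qed

lemma dimer_sum_0: "dimer_sum 0 {} w = 1"
proof -
  have "{M. compatible 0 {} M} = {{}}" by (auto simp: compatible_def edge_box_def grid_def)
  then show ?thesis by (simp add: dimer_sum_def)
qed

section \<open>Two-periodic weights\<close>

declare cell_of.simps [simp del] opposite.simps [simp del] Delta.simps [simp del]

lemma dimer_sum_cong: "(\<And>e. e \<in> edge_box n \<Longrightarrow> w e = w' e) \<Longrightarrow> dimer_sum n P w = dimer_sum n P w'"
  unfolding dimer_sum_def by (intro sum.cong prod.cong refl) (auto simp: compatible_def)

definition half_unless :: "bool \<Rightarrow> real" where "half_unless b = (if b then 1 else 1/2)"

text \<open>After renewal the cells are the former corners between four cells, hence two kinds of weights:
  \<open>cell_weight\<close> is constant on the two edges of a half-column in a cell, \<open>corner_weight\<close> around a corner.\<close>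

definition cell_weight :: "(int \<Rightarrow> bool) \<Rightarrow> pos \<Rightarrow> real" where
  "cell_weight \<sigma> e = half_unless (\<sigma> (fst e) = odd ((snd e + 1) div 2))"

definition corner_weight :: "(int \<Rightarrow> bool) \<Rightarrow> pos \<Rightarrow> real" where
  "corner_weight \<sigma> e = half_unless (\<sigma> (fst e) = even (snd e div 2))"

definition interleave :: "(int \<Rightarrow> bool) \<Rightarrow> (int \<Rightarrow> bool) \<Rightarrow> int \<Rightarrow> bool" where
  "interleave \<alpha> \<beta> h = (if odd h then \<alpha> ((h + 1) div 2) else \<beta> (h div 2))"

definition corner_factor :: "bool \<Rightarrow> bool \<Rightarrow> real" where "corner_factor a b = (if a = b then 1 else 5/4)"

lemma interleave_simps: "interleave \<alpha> \<beta> (2 * s - 1) = \<alpha> s" "interleave \<alpha> \<beta> (2 * s) = \<beta> s"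
  by (simp_all add: interleave_def)

lemma half_unless_nonzero [simp]: "half_unless b \<noteq> 0" and corner_factor_nonzero [simp]: "corner_factor a b \<noteq> 0"
  by (simp_all add: half_unless_def corner_factor_def)

text \<open>The cancellation behind all telescoping below: the weights of complementary phases
  multiply to 1/2.\<close>

lemma half_unless_Not: "half_unless (\<not> b) = 1 / (2 * half_unless b)"
  by (simp add: half_unless_def)

text \<open>Rows of opposite parity are paired; for odd \<open>n\<close> the unpaired row is an odd
  one, hence \<open>f True\<close>.\<close>

lemma prod_alternating:
  fixes f :: "bool \<Rightarrow> real"
  shows "(\<Prod>i\<in>{1..int n}. f (odd i)) = (f True * f False) ^ (n div 2) * (if even n then 1 else f True)"
proof (induction n)
  case (Suc n)
  have "{1..int (Suc n)} = insert (int (Suc n)) {1..int n}" by auto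
  then have *: "(\<Prod>i\<in>{1..int (Suc n)}. f (odd i)) = f (even n) * (\<Prod>i\<in>{1..int n}. f (odd i))"
    by simp
  show ?case
  proof (cases "even n")
    case True
    then show ?thesis unfolding * Suc.IH by simp
  next
    case False
    then have "Suc n div 2 = Suc (n div 2)" by presburger
    with False show ?thesis unfolding * Suc.IH by simp
  qed
qed simp

lemma prod_grid: "(\<Prod>c\<in>grid n. F c) = (\<Prod>s\<in>{1..n}. \<Prod>i\<in>{1..n}. F (s, i))" for F :: "pos \<Rightarrow> real"
  unfolding grid_def by (subst prod.cartesian_product) simp

lemma edge_box_cases:
  assumes "e \<in> edge_box n"
  obtains s i where "s \<in> {1..n}" "i \<in> {1..n}"
    "e = (2 * s - 1, 2 * i - 1) \<or> e = (2 * s, 2 * i - 1) \<or> e = (2 * s, 2 * i) \<or> e = (2 * s - 1, 2 * i)"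
proof -
  obtain s i where si: "cell_of e = (s, i)" by fastforce
  then have "e \<in> cell_edges (s, i)" by (simp only: cell_edges_iff)
  then have *: "e = (2 * s - 1, 2 * i - 1) \<or> e = (2 * s, 2 * i - 1) \<or> e = (2 * s, 2 * i) \<or> e = (2 * s - 1, 2 * i)"
    by simp
  then have "s \<in> {1..n} \<and> i \<in> {1..n}" using assms unfolding edge_box_def
    by (elim disjE) auto
  with * that show ?thesis by blast
qed

lemma renew_at:
  assumes "(s, i) \<in> Q"
  shows "renewal Q w (2 * s - 1, 2 * i - 1) = w (2 * s, 2 * i) / Delta w (s, i)"
    "renewal Q w (2 * s, 2 * i - 1) = w (2 * s - 1, 2 * i) / Delta w (s, i)"
    "renewal Q w (2 * s, 2 * i) = w (2 * s - 1, 2 * i - 1) / Delta w (s, i)"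
    "renewal Q w (2 * s - 1, 2 * i) = w (2 * s, 2 * i - 1) / Delta w (s, i)"
  using assms by (simp_all add: renewal_def cell_of.simps opposite.simps)

lemma diag_shift_at:
  "diag_shift (2 * s - 1, 2 * i - 1) = (2 * s, 2 * i)"
  "diag_shift (2 * s, 2 * i - 1) = (2 * (s + 1) - 1, 2 * i)"
  "diag_shift (2 * s, 2 * i) = (2 * (s + 1) - 1, 2 * (i + 1) - 1)"
  "diag_shift (2 * s - 1, 2 * i) = (2 * s, 2 * (i + 1) - 1)"
  by (simp_all add: diag_shift_def)

lemma div2_simps: "(2 * i) div 2 = (i::int)" "(2 * i - 1) div 2 = i - 1" "(2 * i + 1) div 2 = i" "(2 * i - 1 + 1) div 2 = i"
  by simp_all

lemma Delta_cell_weight: "Delta (cell_weight (interleave \<alpha> \<beta>)) (s, i) = 2 * half_unless (\<alpha> s = odd i) * half_unless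
  (\<beta> s = odd i)"
  by (simp only: Delta.simps cell_weight_def fst_conv snd_conv interleave_simps div2_simps) simp

lemma Delta_corner_weight: "Delta (corner_weight (interleave \<alpha> \<beta>)) (s, i) = corner_factor (\<alpha> s) (\<beta> s)"
  by (simp only: Delta.simps corner_weight_def fst_conv snd_conv interleave_simps div2_simps) (auto simp: half_unless_def corner_factor_def)

text \<open>An edge receives the weight of the other half-column divided by \<open>Delta\<close>,
  which is the inverse of twice its own weight. So half-columns stay in place and are negated, and
  the shift turns right halves into left ones. Two consecutive rows of a column have
  \<open>Delta\<close> values with product 1.\<close>

lemma step_A:
  assumes "n \<ge> 1"
  shows "dimer_sum (int n) {} (cell_weight (interleave \<alpha> \<beta>)) = (\<Prod>s\<in>{1..int n}. if even n then 1 else 2 * half_unless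
    (\<alpha> s) * half_unless (\<beta> s)) *
    dimer_sum (int n - 1) {} (corner_weight (interleave (\<lambda>s. \<not> \<beta> s) (\<lambda>s. \<not> \<alpha> (s + 1))))"
proof -
  have "(\<Prod>c\<in>grid (int n). Delta (cell_weight (interleave \<alpha> \<beta>)) c) = (\<Prod>s\<in>{1..int n}. if even n then 1 else
    2 * half_unless (\<alpha> s) * half_unless (\<beta> s))"
    unfolding prod_grid
  proof (rule prod.cong[OF refl])
    fix s
    let ?f = "\<lambda>b. 2 * half_unless (\<alpha> s = b) * half_unless (\<beta> s = b)"
    have "?f True * ?f False = 1" by (simp add: half_unless_def)
    then show "(\<Prod>i\<in>{1..int n}. Delta (cell_weight (interleave \<alpha> \<beta>)) (s, i)) = (if even n then 1 else 2 * half_unless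
      (\<alpha> s) * half_unless (\<beta> s))"
      unfolding Delta_cell_weight using prod_alternating[of ?f n] by simp
  qed
  moreover have "dimer_sum (int n - 1) {} (renewal (grid (int n)) (cell_weight (interleave \<alpha> \<beta>)) \<circ> diag_shift)
      = dimer_sum (int n - 1) {} (corner_weight (interleave (\<lambda>s. \<not> \<beta> s) (\<lambda>s. \<not> \<alpha> (s + 1))))"
  proof (rule dimer_sum_cong)
    fix e assume "e \<in> edge_box (int n - 1)"
    then obtain s i where si: "s \<in> {1..int n - 1}" "i \<in> {1..int n - 1}"
      and e: "e = (2 * s - 1, 2 * i - 1) \<or> e = (2 * s, 2 * i - 1) \<or> e = (2 * s, 2 * i) \<or> e = (2 * s - 1, 2 * i)"
      by (rule edge_box_cases)
    \<comment> \<open>The four edges of a new cell come from the four old cells around a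
      corner.\<close>
    have g: "(s, i) \<in> grid (int n)" "(s + 1, i) \<in> grid (int n)" "(s, i + 1) \<in> grid (int n)" "(s + 1, i + 1) \<in> grid (int n)"
      using si by (auto simp: grid_def)
    show "(renewal (grid (int n)) (cell_weight (interleave \<alpha> \<beta>)) \<circ> diag_shift) e = corner_weight (interleave
      (\<lambda>s. \<not> \<beta> s) (\<lambda>s. \<not> \<alpha> (s + 1))) e"
      using e
      apply (elim disjE)
         apply (simp_all only: o_apply diag_shift_at renew_at[OF g(1)] renew_at[OF g(2)] renew_at[OF g(3)] renew_at[OF g(4)] Delta_cell_weight)
         apply (simp_all only: cell_weight_def corner_weight_def fst_conv snd_conv interleave_simps div2_simps)
         apply (simp_all add: half_unless_def)
      done
  qed
  ultimately show ?thesis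
    using dimer_sum_step[of "int n" "cell_weight (interleave \<alpha> \<beta>)"] assms by (simp add: Delta_cell_weight split_paired_all)
qed

text \<open>\<open>Delta\<close> is constant along a column of cells, so renewal exchanges the two
  half-columns of each cell and divides whole columns by a constant. That constant is removed as a
  gauge factor.\<close>

lemma step_B:
  assumes "n \<ge> 1"
  shows "dimer_sum (int n) {} (corner_weight (interleave \<alpha> \<beta>)) = (\<Prod>s\<in>{1..int n}. corner_factor (\<alpha> s) (\<beta> s)) *
    dimer_sum (int n - 1) {} (cell_weight (interleave \<alpha> (\<lambda>s. \<beta> (s + 1))))"
proof -
  let ?d = "\<lambda>s. corner_factor (\<alpha> s) (\<beta> s)"
  \<comment> \<open>Half-columns \<open>2 * s\<close> and \<open>2 * s + 1\<close> of the smaller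
    diamond both come from the old column \<open>s + 1\<close>, whence the argument
    \<open>fst e div 2 + 1\<close>.\<close>
  have "dimer_sum (int n - 1) {} (renewal (grid (int n)) (corner_weight (interleave \<alpha> \<beta>)) \<circ> diag_shift)
      = dimer_sum (int n - 1) {} (\<lambda>e. (1 / ?d (fst e div 2 + 1)) * cell_weight (interleave \<alpha> (\<lambda>s. \<beta> (s + 1))) e)"
  proof (rule dimer_sum_cong)
    fix e assume "e \<in> edge_box (int n - 1)"
    then obtain s i where si: "s \<in> {1..int n - 1}" "i \<in> {1..int n - 1}"
      and e: "e = (2 * s - 1, 2 * i - 1) \<or> e = (2 * s, 2 * i - 1) \<or> e = (2 * s, 2 * i) \<or> e = (2 * s - 1, 2 * i)"
      by (rule edge_box_cases)
    have g: "(s, i) \<in> grid (int n)" "(s + 1, i) \<in> grid (int n)" "(s, i + 1) \<in> grid (int n)" "(s + 1, i + 1) \<in> grid (int n)"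
      using si by (auto simp: grid_def)
    show "(renewal (grid (int n)) (corner_weight (interleave \<alpha> \<beta>)) \<circ> diag_shift) e = (1 / ?d (fst e div 2 + 1)) *
      cell_weight (interleave \<alpha> (\<lambda>s. \<beta> (s + 1))) e"
      using e
      apply (elim disjE)
         apply (simp_all only: o_apply diag_shift_at renew_at[OF g(1)] renew_at[OF g(2)] renew_at[OF g(3)] renew_at[OF g(4)] Delta_corner_weight)
         apply (simp_all only: cell_weight_def corner_weight_def fst_conv snd_conv interleave_simps div2_simps)
         apply simp_all
      done
  qed
  also have "\<dots> = (\<Prod>s\<in>{0..int n - 1}. (1 / ?d (s + 1)) ^ nat (int n - 1)) * dimer_sum (int n - 1) {} (cell_weight
    (interleave \<alpha> (\<lambda>s. \<beta> (s + 1))))"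
    by (rule dimer_sum_gauge)
  also have "(\<Prod>s\<in>{0..int n - 1}. (1 / ?d (s + 1)) ^ nat (int n - 1)) = (\<Prod>s\<in>{1..int n}. (1 / ?d s) ^ nat (int n - 1))"
    by (rule prod.reindex_bij_witness[of _ "\<lambda>s. s - 1" "\<lambda>s. s + 1"]) auto
  finally have *: "dimer_sum (int n - 1) {} (renewal (grid (int n)) (corner_weight (interleave \<alpha> \<beta>)) \<circ> diag_shift)
    = (\<Prod>s\<in>{1..int n}. (1 / ?d s) ^ nat (int n - 1)) * dimer_sum (int n - 1) {} (cell_weight (interleave \<alpha> (\<lambda>s.
      \<beta> (s + 1))))" .
  have "dimer_sum (int n) {} (corner_weight (interleave \<alpha> \<beta>)) = (\<Prod>s\<in>{1..int n}. ?d s ^ n) *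
      ((\<Prod>s\<in>{1..int n}. (1 / ?d s) ^ nat (int n - 1)) * dimer_sum (int n - 1) {} (cell_weight (interleave \<alpha> (\<lambda>s.
        \<beta> (s + 1)))))"
    unfolding *[symmetric]
    using dimer_sum_step[of "int n" "corner_weight (interleave \<alpha> \<beta>)"] assms by (simp add: Delta_corner_weight split_paired_all prod_grid)
  also have "\<dots> = (\<Prod>s\<in>{1..int n}. ?d s ^ n * (1 / ?d s) ^ nat (int n - 1)) * dimer_sum (int n - 1) {} (cell_weight
    (interleave \<alpha> (\<lambda>s. \<beta> (s + 1))))"
    by (simp add: prod.distrib)
  \<comment> \<open>A column contributes one \<open>Delta\<close> for each of its \<open>n\<close>
    cells, but the gauge divides by only \<open>n - 1\<close> of them, one for each vertex of the
    smaller diamond; exactly one is left.\<close>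
  also have "(\<Prod>s\<in>{1..int n}. ?d s ^ n * (1 / ?d s) ^ nat (int n - 1)) = (\<Prod>s\<in>{1..int n}. ?d s)"
  proof (rule prod.cong[OF refl])
    fix s
    obtain m where m: "n = Suc m" using assms by (cases n) auto
    show "?d s ^ n * (1 / ?d s) ^ nat (int n - 1) = ?d s"
      unfolding m by (simp add: power_divide)
  qed
  finally show ?thesis .
qed

section \<open>Two-round recursion for corner weights and its closed forms\<close>

lemma step_BA:
  "dimer_sum (int (n + 2)) {} (corner_weight (interleave \<alpha> \<beta>)) = (\<Prod>s\<in>{1..int n + 2}. corner_factor (\<alpha> s) (\<beta> s)) *
    (\<Prod>s\<in>{1..int n + 1}. if odd n then 1 else 2 * half_unless (\<alpha> s) * half_unless (\<beta> (s + 1))) *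
    dimer_sum (int n) {} (corner_weight (interleave (\<lambda>s. \<not> \<beta> (s + 1)) (\<lambda>s. \<not> \<alpha> (s + 1))))"
  using step_B[of "n + 2" \<alpha> \<beta>] step_A[of "n + 1" \<alpha> "\<lambda>s. \<beta> (s + 1)"]
  by (simp add: add_ac mult_ac)

text \<open>Every two rounds strip one column from each end, so column \<open>s\<close> contributes
  its factor as often as its distance to the nearer end allows.\<close>

definition corner_product :: "nat \<Rightarrow> (int \<Rightarrow> bool) \<Rightarrow> (int \<Rightarrow> bool) \<Rightarrow> real" where
  "corner_product n \<alpha> \<beta> = (\<Prod>s\<in>{1..int n}. corner_factor (\<alpha> s) (\<beta> s) ^ nat (min s (int n + 1 - s)))"

text \<open>Column \<open>s + 1\<close> of order \<open>n + 2\<close> becomes column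
  \<open>s\<close> of order \<open>n\<close>, and exchanging and negating the half-columns does not
  affect whether they are in phase.\<close>

lemma corner_product_step:
  "corner_product (n + 2) \<alpha> \<beta> = (\<Prod>s\<in>{1..int n + 2}. corner_factor (\<alpha> s) (\<beta> s)) * corner_product n
    (\<lambda>s. \<not> \<beta> (s + 1)) (\<lambda>s. \<not> \<alpha> (s + 1))"
proof -
  let ?d = "\<lambda>s. corner_factor (\<alpha> s) (\<beta> s)"
  have d: "corner_factor (\<not> b) (\<not> a) = corner_factor a b" for a b by (auto simp: corner_factor_def)
  have "corner_product n (\<lambda>s. \<not> \<beta> (s + 1)) (\<lambda>s. \<not> \<alpha> (s + 1)) = (\<Prod>s\<in>{1..int n}. ?d (s + 1)
    ^ nat (min s (int n + 1 - s)))"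
    unfolding corner_product_def d ..
  also have "\<dots> = (\<Prod>s\<in>{2..int n + 1}. ?d s ^ nat (min s (int n + 3 - s) - 1))"
  proof (rule prod.reindex_bij_witness[of _ "\<lambda>s. s - 1" "\<lambda>s. s + 1"])
    fix s
    have "nat (min (s + 1) (int n + 3 - (s + 1)) - 1) = nat (min s (int n + 1 - s))"
      by (auto simp: min_def)
    then show "?d (s + 1) ^ nat (min (s + 1) (int n + 3 - (s + 1)) - 1) = ?d (s + 1) ^ nat (min s (int n + 1 - s))"
      by simp
  qed auto
  also have "\<dots> = (\<Prod>s\<in>{1..int n + 2}. ?d s ^ nat (min s (int n + 3 - s) - 1))"
  proof (rule prod.mono_neutral_left)
    show "\<forall>s\<in>{1..int n + 2} - {2..int n + 1}. ?d s ^ nat (min s (int n + 3 - s) - 1) = 1"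
    proof
      fix s assume "s \<in> {1..int n + 2} - {2..int n + 1}"
      then have "s = 1 \<or> s = int n + 2" by auto
      then have "nat (min s (int n + 3 - s) - 1) = 0" by (auto simp: min_def)
      then show "?d s ^ nat (min s (int n + 3 - s) - 1) = 1" by simp
    qed
  qed auto
  finally have "(\<Prod>s\<in>{1..int n + 2}. ?d s) * corner_product n (\<lambda>s. \<not> \<beta> (s + 1)) (\<lambda>s. \<not> \<alpha> (s + 1))
      = (\<Prod>s\<in>{1..int n + 2}. ?d s * ?d s ^ nat (min s (int n + 3 - s) - 1))"
    by (simp add: prod.distrib)
  also have "\<dots> = corner_product (n + 2) \<alpha> \<beta>"
    unfolding corner_product_def
  proof (rule prod.cong)
    fix s assume "s \<in> {1..int (n + 2)}"
    then have "nat (min s (int (n + 2) + 1 - s)) = Suc (nat (min s (int n + 3 - s) - 1))" by (auto simp: min_def)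
    then show "?d s * ?d s ^ nat (min s (int n + 3 - s) - 1) = ?d s ^ nat (min s (int (n + 2) + 1 - s))" by simp
  qed simp
  finally show ?thesis ..
qed

text \<open>Here the rounds on cell weights occur in even order only, so no power of two
  remains.\<close>

lemma dimer_sum_corner_weight_odd: "dimer_sum (int (2 * k + 1)) {} (corner_weight (interleave \<alpha> \<beta>)) = corner_product (2 * k +
  1) \<alpha> \<beta>"
proof (induction k arbitrary: \<alpha> \<beta>)
  case 0
  show ?case using step_B[of 1 \<alpha> \<beta>] by (simp add: corner_product_def dimer_sum_0)
next
  case (Suc k)
  show ?case
    using step_BA[of "2 * k + 1" \<alpha> \<beta>] corner_product_step[of "2 * k + 1" \<alpha> \<beta>] Suc[of "\<lambda>s. \<not> \<beta>
      (s + 1)" "\<lambda>s. \<not> \<alpha> (s + 1)"]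
    by (simp add: add_ac)
qed

text \<open>The power of two contributed by corner weights of order \<open>2k\<close>, for the two arrangements of half-columns that
  urban renewal alternates between; the second one requires \<open>k > 0\<close>.\<close>

definition straight_factor :: "nat \<Rightarrow> (int \<Rightarrow> bool) \<Rightarrow> real" where
  "straight_factor k \<tau> = 2 ^ k * (\<Prod>t\<in>{1..2 * int k + 1} - {int k + 1}. half_unless (\<tau> t))"
definition swapped_factor :: "nat \<Rightarrow> (int \<Rightarrow> bool) \<Rightarrow> real" where
  "swapped_factor k \<tau> = 2 ^ k * half_unless (\<tau> (int k + 1)) * (\<Prod>t\<in>{1..2 * int k - 1}. half_unless (\<tau> (t + 1)))"

text \<open>For swapped half-columns the two phases in the leftover factor of a round coincide,
  which gives squares. The straight factor of the negated shifted sequence cancels one copy at every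
  position except the middle one, which it omits.\<close>

lemma dimer_sum_swapped_step:
  assumes "\<And>\<tau>. dimer_sum (int (2 * k)) {} (corner_weight (interleave \<tau> (\<lambda>s. \<tau> (s + 1)))) = corner_product (2 *
    k) \<tau> (\<lambda>s. \<tau> (s + 1)) * straight_factor k \<tau>"
  shows "dimer_sum (int (2 * Suc k)) {} (corner_weight (interleave (\<lambda>s. \<tau> (s + 1)) \<tau>)) = corner_product (2 * Suc k)
    (\<lambda>s. \<tau> (s + 1)) \<tau> * swapped_factor (Suc k) \<tau>"
proof -
  let ?e = "\<lambda>t. half_unless (\<tau> (t + 1))"
  let ?I = "{1..2 * int k + 1}"
  have "(\<Prod>t\<in>?I. 2 * ?e t * ?e t) * (\<Prod>t\<in>?I - {int k + 1}. half_unless (\<not> \<tau> (t + 1)))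
     = 2 * ?e (int k + 1) * ?e (int k + 1) * (\<Prod>t\<in>?I - {int k + 1}. 2 * ?e t * ?e t * half_unless (\<not> \<tau> (t + 1)))"
    by (subst prod.remove[of ?I "int k + 1"]) (auto simp: prod.distrib mult_ac)
  also have "(\<Prod>t\<in>?I - {int k + 1}. 2 * ?e t * ?e t * half_unless (\<not> \<tau> (t + 1))) = (\<Prod>t\<in>?I - {int k + 1}. ?e t)"
    by (rule prod.cong[OF refl]) (simp add: half_unless_Not)
  also have "2 * ?e (int k + 1) * ?e (int k + 1) * \<dots> = 2 * ?e (int k + 1) * (\<Prod>t\<in>?I. ?e t)"
    by (subst prod.remove[of ?I "int k + 1"]) auto
  finally have *: "(\<Prod>t\<in>?I. 2 * ?e t * ?e t) * straight_factor k (\<lambda>s. \<not> \<tau> (s + 1)) = swapped_factor (Suc k) \<tau>"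
    unfolding straight_factor_def swapped_factor_def by (simp add: algebra_simps)
  have "dimer_sum (int (2 * Suc k)) {} (corner_weight (interleave (\<lambda>s. \<tau> (s + 1)) \<tau>)) =
      (\<Prod>s\<in>{1..int (2 * k) + 2}. corner_factor (\<tau> (s + 1)) (\<tau> s)) * (\<Prod>t\<in>?I. 2 * ?e t * ?e t) *
      (corner_product (2 * k) (\<lambda>s. \<not> \<tau> (s + 1)) (\<lambda>s. \<not> \<tau> (s + 1 + 1)) * straight_factor k (\<lambda>s.
        \<not> \<tau> (s + 1)))"
    using step_BA[of "2 * k" "\<lambda>s. \<tau> (s + 1)" \<tau>] assms[of "\<lambda>s. \<not> \<tau> (s + 1)"] by simp
  also have "\<dots> = corner_product (2 * Suc k) (\<lambda>s. \<tau> (s + 1)) \<tau> * swapped_factor (Suc k) \<tau>"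
    using corner_product_step[of "2 * k" "\<lambda>s. \<tau> (s + 1)" \<tau>] by (simp flip: *)
  finally show ?thesis .
qed

text \<open>The leftover factor now combines phases two positions apart, so positions 3 to
  \<open>2 * K + 1\<close> occur twice; \<open>E\<close> collects them. The swapped factor of the
  negated sequence cancels one copy of \<open>E\<close> and, once more, the middle position
  \<open>K + 2\<close>, which is then missing from the result.\<close>

lemma dimer_sum_straight_step:
  assumes k: "k \<ge> 1" and "\<And>\<tau>. dimer_sum (int (2 * k)) {} (corner_weight (interleave (\<lambda>s. \<tau> (s + 1)) \<tau>)) =
    corner_product (2 * k) (\<lambda>s. \<tau> (s + 1)) \<tau> * swapped_factor k \<tau>"
  shows "dimer_sum (int (2 * Suc k)) {} (corner_weight (interleave \<tau> (\<lambda>s. \<tau> (s + 1)))) = corner_product (2 * Suc k)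
    \<tau> (\<lambda>s. \<tau> (s + 1)) * straight_factor (Suc k) \<tau>"
proof -
  let ?e = "\<lambda>t. half_unless (\<tau> t)"
  let ?I = "{1..2 * int k + 1}"
  define K where "K = int k"
  have K: "K \<ge> 1" using k by (simp add: K_def)
  define E where "E = (\<Prod>t\<in>{3..2 * K + 1}. ?e t)"
  have I: "?I = insert 1 (insert 2 {3..2 * K + 1})" using K by (auto simp: K_def)
  have 1: "(\<Prod>t\<in>?I. ?e t) = ?e 1 * (?e 2 * E)" unfolding I E_def by simp
  have "(\<Prod>t\<in>?I. ?e (t + 2)) = (\<Prod>t\<in>{3..2 * K + 3}. ?e t)"
    by (rule prod.reindex_bij_witness[of _ "\<lambda>s. s - 2" "\<lambda>s. s + 2"]) (auto simp: K_def)
  also have "{3..2 * K + 3} = insert (2 * K + 3) (insert (2 * K + 2) {3..2 * K + 1})" using K by auto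
  also have "(\<Prod>t\<in>\<dots>. ?e t) = ?e (2 * K + 3) * (?e (2 * K + 2) * E)" unfolding E_def by simp
  finally have 2: "(\<Prod>t\<in>?I. ?e (t + 2)) = ?e (2 * K + 3) * (?e (2 * K + 2) * E)" .
  have 3: "(\<Prod>t\<in>?I. 2 * ?e t * ?e (t + 2)) = 2 ^ (2 * k + 1) * (?e 1 * (?e 2 * E)) * (?e (2 * K + 3) * (?e (2 * K + 2) * E))"
    unfolding prod.distrib 1 2 by (simp add: nat_add_distrib nat_mult_distrib)
  have "(\<Prod>t\<in>{1..2 * K - 1}. half_unless (\<not> \<tau> (t + 1 + 1))) = (\<Prod>t\<in>{3..2 * K + 1}. half_unless (\<not> \<tau> t))"
    by (rule prod.reindex_bij_witness[of _ "\<lambda>s. s - 2" "\<lambda>s. s + 2"]) (auto simp: add_ac)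
  also have "\<dots> = 1 / (2 ^ (2 * k - 1) * E)"
    unfolding half_unless_Not prod_dividef prod.distrib E_def using k
    by (simp add: K_def nat_diff_distrib nat_mult_distrib)
  finally have 4: "(\<Prod>t\<in>{1..2 * K - 1}. half_unless (\<not> \<tau> (t + 1 + 1))) = 1 / (2 ^ (2 * k - 1) * E)" .
  have E0: "E \<noteq> 0" unfolding E_def by simp
  have "{1..2 * int (Suc k) + 1} = insert 1 (insert 2 (insert (2 * K + 3) (insert (2 * K + 2) {3..2 * K + 1})))"
    using K by (auto simp: K_def)
  then have 5: "(\<Prod>t\<in>{1..2 * int (Suc k) + 1}. ?e t) = ?e 1 * (?e 2 * (?e (2 * K + 3) * (?e (2 * K + 2) * E)))"
    unfolding E_def using K by simp
  have 6: "(\<Prod>t\<in>{1..2 * int (Suc k) + 1}. ?e t) = ?e (K + 2) * (\<Prod>t\<in>{1..2 * int (Suc k) + 1} - {int (Suc k) + 1}. ?e t)"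
    by (subst prod.remove[of _ "int (Suc k) + 1"]) (auto simp: K_def add.commute)
  have p: "(2::real) ^ (2 * k + 1) = 4 * 2 ^ (2 * k - 1)" using k by (cases k) simp_all
  have "(\<Prod>t\<in>?I. 2 * ?e t * ?e (t + 2)) * swapped_factor k (\<lambda>s. \<not> \<tau> (s + 1)) = straight_factor (Suc k) \<tau>"
  proof -
    have Y: "swapped_factor k (\<lambda>s. \<not> \<tau> (s + 1)) = 2 ^ k * (1 / (2 * ?e (K + 2))) * (1 / (2 ^ (2 * k - 1) * E))"
      unfolding swapped_factor_def 4[unfolded K_def, symmetric] by (simp add: half_unless_Not K_def add.commute)
    have X: "straight_factor (Suc k) \<tau> = 2 * 2 ^ k * (?e 1 * (?e 2 * (?e (2 * K + 3) * (?e (2 * K + 2) * E)))) / ?e (K + 2)"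
      unfolding straight_factor_def 5[symmetric] 6 by simp
    show ?thesis unfolding 3 Y X p using E0 by (simp add: field_simps)
  qed
  note * = this
  have "dimer_sum (int (2 * Suc k)) {} (corner_weight (interleave \<tau> (\<lambda>s. \<tau> (s + 1)))) =
      (\<Prod>s\<in>{1..int (2 * k) + 2}. corner_factor (\<tau> s) (\<tau> (s + 1))) * (\<Prod>t\<in>?I. 2 * ?e t * ?e (t + 2)) *
      (corner_product (2 * k) (\<lambda>s. \<not> \<tau> (s + 1 + 1)) (\<lambda>s. \<not> \<tau> (s + 1)) * swapped_factor k (\<lambda>s.
        \<not> \<tau> (s + 1)))"
    using step_BA[of "2 * k" \<tau> "\<lambda>s. \<tau> (s + 1)"] assms(2)[of "\<lambda>s. \<not> \<tau> (s + 1)"] by (simp add: add.assoc)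
  also have "\<dots> = corner_product (2 * Suc k) \<tau> (\<lambda>s. \<tau> (s + 1)) * straight_factor (Suc k) \<tau>"
    using corner_product_step[of "2 * k" \<tau> "\<lambda>s. \<tau> (s + 1)"] by (simp flip: *)
  finally show ?thesis .
qed

text \<open>The two arrangements alternate, so the induction advances by two. Order 2 is a separate
  base case: \<open>swapped_factor 0\<close> need not be 1, so the swapped formula cannot start at
  order 0.\<close>

lemma dimer_sum_corner_weight_even:
  "dimer_sum (int (2 * k)) {} (corner_weight (interleave \<tau> (\<lambda>s. \<tau> (s + 1)))) = corner_product (2 * k) \<tau> (\<lambda>s.
    \<tau> (s + 1)) * straight_factor k \<tau>"
proof (induction k arbitrary: \<tau> rule: induct_nat_012)
  case 0
  show ?case by (simp add: dimer_sum_0 corner_product_def straight_factor_def)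
next
  case 1
  have "{1..3} - {2} = {1, 3::int}" by auto
  then have X: "straight_factor (Suc 0) \<tau> = 2 * half_unless (\<tau> 1) * half_unless (\<tau> 3)" by (simp add: straight_factor_def)
  have "dimer_sum (int (0 + 2)) {} (corner_weight (interleave \<tau> (\<lambda>s. \<tau> (s + 1)))) = corner_product (0 + 2) \<tau>
    (\<lambda>s. \<tau> (s + 1)) * straight_factor (Suc 0) \<tau>"
    unfolding step_BA corner_product_step X by (simp add: dimer_sum_0 corner_product_def)
  then show ?case by (simp only: One_nat_def[symmetric] mult_1_right add_0)
next
  case (ge2 k)
  show ?case by (rule dimer_sum_straight_step[OF _ dimer_sum_swapped_step[OF ge2(1)]]) simp
qed

text \<open>With unit weights each cell outside \<open>P\<close> has \<open>Delta\<close> 2, and its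
  renewed weights are 1/2; cells of \<open>P\<close> keep weight 1. After this round all cells are
  flipped, and seen from the corners the weights form the straight arrangement for
  \<open>\<tau>\<close>.\<close>

lemma dimer_sum_fortress:
  assumes "n \<ge> 1" and P: "P = {(s, i) \<in> grid (int n). \<tau> s = odd i}"
  shows "dimer_sum (int n) P (\<lambda>_. 1) = (\<Prod>s\<in>{1..int n}. 2 ^ (n div 2) * (if even n then 1 else 1 / half_unless (\<tau> s))) *
    dimer_sum (int n - 1) {} (corner_weight (interleave \<tau> (\<lambda>s. \<tau> (s + 1))))"
proof -
  let ?Q = "grid (int n) - P"
  have D: "Delta (\<lambda>_. 1) c = 2" for c by (cases c) (simp add: Delta.simps)
  have "P \<union> ?Q = grid (int n)" using P by auto
  then have "dimer_sum (int n) P (\<lambda>_. 1) = (\<Prod>c\<in>?Q. 2) * dimer_sum (int n) (grid (int n)) (renewal ?Q (\<lambda>_. 1))"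
    using renew_cells[of ?Q "int n" P "\<lambda>_. 1"] by (auto simp: D)
  also have "(\<Prod>c\<in>?Q. 2) = (\<Prod>c\<in>grid (int n). if c \<in> P then 1 else 2 :: real)"
    by (subst prod.If_cases) (simp_all add: Diff_eq)
  also have "\<dots> = (\<Prod>s\<in>{1..int n}. \<Prod>i\<in>{1..int n}. if \<tau> s = odd i then 1 else 2)"
    unfolding prod_grid by (intro prod.cong refl) (simp add: P grid_def)
  \<comment> \<open>A column has \<open>n div 2\<close> cells outside \<open>P\<close>, and one more
    if \<open>n\<close> is odd and \<open>\<tau> s\<close> is false, since odd rows are then the
    majority.\<close>
  also have "\<dots> = (\<Prod>s\<in>{1..int n}. 2 ^ (n div 2) * (if even n then 1 else 1 / half_unless (\<tau> s)))"
  proof (rule prod.cong[OF refl])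
    fix s
    show "(\<Prod>i\<in>{1..int n}. if \<tau> s = odd i then 1 else 2) = (2 ^ (n div 2) * (if even n then 1 else 1 / half_unless (\<tau> s)) :: real)"
      using prod_alternating[of "\<lambda>b. if \<tau> s = b then 1 else 2" n] by (cases "\<tau> s") (simp_all add: half_unless_def)
  qed
  also have "dimer_sum (int n) (grid (int n)) (renewal ?Q (\<lambda>_. 1)) = dimer_sum (int n - 1) {} (renewal ?Q (\<lambda>_. 1) \<circ> diag_shift)"
    using assms by (intro dimer_sum_grid) simp
  also have "\<dots> = dimer_sum (int n - 1) {} (corner_weight (interleave \<tau> (\<lambda>s. \<tau> (s + 1))))"
  proof (rule dimer_sum_cong)
    fix e assume "e \<in> edge_box (int n - 1)"
    then obtain s i where si: "s \<in> {1..int n - 1}" "i \<in> {1..int n - 1}"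
      and e: "e = (2 * s - 1, 2 * i - 1) \<or> e = (2 * s, 2 * i - 1) \<or> e = (2 * s, 2 * i) \<or> e = (2 * s - 1, 2 * i)"
      by (rule edge_box_cases)
    have g: "(s, i) \<in> grid (int n)" "(s + 1, i) \<in> grid (int n)" "(s, i + 1) \<in> grid (int n)" "(s + 1, i + 1) \<in> grid (int n)"
      using si by (auto simp: grid_def)
    have r: "renewal ?Q (\<lambda>_. 1) f = (if cell_of f \<in> ?Q then 1 / 2 else 1)" for f
      by (simp add: renewal_def D)
    have c: "cell_of (2 * s - 1, 2 * i - 1) = (s, i)" "cell_of (2 * s, 2 * i - 1) = (s, i)"
      "cell_of (2 * s, 2 * i) = (s, i)" "cell_of (2 * s - 1, 2 * i) = (s, i)" for s i
      by (simp_all add: cell_of.simps)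
    have q: "(s, i) \<in> ?Q \<longleftrightarrow> \<tau> s \<noteq> odd i" if "(s, i) \<in> grid (int n)" for s i using that P by simp
    show "(renewal ?Q (\<lambda>_. 1) \<circ> diag_shift) e = corner_weight (interleave \<tau> (\<lambda>s. \<tau> (s + 1))) e"
      using e
      apply (elim disjE)
         apply (simp_all only: o_apply diag_shift_at r c q[OF g(1)] q[OF g(2)] q[OF g(3)] q[OF g(4)])
         apply (simp_all only: corner_weight_def fst_conv snd_conv interleave_simps div2_simps)
         apply (simp_all add: half_unless_def)
      done
  qed
  finally show ?thesis .
qed

lemma dimer_sum_fortress_even:
  assumes "k \<ge> 1" and P: "P = {(s, i) \<in> grid (int (2 * k)). \<tau> s = odd i}"
  shows "dimer_sum (int (2 * k)) P (\<lambda>_. 1) = 2 ^ (2 * k ^ 2) * corner_product (2 * k - 1) \<tau> (\<lambda>s. \<tau> (s + 1))"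
proof -
  obtain j where k: "k = Suc j" using assms by (cases k) auto
  have "dimer_sum (int (2 * k) - 1) {} (corner_weight (interleave \<tau> (\<lambda>s. \<tau> (s + 1)))) = corner_product (2 * k - 1) \<tau>
    (\<lambda>s. \<tau> (s + 1))"
    using dimer_sum_corner_weight_odd[of j \<tau> "\<lambda>s. \<tau> (s + 1)"] unfolding k by (simp add: algebra_simps)
  moreover have "((2::real) ^ k) ^ (2 * k) = 2 ^ (2 * k ^ 2)"
    by (simp add: power_mult[symmetric] power2_eq_square mult_ac)
  ultimately show ?thesis
    using dimer_sum_fortress[OF _ P] assms(1) by (simp add: nat_mult_distrib)
qed

text \<open>The phase factors of the first renewal cancel against the straight factor in every
  column except the middle one, which the latter omits.\<close>

lemma dimer_sum_fortress_odd:
  assumes P: "P = {(s, i) \<in> grid (int (2 * k + 1)). \<tau> s = odd i}"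
  shows "dimer_sum (int (2 * k + 1)) P (\<lambda>_. 1) = 2 ^ (k * (2 * k + 2)) / half_unless (\<tau> (int k + 1)) * corner_product (2 * k)
    \<tau> (\<lambda>s. \<tau> (s + 1))"
proof -
  define E where "E = (\<Prod>s\<in>{1..2 * int k + 1}. half_unless (\<tau> s))"
  have E: "E = half_unless (\<tau> (int k + 1)) * (\<Prod>t\<in>{1..2 * int k + 1} - {int k + 1}. half_unless (\<tau> t))"
    unfolding E_def by (rule prod.remove) auto
  have E0: "E \<noteq> 0" unfolding E_def by simp
  have X: "straight_factor k \<tau> = 2 ^ k * E / half_unless (\<tau> (int k + 1))" unfolding straight_factor_def E by simp
  have n: "int (2 * k + 1) = 2 * int k + 1" "int (2 * k + 1) - 1 = int (2 * k)" by simp_all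
  have pr: "(\<Prod>s\<in>{1..int (2 * k + 1)}. 2 ^ ((2 * k + 1) div 2) * (if even (2 * k + 1) then 1 else 1 / half_unless (\<tau> s))) =
    (2 ^ k) ^ (2 * k + 1) / E"
    unfolding n E_def by (simp add: prod.distrib prod_dividef nat_add_distrib nat_mult_distrib)
  have 2: "((2::real) ^ k) ^ (2 * k + 1) * 2 ^ k = 2 ^ (k * (2 * k + 2))"
    by (simp add: power_mult[symmetric] power_add[symmetric] algebra_simps)
  have "dimer_sum (int (2 * k + 1)) P (\<lambda>_. 1) = (2 ^ k) ^ (2 * k + 1) / E * (corner_product (2 * k) \<tau> (\<lambda>s. \<tau> (s +
    1)) * straight_factor k \<tau>)"
    using dimer_sum_fortress[OF _ P] unfolding pr n(2) dimer_sum_corner_weight_even by simp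
  also have "\<dots> = (((2::real) ^ k) ^ (2 * k + 1) * 2 ^ k) / half_unless (\<tau> (int k + 1)) * corner_product (2 * k) \<tau>
    (\<lambda>s. \<tau> (s + 1))"
    unfolding X using E0 by (simp add: field_simps)
  finally show ?thesis unfolding 2 .
qed

section \<open>Tilings as pairings of regions\<close>

definition dimers :: "(real \<times> real) set \<Rightarrow> (real \<times> real) set set set" where
  "dimers L = {{c, c'} | c c'. c \<in> elementary_regions L \<and> c' \<in> elementary_regions L \<and> share_edge c c'}"

definition pairings :: "(real \<times> real) set \<Rightarrow> (real \<times> real) set set \<Rightarrow> (real \<times> real) set set set set" where
  "pairings L C = {M. M \<subseteq> dimers L \<and> \<Union>M = C \<and> pairwise disjnt M}"

text \<open>Closed regions may meet along their boundaries, so they are told apart by dense open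
  parts: \<open>I c\<close> is a chosen component with closure \<open>c\<close>.\<close>

lemma regions_disjoint_interiors:
  assumes "open (- L)"
  obtains I where "\<And>c. c \<in> elementary_regions L \<Longrightarrow> open (I c) \<and> I c \<noteq> {} \<and> closure (I c) = c"
    "\<And>c c'. c \<in> elementary_regions L \<Longrightarrow> c' \<in> elementary_regions L \<Longrightarrow> c \<noteq> c'
      \<Longrightarrow> I c \<inter> I c' = {}"
proof -
  define I where "I c = (SOME K. K \<in> components (- L) \<and> closure K = c)" for c
  have I: "I c \<in> components (- L) \<and> closure (I c) = c" if "c \<in> elementary_regions L" for c
    unfolding I_def by (rule someI_ex) (use that in \<open>auto simp: elementary_regions_def\<close>)
  show thesis
  proof
    fix c assume c: "c \<in> elementary_regions L"
    then show "open (I c) \<and> I c \<noteq> {} \<and> closure (I c) = c"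
      using I[OF c] open_components[OF assms] in_components_nonempty by blast
    fix c' assume "c' \<in> elementary_regions L" "c \<noteq> c'"
    then show "I c \<inter> I c' = {}"
      using I[OF c] I[of c'] components_nonoverlap by metis
  qed
qed

text \<open>The open part of a region avoids every other region. Hence a union of regions determines
  its members, and two unions have disjoint interiors exactly when they have no region in common.
  Taking unions is therefore a bijection from pairings to tilings.\<close>

lemma num_tilings_eq_pairings:
  assumes L: "open (- L)" and C: "C \<subseteq> elementary_regions L"
  shows "num_tilings L (\<Union>C) = card (pairings L C)"
proof -
  let ?E = "elementary_regions L"
  obtain I where I: "\<And>c. c \<in> ?E \<Longrightarrow> open (I c) \<and> I c \<noteq> {} \<and> closure (I c) = c"
    and dis: "\<And>c c'. c \<in> ?E \<Longrightarrow> c' \<in> ?E \<Longrightarrow> c \<noteq> c' \<Longrightarrow> I c \<inter> I c' = {}"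
    using regions_disjoint_interiors[OF L] by metis
  have avoid: "I c \<inter> \<Union>D = {}" if "c \<in> ?E" "D \<subseteq> ?E" "c \<notin> D" for c D
  proof -
    have "I c \<inter> c' = {}" if "c' \<in> D" for c'
    proof -
      have c': "c' \<in> ?E" "c \<noteq> c'" using that \<open>D \<subseteq> ?E\<close> \<open>c \<notin> D\<close> by auto
      \<comment> \<open>An open set that misses \<open>I c'\<close> also misses its closure.\<close>
      then have "I c \<inter> closure (I c') = {}"
        using dis[OF \<open>c \<in> ?E\<close> c'] I[OF \<open>c \<in> ?E\<close>] by (simp add: open_Int_closure_eq_empty)
      then show ?thesis using I[OF c'(1)] by simp
    qed
    then show ?thesis by blast
  qed
  have sub: "I c \<subseteq> \<Union>D" if "c \<in> ?E" "c \<in> D" for c D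
    using I[OF that(1)] closure_subset[of "I c"] that(2) by auto
  have Union_le: "D \<subseteq> D'" if "D \<subseteq> ?E" "D' \<subseteq> ?E" "\<Union>D \<subseteq> \<Union>D'" for D D'
  proof
    fix c assume c: "c \<in> D"
    then have "c \<in> ?E" using that(1) by blast
    with c have "I c \<subseteq> \<Union>D'" "I c \<noteq> {}" using sub[of c D] I that(3) by blast+
    then show "c \<in> D'" using avoid[OF \<open>c \<in> ?E\<close> that(2)] by blast
  qed
  then have Union_eq: "D = D'" if "D \<subseteq> ?E" "D' \<subseteq> ?E" "\<Union>D = \<Union>D'" for D D'
    using that by (intro equalityI) auto
  have interior_disj: "interior (\<Union>D) \<inter> interior (\<Union>D') = {}
    \<longleftrightarrow> disjnt D D'" if "D \<subseteq> ?E" "D' \<subseteq> ?E" for D D'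
  proof
    assume a: "interior (\<Union>D) \<inter> interior (\<Union>D') = {}"
    show "disjnt D D'"
    proof (rule ccontr)
      assume "\<not> disjnt D D'"
      then obtain c where c: "c \<in> D" "c \<in> D'" by (auto simp: disjnt_iff)
      then have "c \<in> ?E" using that by auto
      then have "I c \<subseteq> interior (\<Union>D)" "I c \<subseteq> interior (\<Union>D')"
        using interior_maximal[OF sub] c I by blast+
      then show False using a I[OF \<open>c \<in> ?E\<close>] by blast
    qed
  next
    assume d: "disjnt D D'"
    show "interior (\<Union>D) \<inter> interior (\<Union>D') = {}"
    proof (rule ccontr)
      let ?U = "interior (\<Union>D) \<inter> interior (\<Union>D')"
      assume "?U \<noteq> {}"
      then obtain p where p: "p \<in> ?U" by blast
      then obtain c where c: "c \<in> D" "p \<in> c" using interior_subset by blast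
      have "c \<in> ?E" using c that by auto
      have "open ?U" by auto
      \<comment> \<open>The point \<open>p\<close> lies in the closure of \<open>I c\<close>, so the
        open set \<open>?U\<close> around it meets \<open>I c\<close>.\<close>
      then have "?U \<inter> I c \<noteq> {}"
        using p c I[OF \<open>c \<in> ?E\<close>] open_Int_closure_eq_empty[of ?U "I c"] by auto
      moreover have "I c \<inter> \<Union>D' = {}"
        using avoid[OF \<open>c \<in> ?E\<close> that(2)] d c(1) by (auto simp: disjnt_iff)
      ultimately show False using interior_subset by blast
    qed
  qed
  have dE: "t \<subseteq> ?E" if "t \<in> dimers L" for t using that by (auto simp: dimers_def)
  have tiles: "tiles L = Union ` dimers L"
  proof (intro equalityI subsetI)
    fix t assume "t \<in> tiles L"
    then obtain c c' where "c \<in> ?E" "c' \<in> ?E" "share_edge c c'" "t = c \<union> c'" unfolding tiles_def by blast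
    then have "{c, c'} \<in> dimers L" "t = \<Union>{c, c'}" unfolding dimers_def by blast+
    then show "t \<in> Union ` dimers L" by (rule rev_image_eqI)
  next
    fix t assume "t \<in> Union ` dimers L"
    then obtain c c' where "c \<in> ?E" "c' \<in> ?E" "share_edge c c'" "t = \<Union>{c, c'}" unfolding dimers_def by blast
    then show "t \<in> tiles L" unfolding tiles_def by auto
  qed
  have inj: "inj_on Union (dimers L)"
    by (rule inj_onI) (rule Union_eq[OF dE dE])
  have "bij_betw (image Union) (pairings L C) (tilings L (\<Union>C))"
    unfolding bij_betw_def
  proof
    show "inj_on (image Union) (pairings L C)"
      by (rule inj_on_subset[OF inj_on_image_Pow[OF inj]]) (auto simp: pairings_def)
    show "image Union ` pairings L C = tilings L (\<Union>C)"
    proof (intro equalityI subsetI)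
      fix T assume "T \<in> image Union ` pairings L C"
      then obtain M where "M \<in> pairings L C" and TM: "T = Union ` M" by blast
      then have M: "M \<subseteq> dimers L" "\<Union>M = C" "pairwise disjnt M" unfolding pairings_def by blast+
      have "pairwise (\<lambda>t u. interior t \<inter> interior u = {}) T"
      proof (rule pairwiseI)
        fix t u assume "t \<in> T" "u \<in> T" "t \<noteq> u"
        then obtain a b where ab: "a \<in> M" "b \<in> M" "t = \<Union>a" "u = \<Union>b" "a \<noteq> b" unfolding TM by blast
        then have "disjnt a b" using M(3) by (simp add: pairwise_def)
        moreover have "a \<subseteq> ?E" "b \<subseteq> ?E" using ab M(1) dE by blast+
        ultimately show "interior t \<inter> interior u = {}" using interior_disj ab by blast
      qed
      moreover have "\<Union>T = \<Union>C" unfolding TM M(2)[symmetric] by blast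
      moreover have "T \<subseteq> tiles L" unfolding TM tiles using M(1) by blast
      ultimately show "T \<in> tilings L (\<Union>C)" by (simp add: tilings_def)
    next
      fix T assume T: "T \<in> tilings L (\<Union>C)"
      then have "T \<subseteq> Union ` dimers L" by (simp add: tilings_def tiles)
      then obtain M where M: "M \<subseteq> dimers L" "T = Union ` M" by (meson subset_imageE)
      have "\<Union>(\<Union>M) = \<Union>(Union ` M)" by blast
      also have "\<dots> = \<Union>C" using T unfolding M(2) tilings_def by blast
      finally have "\<Union>(\<Union>M) = \<Union>C" .
      moreover have "\<Union>M \<subseteq> ?E" using M dE by blast
      ultimately have "\<Union>M = C" using Union_eq[OF _ C] by metis
      moreover have "pairwise disjnt M"
      proof (rule pairwiseI)
        fix t u assume tu: "t \<in> M" "u \<in> M" "t \<noteq> u"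
        then have "t \<in> dimers L" "u \<in> dimers L" using M(1) by blast+
        then have ne: "\<Union>t \<noteq> \<Union>u" using inj_on_eq_iff[OF inj] tu(3) by simp
        have "\<Union>t \<in> T" "\<Union>u \<in> T" using tu unfolding M(2) by simp_all
        moreover have "pairwise (\<lambda>t u. interior t \<inter> interior u = {}) T" using T by (simp add: tilings_def)
        ultimately have "interior (\<Union>t) \<inter> interior (\<Union>u) = {}" using ne by (simp add: pairwise_def)
        moreover have "t \<subseteq> ?E" "u \<subseteq> ?E" using tu M(1) dE by blast+
        ultimately show "disjnt t u" using interior_disj by blast
      qed
      ultimately have "M \<in> pairings L C" using M(1) unfolding pairings_def by blast
      then show "T \<in> image Union ` pairings L C" using M(2) by blast
    qed
  qed
  then show ?thesis unfolding num_tilings_def by (rule bij_betw_same_card[symmetric])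
qed

section \<open>Elementary regions of the line arrangement\<close>

definition hclosed :: "(real \<times> real \<times> real) set \<Rightarrow> (real \<times> real) set" where
  "hclosed H = {(x, y). \<forall>(a, b, c)\<in>H. a * x + b * y \<le> c}"

definition hopen :: "(real \<times> real \<times> real) set \<Rightarrow> (real \<times> real) set" where
  "hopen H = {(x, y). \<forall>(a, b, c)\<in>H. a * x + b * y < c}"

lemma hclosed_insert: "hclosed (insert (a, b, c) H) = {p. (a, b) \<bullet> p \<le> c} \<inter> hclosed H"
  and hopen_insert: "hopen (insert (a, b, c) H) = {p. (a, b) \<bullet> p < c} \<inter> hopen H"
  and hclosed_empty: "hclosed {} = UNIV" and hopen_empty: "hopen {} = UNIV"
  by (auto simp: hclosed_def hopen_def)

text \<open>Vanishing coefficients are excluded because of the triple \<open>(0, 0, 0)\<close>: its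
  weak inequality always holds and its strict one never, so the interior would be wrong.\<close>

lemma hclosed_props:
  assumes "finite H" "\<And>c. (0, 0, c) \<notin> H"
  shows "convex (hclosed H) \<and> convex (hopen H) \<and> closed (hclosed H) \<and> open (hopen H) \<and> interior (hclosed H) = hopen H"
  using assms
proof (induction H)
  case (insert h H)
  obtain a b c where h: "h = (a, b, c)" by (cases h)
  have "(a, b) \<noteq> 0" using insert.prems[of c] h by (auto simp: zero_prod_def)
  then have i: "interior {p. (a, b) \<bullet> p \<le> c} = {p. (a, b) \<bullet> p < c}" by (rule interior_halfspace_le)
  have IH: "convex (hclosed H)" "convex (hopen H)" "closed (hclosed H)" "open (hopen H)" "interior (hclosed H) = hopen H"
    using insert by auto
  show ?case unfolding h hclosed_insert hopen_insert interior_Int i IH(5)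
    using IH by (intro conjI convex_Int closed_Int open_Int convex_halfspace_le convex_halfspace_lt
      closed_halfspace_le open_halfspace_lt) auto
qed (simp add: hclosed_empty hopen_empty)

lemma
  assumes "finite H" "\<And>c. (0, 0, c) \<notin> H"
  shows convex_hclosed: "convex (hclosed H)" and convex_hopen: "convex (hopen H)"
    and closed_hclosed: "closed (hclosed H)" and open_hopen: "open (hopen H)"
    and interior_hclosed: "interior (hclosed H) = hopen H"
  using hclosed_props[OF assms] by blast+

lemma closure_hopen:
  assumes "finite H" "\<And>c. (0, 0, c) \<notin> H" "hopen H \<noteq> {}"
  shows "closure (hopen H) = hclosed H"
  using convex_closure_interior[OF convex_hclosed] closed_hclosed interior_hclosed assms
  by (metis closure_closed)

text \<open>The cell \<open>(s, i)\<close> is centred at the lattice point \<open>(s + i - 1, s - i)\<close>. It consists of the four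
  triangles in the quadrants at that point, North being the upper left and East the upper right one, so
  that \<open>x + y\<close> grows with \<open>s\<close> and \<open>y - x\<close> decreases with \<open>i\<close>. The squares of the triangles East of
  \<open>(s, i)\<close> and West of \<open>(s + 1, i)\<close> are cut only if \<open>ct s\<close>; otherwise both names denote the whole
    square.\<close>

datatype dir = North | East | South | West

text \<open>Half-planes are encoded as coefficient triples \<open>(a, b, c)\<close> standing for \<open>a x + b y \<le> c\<close>.\<close>

fun triangle_planes :: "dir \<Rightarrow> real \<Rightarrow> real \<Rightarrow> (real \<times> real \<times> real) set" where
  "triangle_planes North s i = {(1, 0, s + i - 1), (0, -1, i - s), (-1, 1, 2 - 2 * i)}"
| "triangle_planes South s i = {(-1, 0, 1 - s - i), (0, 1, s - i), (1, -1, 2 * i)}"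
| "triangle_planes East s i = {(-1, 0, 1 - s - i), (0, -1, i - s), (1, 1, 2 * s)}"
| "triangle_planes West s i = {(1, 0, s + i - 1), (0, 1, s - i), (-1, -1, 2 - 2 * s)}"

definition square_planes :: "real \<Rightarrow> real \<Rightarrow> (real \<times> real \<times> real) set" where
  "square_planes s i = {(-1, 0, 1 - s - i), (0, -1, i - s), (1, 0, s + i), (0, 1, s - i + 1)}"

definition region_planes :: "(int \<Rightarrow> bool) \<Rightarrow> dir \<Rightarrow> int \<Rightarrow> int \<Rightarrow> (real \<times>
  real \<times> real) set" where
  "region_planes ct D s i = (if D = East \<and> \<not> ct s then square_planes (of_int s) (of_int i)
     else if D = West \<and> \<not> ct (s - 1) then square_planes (of_int s - 1) (of_int i)
     else triangle_planes D (of_int s) (of_int i))"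

abbreviation region :: "(int \<Rightarrow> bool) \<Rightarrow> dir \<Rightarrow> int \<Rightarrow> int \<Rightarrow> (real \<times> real) set" where
  "region ct D s i \<equiv> hclosed (region_planes ct D s i)"

text \<open>The offsets 1/4 place the point strictly inside the triangle, hence also inside the
  whole square when that is uncut.\<close>

fun inner_point :: "dir \<Rightarrow> real \<Rightarrow> real \<Rightarrow> real \<times> real" where
  "inner_point North s i = (s + i - 1 - 1/4, s - i + 1/4)"
| "inner_point South s i = (s + i - 1 + 1/4, s - i - 1/4)"
| "inner_point East s i = (s + i - 1 + 1/4, s - i + 1/4)"
| "inner_point West s i = (s + i - 1 - 1/4, s - i - 1/4)"

lemma finite_region_planes: "finite (region_planes ct D s i)" and region_planes_nondeg: "(0, 0, c) \<notin> region_planes ct D s i"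
  by (cases D; simp add: region_planes_def square_planes_def)+

lemma inner_point_in_hopen: "inner_point D (of_int s) (of_int i) \<in> hopen (region_planes ct D s i)"
  by (cases D) (auto simp: region_planes_def square_planes_def hopen_def)

lemma hopen_region_nonempty: "hopen (region_planes ct D s i) \<noteq> {}"
  using inner_point_in_hopen by blast

lemmas closure_region = closure_hopen[OF finite_region_planes region_planes_nondeg hopen_region_nonempty]
lemmas interior_region = interior_hclosed[OF finite_region_planes region_planes_nondeg]

lemma floor_region:
  assumes "(x, y) \<in> hopen (region_planes ct D s i)"
  shows "D = North \<Longrightarrow> \<lfloor>x\<rfloor> = s + i - 2 \<and> \<lfloor>y\<rfloor> = s - i \<and> y - x < 2 - 2 * of_int i"
    "D = South \<Longrightarrow> \<lfloor>x\<rfloor> = s + i - 1 \<and> \<lfloor>y\<rfloor> = s - i - 1 \<and> y - x > - 2 * of_int i"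
    "D = East \<Longrightarrow> \<lfloor>x\<rfloor> = s + i - 1 \<and> \<lfloor>y\<rfloor> = s - i \<and> (ct s
      \<longrightarrow> x + y < 2 * of_int s)"
    "D = West \<Longrightarrow> \<lfloor>x\<rfloor> = s + i - 2 \<and> \<lfloor>y\<rfloor> = s - i - 1 \<and> (ct (s - 1)
      \<longrightarrow> x + y > 2 * of_int s - 2)"
  using assms by (auto simp: region_planes_def square_planes_def hopen_def floor_eq_iff split: if_splits)

text \<open>The floors of the coordinates locate the unit square. If their sum is even, the square
  is cut by a line \<open>y - x = 2 * c\<close> into a North and a South triangle, and the side of
  that line decides; if it is odd, the square carries an East and a West name. Sum and difference of
  the floors then recover \<open>s\<close> and \<open>i\<close>.\<close>

lemma region_planes_eqI:
  assumes "p \<in> hopen (region_planes ct D s i)" "p \<in> hopen (region_planes ct D' s' i')"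
  shows "region_planes ct D s i = region_planes ct D' s' i' \<and>
    ((D, s, i) = (D', s', i') \<or> (\<not> ct s \<and> D = East \<and> D' = West \<and> s' = s + 1 \<and> i' = i) \<or>
     (\<not> ct s' \<and> D = West \<and> D' = East \<and> s = s' + 1 \<and> i' = i))"
proof -
  obtain x y where p: "p = (x, y)" by fastforce
  note f = floor_region[OF assms(1)[unfolded p]] and g = floor_region[OF assms(2)[unfolded p]]
  have par: "\<lfloor>x\<rfloor> + \<lfloor>y\<rfloor> = (if D = North \<or> D = South then 2 * s - 2 else if D = East then 2 * s - 1 else 2 * s - 3)"
    "\<lfloor>y\<rfloor> - \<lfloor>x\<rfloor> = (if D = North then 2 - 2 * i else if D = South then - 2 * i else 1 - 2 * i)"
    using f by (cases D; simp)+
  have par': "\<lfloor>x\<rfloor> + \<lfloor>y\<rfloor> = (if D' = North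
    \<or> D' = South then 2 * s' - 2 else if D' = East then 2 * s' - 1 else 2 * s' - 3)"
    "\<lfloor>y\<rfloor> - \<lfloor>x\<rfloor> = (if D' = North then 2 - 2 * i' else if D' = South then - 2 * i' else 1 - 2 * i')"
    using g by (cases D'; simp)+
  have "(D, s, i) = (D', s', i') \<or> (\<not> ct s \<and> D = East \<and> D' = West \<and> s' = s + 1 \<and> i' = i) \<or>
     (\<not> ct s' \<and> D = West \<and> D' = East \<and> s = s' + 1 \<and> i' = i)"
  proof (cases "D = D'")
    case True
    then show ?thesis using par par' by (auto split: if_splits)
  next
    case False
    have NS: False if "D1 = North" "D2 = South" "(x, y) \<in> hopen (region_planes ct D1 s1 i1)" "(x, y)
      \<in> hopen (region_planes ct D2 s2 i2)" for D1 D2 s1 s2 i1 i2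
    proof -
      have a: "\<lfloor>x\<rfloor> = s1 + i1 - 2 \<and> \<lfloor>y\<rfloor> = s1 - i1 \<and> y - x < 2 - 2 * of_int i1"
        using floor_region(1)[OF that(3)] that(1) by simp
      have b: "\<lfloor>x\<rfloor> = s2 + i2 - 1 \<and> \<lfloor>y\<rfloor> = s2 - i2 - 1 \<and> y - x > - 2 * of_int i2"
        using floor_region(2)[OF that(4)] that(2) by simp
      have "i1 = i2 + 1" using a b by linarith
      with a b show False by simp
    qed
    have EW: "s2 = s1 + 1 \<and> i1 = i2 \<and> \<not> ct s1" if "D1 = East" "D2 = West" "(x, y)
      \<in> hopen (region_planes ct D1 s1 i1)" "(x, y) \<in> hopen (region_planes ct D2 s2 i2)" for D1 D2 s1 s2 i1 i2
    proof -
      have a: "\<lfloor>x\<rfloor> = s1 + i1 - 1 \<and> \<lfloor>y\<rfloor> = s1 - i1 \<and> (ct s1 \<longrightarrow> x + y < 2 * of_int s1)"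
        using floor_region(3)[OF that(3)] that(1) by simp
      have b: "\<lfloor>x\<rfloor> = s2 + i2 - 2 \<and> \<lfloor>y\<rfloor> = s2 - i2 - 1 \<and> (ct (s2 - 1)
        \<longrightarrow> x + y > 2 * of_int s2 - 2)"
        using floor_region(4)[OF that(4)] that(2) by simp
      have "s2 = s1 + 1" "i1 = i2" using a b by linarith+
      with a b show ?thesis by auto
    qed
    have NE: False if "D1 \<in> {North, South}" "D2 \<in> {East, West}" "(x, y) \<in> hopen (region_planes ct D1 s1 i1)" "(x, y)
      \<in> hopen (region_planes ct D2 s2 i2)" for D1 D2 s1 s2 i1 i2
    proof -
      have "even (\<lfloor>x\<rfloor> + \<lfloor>y\<rfloor>)" using floor_region(1,2)[OF that(3)] that(1) by auto
      moreover have "odd (\<lfloor>x\<rfloor> + \<lfloor>y\<rfloor>)" using floor_region(3,4)[OF that(4)] that(2) by auto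
      ultimately show False by simp
    qed
    have "D \<in> {North, South, East, West}" "D' \<in> {North, South, East, West}" by (cases D; simp) (cases D'; simp)
    then show ?thesis
      using NS[OF _ _ assms(1)[unfolded p] assms(2)[unfolded p]] NS[OF _ _ assms(2)[unfolded p] assms(1)[unfolded p]]
        EW[OF _ _ assms(1)[unfolded p] assms(2)[unfolded p]] EW[OF _ _ assms(2)[unfolded p] assms(1)[unfolded p]]
        NE[OF _ _ assms(1)[unfolded p] assms(2)[unfolded p]] NE[OF _ _ assms(2)[unfolded p] assms(1)[unfolded p]] False
      by auto
  qed
  then show ?thesis by (auto simp: region_planes_def)
qed

lemma region_eq_iff:
  "region ct D s i = region ct D' s' i' \<longleftrightarrow>
    (D, s, i) = (D', s', i') \<or> (\<not> ct s \<and> D = East \<and> D' = West \<and> s' = s + 1 \<and> i' = i) \<or>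
     (\<not> ct s' \<and> D = West \<and> D' = East \<and> s = s' + 1 \<and> i' = i)" (is "?l \<longleftrightarrow> ?r")
proof
  assume ?l
  then have "hopen (region_planes ct D s i) = hopen (region_planes ct D' s' i')" by (simp flip: interior_region)
  then show ?r using region_planes_eqI[of _ ct D s i D' s' i'] inner_point_in_hopen by blast
next
  assume ?r
  then have "region_planes ct D s i = region_planes ct D' s' i'" by (auto simp: region_planes_def)
  then show ?l by simp
qed

definition grid_lines :: "(int \<Rightarrow> bool) \<Rightarrow> (real \<times> real) set" where
  "grid_lines ct = {(x, y). x \<in> \<int> \<or> y \<in> \<int> \<or> (\<exists>c::int. y - x = 2 * of_int c) \<or> (\<exists>s. ct s
    \<and> x + y = 2 * of_int s)}"

lemma not_Ints: "of_int k < x \<Longrightarrow> x < of_int k + 1 \<Longrightarrow> x \<notin> \<int>" for x :: real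
  by (auto elim!: Ints_cases)

lemma no_even_between: "2 * of_int a < z \<Longrightarrow> z < 2 * of_int a + 2 \<Longrightarrow> z \<noteq> 2 * of_int c" for z :: real
proof
  assume "2 * of_int a < z" "z < 2 * of_int a + 2" "z = 2 * of_int c"
  then have "real_of_int a < of_int c" "real_of_int c < of_int (a + 1)" by simp_all
  then show False unfolding of_int_less_iff by simp
qed

lemma hopen_avoids_lines: "hopen (region_planes ct D s i) \<inter> grid_lines ct = {}"
proof (rule ccontr)
  assume "hopen (region_planes ct D s i) \<inter> grid_lines ct \<noteq> {}"
  then obtain x y where p: "(x, y) \<in> hopen (region_planes ct D s i)" and l: "(x, y) \<in> grid_lines ct" by auto
  have "of_int (s + i - 2) < x \<and> x < of_int (s + i - 2) + 1 \<or> of_int (s + i - 1) < x \<and> x < of_int (s + i - 1) + 1"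
    using p by (cases D) (auto simp: region_planes_def square_planes_def hopen_def split: if_splits)
  then have x: "x \<notin> \<int>" using not_Ints by blast
  have "of_int (s - i) < y \<and> y < of_int (s - i) + 1 \<or> of_int (s - i - 1) < y \<and> y < of_int (s - i - 1) + 1"
    using p by (cases D) (auto simp: region_planes_def square_planes_def hopen_def split: if_splits)
  then have y: "y \<notin> \<int>" using not_Ints by blast
  have "2 * of_int (- i) < y - x \<and> y - x < 2 * of_int (- i) + 2"
    using p by (cases D) (auto simp: region_planes_def square_planes_def hopen_def split: if_splits)
  then have yx: "y - x \<noteq> 2 * of_int c" for c using no_even_between by blast
  obtain c where c: "ct c" "x + y = 2 * of_int c" using l x y yx unfolding grid_lines_def by blast
  show False
  proof (cases "D = East \<and> \<not> ct s \<or> D = West \<and> \<not> ct (s - 1)")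
    case False
    then have "2 * of_int (s - 1) < x + y \<and> x + y < 2 * of_int (s - 1) + 2"
      using p by (cases D) (auto simp: region_planes_def hopen_def split: if_splits)
    then show False using no_even_between c(2) by blast
  next
    case True
    \<comment> \<open>In an uncut square \<open>x + y\<close> ranges strictly between
      \<open>2 * s' - 1\<close> and \<open>2 * s' + 1\<close>. The only line that could enter is the
      one at \<open>2 * s'\<close>, which is not a cut.\<close>
    define s' where "s' = (if D = East then s else s - 1)"
    have s': "\<not> ct s'" using True by (auto simp: s'_def)
    have "2 * of_int s' - 1 < x + y \<and> x + y < 2 * of_int s' + 1"
      using p True by (cases D) (auto simp: region_planes_def square_planes_def hopen_def s'_def split: if_splits)
    then have "real_of_int (2 * s' - 1) < of_int (2 * c)" "real_of_int (2 * c) < of_int (2 * s' + 1)"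
      unfolding c(2) by simp_all
    then have "c = s'" unfolding of_int_less_iff by presburger
    then show False using s' c(1) by simp
  qed
qed

lemma lines_cover:
  assumes "(x, y) \<notin> grid_lines ct"
  shows "\<exists>D s i. (x, y) \<in> hopen (region_planes ct D s i)"
proof -
  define p q where pq: "p = \<lfloor>x\<rfloor>" "q = \<lfloor>y\<rfloor>"
  have xy: "x \<notin> \<int>" "y \<notin> \<int>" and yx: "\<And>c. y - x \<noteq> 2 * of_int c" and ct: "\<And>s. ct s
    \<Longrightarrow> x + y \<noteq> 2 * of_int s"
    using assms unfolding grid_lines_def by auto
  have x: "of_int p < x" "x < of_int p + 1" and y: "of_int q < y" "y < of_int q + 1"
    using xy unfolding pq by (metis Ints_of_int floor_less_iff less_le of_int_floor_le, linarith)+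
  show ?thesis
  proof (cases "even (p + q)")
    case True
    \<comment> \<open>In a square with even corner sum \<open>x + y\<close> runs from
      \<open>p + q\<close> to \<open>p + q + 2\<close>, which is the range from
      \<open>2 * s - 2\<close> to \<open>2 * s\<close> of column \<open>s\<close>.\<close>
    define s where "s = (p + q) div 2 + 1"
    have s: "p + q = 2 * s - 2" using True by (simp add: s_def)
    then have p: "p = 2 * s - 2 - q" by simp
    have "y - x \<noteq> 2 * of_int (q - s + 1)" by (rule yx)
    then consider "y - x < 2 * of_int (q - s + 1)" | "y - x > 2 * of_int (q - s + 1)" by linarith
    then show ?thesis
    proof cases
      case 1
      then have "(x, y) \<in> hopen (region_planes ct North s (s - q))"
        using x y unfolding p by (auto simp: region_planes_def hopen_def)
      then show ?thesis by blast
    next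
      case 2
      then have "(x, y) \<in> hopen (region_planes ct South s (s - q - 1))"
        using x y unfolding p by (auto simp: region_planes_def hopen_def)
      then show ?thesis by blast
    qed
  next
    case False
    define s where "s = (p + q + 1) div 2"
    have s: "p + q = 2 * s - 1" using False unfolding s_def by presburger
    then have p: "p = 2 * s - 1 - q" by simp
    consider "\<not> ct s \<or> x + y < 2 * of_int s" | "ct s" "x + y > 2 * of_int s" using ct[of s] by fastforce
    then show ?thesis
    proof cases
      case 1
      then have "(x, y) \<in> hopen (region_planes ct East s (s - q))"
        using x y unfolding p by (auto simp: region_planes_def square_planes_def hopen_def)
      then show ?thesis by blast
    next
      case 2
      then have "(x, y) \<in> hopen (region_planes ct West (s + 1) (s - q))"
        using x y unfolding p by (auto simp: region_planes_def square_planes_def hopen_def)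
      then show ?thesis by blast
    qed
  qed
qed

text \<open>Nonempty connected open sets that partition a set are its components, so no path
  argument in the complement is required.\<close>

lemma components_grid_lines: "components (- grid_lines ct) = {hopen (region_planes ct D s i) | D s i. True}"
proof (rule components_open_unique)
  show "pairwise disjnt {hopen (region_planes ct D s i) | D s i. True}"
  proof (rule pairwiseI)
    fix A B assume "A \<in> {hopen (region_planes ct D s i) | D s i. True}" "B \<in> {hopen (region_planes ct D s i) | D s i. True}" "A \<noteq> B"
    then obtain D s i D' s' i' where AB: "A = hopen (region_planes ct D s i)" "B = hopen (region_planes ct D' s' i')" by blast
    show "disjnt A B"
      using region_planes_eqI[of _ ct D s i D' s' i'] \<open>A \<noteq> B\<close> unfolding AB disjnt_iff by metis
  qed
  show "\<Union>{hopen (region_planes ct D s i) | D s i. True} = - grid_lines ct"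
  proof (intro equalityI subsetI)
    fix p assume "p \<in> - grid_lines ct"
    then show "p \<in> \<Union>{hopen (region_planes ct D s i) | D s i. True}"
      using lines_cover[of "fst p" "snd p" ct] by auto
  qed (use hopen_avoids_lines in blast)
  fix X assume "X \<in> {hopen (region_planes ct D s i) | D s i. True}"
  then show "open X \<and> connected X \<and> X \<noteq> {}"
    using open_hopen[OF finite_region_planes region_planes_nondeg] convex_hopen[OF finite_region_planes region_planes_nondeg] hopen_region_nonempty
      convex_connected by blast
qed

lemma elementary_regions_grid_lines: "elementary_regions (grid_lines ct) = {region ct D s i | D s i. True}"
proof -
  have "closure ` {hopen (region_planes ct D s i) | D s i. True} = {closure (hopen (region_planes ct D s i)) | D s i. True}" by blast
  then show ?thesis unfolding elementary_regions_def components_grid_lines closure_region .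
qed

lemma open_compl_grid_lines: "open (- grid_lines ct)"
proof -
  have "- grid_lines ct = \<Union>(components (- grid_lines ct))" by simp
  moreover have "open A" if "A \<in> components (- grid_lines ct)" for A
    using that open_hopen[OF finite_region_planes region_planes_nondeg] unfolding components_grid_lines by blast
  ultimately show ?thesis by (metis open_Union)
qed

section \<open>Adjacent regions\<close>

text \<open>If two polygons lie on different sides of a line and leave the same trace on it, the
  trace is a face of both, and two distinct points make it one-dimensional. Equality of the traces
  matters because \<open>share_edge\<close> asks for a full edge of both.\<close>

lemma share_edge_hclosedI:
  fixes u v :: "real \<times> real"
  assumes fin: "finite H" "\<And>c. (0, 0, c) \<notin> H" "finite H'" "\<And>c. (0, 0, c) \<notin> H'" and ab: "(a, b) \<noteq> 0"
    and le: "\<And>x y. (x, y) \<in> hclosed H \<Longrightarrow> a * x + b * y \<le> c"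
    and ge: "\<And>x y. (x, y) \<in> hclosed H' \<Longrightarrow> a * x + b * y \<ge> c"
    and eq: "\<And>x y. a * x + b * y = c \<Longrightarrow> (x, y) \<in> hclosed H \<longleftrightarrow> (x, y) \<in> hclosed H'"
    and uv: "u \<noteq> v" "(a, b) \<bullet> u = c" "(a, b) \<bullet> v = c" "u \<in> hclosed H" "v \<in> hclosed H"
    and ne: "hclosed H \<noteq> hclosed H'"
  shows "share_edge (hclosed H) (hclosed H')"
proof -
  let ?l = "{p. (a, b) \<bullet> p = c}"
  define e where "e = hclosed H \<inter> ?l"
  have e': "e = hclosed H' \<inter> ?l" unfolding e_def using eq by auto
  have "aff_dim e \<le> aff_dim ?l" unfolding e_def by (intro aff_dim_subset) simp
  also have "aff_dim ?l = 1" using ab by simp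
  finally have "aff_dim e \<le> 1" .
  moreover have "aff_dim {u, v} \<le> aff_dim e" by (intro aff_dim_subset) (use uv in \<open>simp add: e_def\<close>)
  ultimately have dim: "aff_dim e = 1" using uv(1) by simp
  have "e face_of hclosed H" unfolding e_def
    using le by (intro face_of_Int_supporting_hyperplane_le convex_hclosed fin) auto
  moreover have "e face_of hclosed H'" unfolding e'
    using ge by (intro face_of_Int_supporting_hyperplane_ge convex_hclosed fin) auto
  ultimately show ?thesis unfolding share_edge_def edge_of_def using dim ne by blast
qed

lemma share_edge_commute: "share_edge c c' \<longleftrightarrow> share_edge c' c"
  by (auto simp: share_edge_def)

lemma share_edgeI:
  assumes "(a, b) \<noteq> (0, 0)"
    and "\<And>x y. (x, y) \<in> region ct D s i \<Longrightarrow> a * x + b * y \<le> c"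
    and "\<And>x y. (x, y) \<in> region ct D' s' i' \<Longrightarrow> a * x + b * y \<ge> c"
    and "\<And>x y. a * x + b * y = c \<Longrightarrow> (x, y) \<in> region ct D s i \<longleftrightarrow> (x, y) \<in> region ct D' s' i'"
    and "(x1, y1) \<noteq> (x2, y2)" "a * x1 + b * y1 = c" "a * x2 + b * y2 = c"
    and "(x1, y1) \<in> region ct D s i" "(x2, y2) \<in> region ct D s i"
    and "region ct D s i \<noteq> region ct D' s' i'"
  shows "share_edge (region ct D s i) (region ct D' s' i')"
  by (rule share_edge_hclosedI[OF finite_region_planes region_planes_nondeg finite_region_planes region_planes_nondeg,
        where a = a and b = b and c = c and u = "(x1, y1)" and v = "(x2, y2)"])
    (use assms in \<open>simp_all add: zero_prod_def\<close>)

lemma triangle_planes_iff: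
  "(x, y) \<in> hclosed (triangle_planes North s i) \<longleftrightarrow> x \<le> s + i - 1 \<and> s - i \<le> y \<and> y - x \<le> 2 - 2 * i"
  "(x, y) \<in> hclosed (triangle_planes South s i) \<longleftrightarrow> s + i - 1 \<le> x \<and> y \<le> s - i \<and> x - y \<le> 2 * i"
  "(x, y) \<in> hclosed (triangle_planes East s i) \<longleftrightarrow> s + i - 1 \<le> x \<and> s - i \<le> y \<and> x + y \<le> 2 * s"
  "(x, y) \<in> hclosed (triangle_planes West s i) \<longleftrightarrow> x \<le> s + i - 1 \<and> y \<le> s - i \<and> 2 * s - 2 \<le> x + y"
  by (auto simp: hclosed_def)

declare triangle_planes.simps [simp del]

lemma square_planes_iff:
  "(x, y) \<in> hclosed (square_planes s i) \<longleftrightarrow> s + i - 1 \<le> x \<and> s - i \<le> y \<and> x \<le> s + i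
    \<and> y \<le> s - i + 1"
  by (auto simp: hclosed_def square_planes_def)

lemma region_iff:
  "(x, y) \<in> region ct North s i \<longleftrightarrow> x \<le> of_int s + of_int i - 1 \<and> of_int s - of_int i \<le> y
    \<and> y - x \<le> 2 - 2 * of_int i"
  "(x, y) \<in> region ct South s i \<longleftrightarrow> of_int s + of_int i - 1 \<le> x \<and> y \<le> of_int s - of_int i
    \<and> x - y \<le> 2 * of_int i"
  "(x, y) \<in> region ct East s i \<longleftrightarrow> of_int s + of_int i - 1 \<le> x \<and> of_int s - of_int i \<le> y \<and>
     (if ct s then x + y \<le> 2 * of_int s else x \<le> of_int s + of_int i \<and> y \<le> of_int s - of_int i + 1)"
  "(x, y) \<in> region ct West s i \<longleftrightarrow> x \<le> of_int s + of_int i - 1 \<and> y \<le> of_int s - of_int i \<and>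
     (if ct (s - 1) then 2 * of_int s - 2 \<le> x + y else of_int s + of_int i - 2 \<le> x \<and> of_int s - of_int i - 1 \<le> y)"
  by (auto simp: region_planes_def triangle_planes_iff square_planes_iff)

lemma share_edge_North_East: "share_edge (region ct North s i) (region ct East s i)"
  by (rule share_edgeI[where a = "1" and b = "0" and c = "of_int s + of_int i - 1" and ?x1.0 = "of_int s + of_int i - 1" and ?y1.0 =
    "of_int s - of_int i"
      and ?x2.0 = "of_int s + of_int i - 1" and ?y2.0 = "of_int s - of_int i + 1"])
    (auto simp: region_iff region_eq_iff split: if_splits)

lemma share_edge_South_East: "share_edge (region ct South s i) (region ct East s i)"
  by (rule share_edgeI[where a = "0" and b = "1" and c = "of_int s - of_int i" and ?x1.0 = "of_int s + of_int i - 1" and ?y1.0 = "of_int s - of_int i"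
      and ?x2.0 = "of_int s + of_int i - 1 + 1" and ?y2.0 = "of_int s - of_int i"])
    (auto simp: region_iff region_eq_iff split: if_splits)

lemma share_edge_West_North: "share_edge (region ct West s i) (region ct North s i)"
  by (rule share_edgeI[where a = "0" and b = "1" and c = "of_int s - of_int i" and ?x1.0 = "of_int s + of_int i - 1" and ?y1.0 = "of_int s - of_int i"
      and ?x2.0 = "of_int s + of_int i - 1 - 1" and ?y2.0 = "of_int s - of_int i"])
    (auto simp: region_iff region_eq_iff split: if_splits)

lemma share_edge_West_South: "share_edge (region ct West s i) (region ct South s i)"
  by (rule share_edgeI[where a = "1" and b = "0" and c = "of_int s + of_int i - 1" and ?x1.0 = "of_int s + of_int i - 1" and ?y1.0 =
    "of_int s - of_int i"
      and ?x2.0 = "of_int s + of_int i - 1" and ?y2.0 = "of_int s - of_int i - 1"])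
    (auto simp: region_iff region_eq_iff split: if_splits)

lemma share_edge_North_South: "share_edge (region ct North s (i + 1)) (region ct South s i)"
  by (rule share_edgeI[where a = "-1" and b = "1" and c = "- 2 * of_int i" and ?x1.0 = "of_int s + of_int i - 1" and ?y1.0 = "of_int s - of_int i - 1"
      and ?x2.0 = "of_int s + of_int i - 1 + 1" and ?y2.0 = "of_int s - of_int i"])
    (auto simp: region_iff region_eq_iff split: if_splits)

lemma share_edge_East_West: "ct s \<Longrightarrow> share_edge (region ct East s i) (region ct West (s + 1) i)"
  by (rule share_edgeI[where a = "1" and b = "1" and c = "2 * of_int s" and ?x1.0 = "of_int s + of_int i - 1" and ?y1.0 = "of_int s - of_int i + 1"
      and ?x2.0 = "of_int s + of_int i - 1 + 1" and ?y2.0 = "of_int s - of_int i"])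
    (auto simp: region_iff region_eq_iff split: if_splits)

text \<open>The hypotenuses of the four triangles are the sides of the tilted square around the
  cell; any other triangle of the cell meets such a side in at most one point.\<close>

lemma
  assumes "(x, y) \<in> hclosed (triangle_planes D s i)" "(x', y') \<in> hclosed (triangle_planes D s i)" and "(x, y) \<noteq> (x', y')"
  shows tri_right: "x + y = 2 * s \<Longrightarrow> x' + y' = 2 * s \<Longrightarrow> D = East"
    and tri_left: "x + y = 2 * s - 2 \<Longrightarrow> x' + y' = 2 * s - 2 \<Longrightarrow> D = West"
    and tri_top: "y - x = 2 - 2 * i \<Longrightarrow> y' - x' = 2 - 2 * i \<Longrightarrow> D = North"
    and tri_bottom: "y - x = - 2 * i \<Longrightarrow> y' - x' = - 2 * i \<Longrightarrow> D = South"
proof -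
  have pq: False if "x = x' \<and> y = y'" using assms(3) that by simp
  show "D = East" if "x + y = 2 * s" "x' + y' = 2 * s"
  proof (cases D)
    case North
    show ?thesis by (rule FalseE, rule pq) (use assms(1,2) that North in \<open>simp add: triangle_planes_iff\<close>)
  next
    case South
    show ?thesis by (rule FalseE, rule pq) (use assms(1,2) that South in \<open>simp add: triangle_planes_iff\<close>)
  next
    case West
    show ?thesis by (rule FalseE, rule pq) (use assms(1,2) that West in \<open>simp add: triangle_planes_iff\<close>)
  qed
  show "D = West" if "x + y = 2 * s - 2" "x' + y' = 2 * s - 2"
  proof (cases D)
    case North
    show ?thesis by (rule FalseE, rule pq) (use assms(1,2) that North in \<open>simp add: triangle_planes_iff\<close>)
  next
    case South
    show ?thesis by (rule FalseE, rule pq) (use assms(1,2) that South in \<open>simp add: triangle_planes_iff\<close>)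
  next
    case East
    show ?thesis by (rule FalseE, rule pq) (use assms(1,2) that East in \<open>simp add: triangle_planes_iff\<close>)
  qed
  show "D = North" if "y - x = 2 - 2 * i" "y' - x' = 2 - 2 * i"
  proof (cases D)
    case West
    show ?thesis by (rule FalseE, rule pq) (use assms(1,2) that West in \<open>simp add: triangle_planes_iff\<close>)
  next
    case South
    show ?thesis by (rule FalseE, rule pq) (use assms(1,2) that South in \<open>simp add: triangle_planes_iff\<close>)
  next
    case East
    show ?thesis by (rule FalseE, rule pq) (use assms(1,2) that East in \<open>simp add: triangle_planes_iff\<close>)
  qed
  show "D = South" if "y - x = - 2 * i" "y' - x' = - 2 * i"
  proof (cases D)
    case West
    show ?thesis by (rule FalseE, rule pq) (use assms(1,2) that West in \<open>simp add: triangle_planes_iff\<close>)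
  next
    case North
    show ?thesis by (rule FalseE, rule pq) (use assms(1,2) that North in \<open>simp add: triangle_planes_iff\<close>)
  next
    case East
    show ?thesis by (rule FalseE, rule pq) (use assms(1,2) that East in \<open>simp add: triangle_planes_iff\<close>)
  qed
qed

text \<open>Opposite triangles of a cell have only its centre in common.\<close>

lemma tri_same_cell:
  assumes "(x, y) \<in> hclosed (triangle_planes D s i)" "(x', y') \<in> hclosed (triangle_planes D s i)" "(x, y) \<noteq> (x', y')"
    "(x, y) \<in> hclosed (triangle_planes D' s i)" "(x', y') \<in> hclosed (triangle_planes D' s i)"
  shows "D = D' \<or> (D \<in> {North, South}) \<noteq> (D' \<in> {North, South})"
  using assms by (cases D; cases D'; force simp: triangle_planes_iff)

lemma tri_in_cell:
  assumes "(x, y) \<in> hclosed (triangle_planes D s i)"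
  shows "2 * s - 2 \<le> x + y \<and> x + y \<le> 2 * s \<and> - 2 * i \<le> y - x \<and> y - x \<le> 2 - 2 * i"
  using assms by (cases D) (auto simp: triangle_planes_iff)

text \<open>If the cells differ in both indices, \<open>x + y\<close> and \<open>y - x\<close> are
  both constant on the overlap, which leaves a single point. If they differ in one index, the
  overlap lies on the common side of the two tilted squares, where each cell has only one
  triangle.\<close>

lemma tri_overlap:
  assumes p: "(x, y) \<in> hclosed (triangle_planes D (of_int s) (of_int i))" "(x, y) \<in> hclosed (triangle_planes D' (of_int s') (of_int i'))"
    and q: "(x', y') \<in> hclosed (triangle_planes D (of_int s) (of_int i))" "(x', y') \<in> hclosed (triangle_planes D' (of_int s') (of_int i'))"
    and pq: "(x, y) \<noteq> (x', y')"
  shows "(D, s, i) = (D', s', i') \<or> (s = s' \<and> i = i' \<and> (D \<in> {North, South}) \<noteq> (D' \<in> {North, South})) \<or>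
    (D = North \<and> D' = South \<and> s = s' \<and> i = i' + 1) \<or> (D = South \<and> D' = North \<and> s = s' \<and> i' = i + 1) \<or>
    (D = East \<and> D' = West \<and> s' = s + 1 \<and> i = i') \<or> (D = West \<and> D' = East \<and> s = s' + 1 \<and> i = i')"
proof -
  note c = tri_in_cell[OF p(1)] tri_in_cell[OF p(2)] tri_in_cell[OF q(1)] tri_in_cell[OF q(2)]
  note t = p(1) q(1) pq and t' = p(2) q(2) pq
  have "real_of_int (s - s') \<le> of_int 1" "real_of_int (s' - s) \<le> of_int 1"
    "real_of_int (i - i') \<le> of_int 1" "real_of_int (i' - i) \<le> of_int 1"
    using c by simp_all
  then have si: "s' = s \<or> s' = s + 1 \<or> s = s' + 1" "i' = i \<or> i' = i + 1 \<or> i = i' + 1"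
    unfolding of_int_le_iff by presburger+
  have ss: "x + y = x' + y'" if "s' \<noteq> s" using si(1) that c by auto
  have ii: "y - x = y' - x'" if "i' \<noteq> i" using si(2) that c by auto
  have "s' = s \<or> i' = i"
  proof (rule ccontr)
    assume "\<not> (s' = s \<or> i' = i)"
    then have "x + y = x' + y'" "y - x = y' - x'" using ss ii by auto
    then have "x = x' \<and> y = y'" by linarith
    then show False using pq by simp
  qed
  then consider "s' = s \<and> i' = i" | "s' = s + 1 \<and> i' = i" | "s = s' + 1 \<and> i' = i"
    | "i' = i + 1 \<and> s' = s" | "i = i' + 1 \<and> s' = s" using si by blast
  then show ?thesis
  proof cases
    case 1
    then show ?thesis using tri_same_cell[OF t] p(2) q(2) by simp
  next
    case 2
    then have "x + y = 2 * of_int s" "x' + y' = 2 * of_int s" "x + y = 2 * of_int s' - 2" "x' + y' = 2 * of_int s' - 2" using c by auto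
    then show ?thesis using 2 tri_right[OF t] tri_left[OF t'] by blast
  next
    case 3
    then have "x + y = 2 * of_int s'" "x' + y' = 2 * of_int s'" "x + y = 2 * of_int s - 2" "x' + y' = 2 * of_int s - 2" using c by auto
    then show ?thesis using 3 tri_right[OF t'] tri_left[OF t] by blast
  next
    case 4
    then have "y - x = - 2 * of_int i" "y' - x' = - 2 * of_int i" "y - x = 2 - 2 * of_int i'" "y' - x' = 2 - 2 * of_int i'" using c by auto
    then show ?thesis using 4 tri_bottom[OF t] tri_top[OF t'] by blast
  next
    case 5
    then have "y - x = - 2 * of_int i'" "y' - x' = - 2 * of_int i'" "y - x = 2 - 2 * of_int i" "y' - x' = 2 - 2 * of_int i" using c by auto
    then show ?thesis using 5 tri_bottom[OF t'] tri_top[OF t] by blast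
  qed
qed

text \<open>Squares are split into triangles so that only overlaps of triangles have to be analysed.\<close>

lemma region_halves:
  assumes "(x, y) \<in> region ct D s i"
  shows "\<exists>D' s' i'. (D', s', i') \<in> {(D, s, i), (East, s - 1, i), (West, s + 1, i)} \<and>
    region ct D' s' i' = region ct D s i \<and> (x, y) \<in> hclosed (triangle_planes D' (of_int s') (of_int i'))"
proof (cases "D = East \<and> \<not> ct s \<or> D = West \<and> \<not> ct (s - 1)")
  case False
  then have "region_planes ct D s i = triangle_planes D (of_int s) (of_int i)" by (auto simp: region_planes_def)
  then show ?thesis using assms by (intro exI[of _ D] exI[of _ s] exI[of _ i]) simp
next
  case True
  then show ?thesis
  proof
    assume "D = East \<and> \<not> ct s"
    then have "region ct West (s + 1) i = region ct D s i" "D = East" and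
      "(x, y) \<in> hclosed (triangle_planes East (of_int s) (of_int i)) \<or> (x, y)
        \<in> hclosed (triangle_planes West (of_int (s + 1)) (of_int i))"
      using assms by (auto simp: region_eq_iff region_iff triangle_planes_iff)
    then show ?thesis by blast
  next
    assume "D = West \<and> \<not> ct (s - 1)"
    then have "region ct East (s - 1) i = region ct D s i" "D = West" and
      "(x, y) \<in> hclosed (triangle_planes West (of_int s) (of_int i)) \<or> (x, y)
        \<in> hclosed (triangle_planes East (of_int (s - 1)) (of_int i))"
      using assms by (auto simp: region_eq_iff region_iff triangle_planes_iff)
    then show ?thesis by blast
  qed
qed

text \<open>A common edge is infinite, and the intersection of the two regions is covered by
  finitely many overlaps of triangles; so one overlap contains two distinct points. Passing to the
  triangles only changes the names of the regions.\<close>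

lemma share_edge_region_cases:
  assumes "share_edge (region ct D s i) (region ct D' s' i')"
  obtains D1 D2 s1 i1 s2 i2 where "region ct D1 s1 i1 = region ct D s i" "region ct D2 s2 i2 = region ct D' s' i'"
    "(s1 = s2 \<and> i1 = i2 \<and> (D1 \<in> {North, South}) \<noteq> (D2 \<in> {North, South})) \<or>
    (D1 = North \<and> D2 = South \<and> s1 = s2 \<and> i1 = i2 + 1) \<or> (D1 = South \<and> D2 = North \<and> s1 = s2 \<and> i2 = i1 + 1) \<or>
    (D1 = East \<and> D2 = West \<and> s2 = s1 + 1 \<and> i1 = i2) \<or> (D1 = West \<and> D2 = East \<and> s1 = s2 + 1 \<and> i1 = i2)"
proof -
  let ?c = "region ct D s i" and ?c' = "region ct D' s' i'"
  have ne: "?c \<noteq> ?c'" using assms by (simp add: share_edge_def)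
  obtain e where e: "e edge_of ?c" "e edge_of ?c'" using assms by (auto simp: share_edge_def)
  have "\<not> finite (?c \<inter> ?c')"
  proof
    assume "finite (?c \<inter> ?c')"
    moreover have sub: "e \<subseteq> ?c \<inter> ?c'" using e edge_of_imp_subset by blast
    ultimately have "finite e" by (rule finite_subset[rotated])
    moreover have "convex e" using e face_of_imp_convex by (auto simp: edge_of_def)
    \<comment> \<open>A segment between distinct points is infinite, so a finite convex set has at
      most one point.\<close>
    ultimately have "\<exists>p. e \<subseteq> {p}"
      by (metis convex_contains_segment finite_closed_segment finite_subset insert_iff subsetI)
    then obtain p where "e \<subseteq> {p}" ..
    then have "aff_dim e \<le> aff_dim {p}" by (rule aff_dim_subset)
    then show False using e by (simp add: edge_of_def)
  qed
  define T where "T h = (case h of (D, s, i) \<Rightarrow> hclosed (triangle_planes D (of_int s) (of_int i)))" for h :: "dir \<times> int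
    \<times> int"
  define H where "H = (\<lambda>(D, s, i). {(D, s, i), (East, s - 1, i), (West, s + 1, i)} \<inter>
    {(D', s', i'). region ct D' s' i' = region ct D s i})"
  define P where "P = H (D, s, i) \<times> H (D', s', i')"
  have TD: "T (D, s, i) = hclosed (triangle_planes D (of_int s) (of_int i))" for D s i by (simp add: T_def)
  have HD: "(D', s', i') \<in> H (D, s, i) \<longleftrightarrow> (D', s', i') \<in> {(D, s, i), (East, s - 1, i), (West, s + 1, i)}
    \<and> region ct D' s' i' = region ct D s i"
    for D s i D' s' i' unfolding H_def by blast
  have halves: "\<exists>h\<in>H (D, s, i). p \<in> T h" if r: "p \<in> region ct D s i" for p D s i
  proof -
    obtain x y where p: "p = (x, y)" by fastforce
    obtain D' s' i' where "(D', s', i') \<in> H (D, s, i)" "p \<in> T (D', s', i')"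
      using region_halves[OF r[unfolded p]] unfolding TD HD p by blast
    then show ?thesis by blast
  qed
  have sub: "?c \<inter> ?c' \<subseteq> (\<Union>z\<in>P. T (fst z) \<inter> T (snd z))"
  proof
    fix p assume p: "p \<in> ?c \<inter> ?c'"
    obtain h where h: "h \<in> H (D, s, i)" "p \<in> T h" using halves p by blast
    obtain h' where h': "h' \<in> H (D', s', i')" "p \<in> T h'" using halves p by blast
    have "(h, h') \<in> P" using h h' by (simp add: P_def)
    moreover have "p \<in> T (fst (h, h')) \<inter> T (snd (h, h'))" using h h' by simp
    ultimately show "p \<in> (\<Union>z\<in>P. T (fst z) \<inter> T (snd z))" by blast
  qed
  have fin: "finite P" by (simp add: P_def H_def)
  have "\<exists>z\<in>P. infinite (T (fst z) \<inter> T (snd z))"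
  proof (rule ccontr)
    assume "\<not> ?thesis"
    then have "finite (\<Union>z\<in>P. T (fst z) \<inter> T (snd z))" by (intro finite_UN_I[OF fin]) simp
    then have "finite (?c \<inter> ?c')" by (rule finite_subset[OF sub])
    then show False using \<open>\<not> finite (?c \<inter> ?c')\<close> by simp
  qed
  then obtain h h' where hh: "(h, h') \<in> P" "infinite (T h \<inter> T h')" by (metis prod.collapse)
  obtain D1 s1 i1 D2 s2 i2 where h: "h = (D1, s1, i1)" "h' = (D2, s2, i2)" by (metis surj_pair)
  obtain p where p: "p \<in> T h \<inter> T h'" using infinite_imp_nonempty[OF hh(2)] by blast
  have "infinite (T h \<inter> T h' - {p})" using hh(2) by simp
  then obtain q where q: "q \<in> T h \<inter> T h'" "p \<noteq> q" using infinite_imp_nonempty by blast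
  have ov: "(D1, s1, i1) = (D2, s2, i2) \<or> (s1 = s2 \<and> i1 = i2 \<and> (D1 \<in> {North, South}) \<noteq> (D2 \<in> {North, South})) \<or>
    (D1 = North \<and> D2 = South \<and> s1 = s2 \<and> i1 = i2 + 1) \<or> (D1 = South \<and> D2 = North \<and> s1 = s2 \<and> i2 = i1 + 1) \<or>
    (D1 = East \<and> D2 = West \<and> s2 = s1 + 1 \<and> i1 = i2) \<or> (D1 = West \<and> D2 = East \<and> s1 = s2 + 1 \<and> i1 = i2)"
    by (rule tri_overlap[of "fst p" "snd p" D1 s1 i1 D2 s2 i2 "fst q" "snd q"])
      (use p q in \<open>simp_all add: h TD prod_eq_iff\<close>)
  have r: "region ct D1 s1 i1 = ?c" "region ct D2 s2 i2 = ?c'" using hh(1) unfolding h P_def by (simp_all add: HD)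
  then have "(D1, s1, i1) \<noteq> (D2, s2, i2)" using ne by auto
  then show thesis using that[OF r] ov by blast
qed

section \<open>Tiles that straddle lattice edges and tiles that straddle diagonals\<close>

definition hdir :: "pos \<Rightarrow> dir" where "hdir e = (if odd (fst e) then West else East)"
definition vdir :: "pos \<Rightarrow> dir" where "vdir e = (if odd (snd e) then North else South)"

fun cell_region :: "(int \<Rightarrow> bool) \<Rightarrow> dir \<Rightarrow> pos \<Rightarrow> (real \<times> real) set" where
  "cell_region ct D (s, i) = region ct D s i"

definition unit_dimer :: "(int \<Rightarrow> bool) \<Rightarrow> pos \<Rightarrow> (real \<times> real) set set" where
  "unit_dimer ct e = {cell_region ct (hdir e) (cell_of e), cell_region ct (vdir e) (cell_of e)}"

definition vertical_dimer :: "(int \<Rightarrow> bool) \<Rightarrow> pos \<Rightarrow> (real \<times> real) set set" where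
  "vertical_dimer ct c = {region ct South (fst c) (snd c), region ct North (fst c) (snd c + 1)}"
definition horizontal_dimer :: "(int \<Rightarrow> bool) \<Rightarrow> pos \<Rightarrow> (real \<times> real) set set" where
  "horizontal_dimer ct c = {region ct East (fst c) (snd c), region ct West (fst c + 1) (snd c)}"

lemma unit_dimer_at:
  "unit_dimer ct (2 * s - 1, 2 * i - 1) = {region ct West s i, region ct North s i}"
  "unit_dimer ct (2 * s, 2 * i - 1) = {region ct East s i, region ct North s i}"
  "unit_dimer ct (2 * s, 2 * i) = {region ct East s i, region ct South s i}"
  "unit_dimer ct (2 * s - 1, 2 * i) = {region ct West s i, region ct South s i}"
  by (simp_all add: unit_dimer_def hdir_def vdir_def cell_of.simps)

lemma share_edge_hdir_vdir: "share_edge (cell_region ct (hdir e) c) (cell_region ct (vdir e) c)"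
proof -
  obtain s i where c: "c = (s, i)" by fastforce
  have "share_edge (region ct D s i) (region ct D' s i)" if "D \<in> {East, West}" "D' \<in> {North, South}" for D D'
    using that share_edge_North_East[of ct s i] share_edge_South_East[of ct s i]
      share_edge_West_North[of ct s i] share_edge_West_South[of ct s i] share_edge_commute by auto
  then show ?thesis unfolding c cell_region.simps by (simp add: hdir_def vdir_def)
qed

lemma dimers_grid_lines:
  "dimers (grid_lines ct) = range (unit_dimer ct) \<union> range (vertical_dimer ct) \<union> horizontal_dimer ct ` {c. ct (fst c)}"
proof (intro equalityI subsetI)
  fix t assume "t \<in> dimers (grid_lines ct)"
  then obtain D s i D' s' i' where t: "t = {region ct D s i, region ct D' s' i'}" and sh: "share_edge (region ct D s i) (region ct D' s' i')"
    unfolding dimers_def elementary_regions_grid_lines by blast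
  have ne: "region ct D s i \<noteq> region ct D' s' i'" using sh by (simp add: share_edge_def)
  obtain D1 D2 s1 i1 s2 i2 where r: "region ct D1 s1 i1 = region ct D s i" "region ct D2 s2 i2 = region ct D' s' i'"
    and c: "(s1 = s2 \<and> i1 = i2 \<and> (D1 \<in> {North, South}) \<noteq> (D2 \<in> {North, South})) \<or>
    (D1 = North \<and> D2 = South \<and> s1 = s2 \<and> i1 = i2 + 1) \<or> (D1 = South \<and> D2 = North \<and> s1 = s2 \<and> i2 = i1 + 1) \<or>
    (D1 = East \<and> D2 = West \<and> s2 = s1 + 1 \<and> i1 = i2) \<or> (D1 = West \<and> D2 = East \<and> s1 = s2 + 1 \<and> i1 = i2)"
    using share_edge_region_cases[OF sh] .
  have t': "t = {region ct D1 s1 i1, region ct D2 s2 i2}" unfolding t r ..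
  \<comment> \<open>In an uncut square the East and West names denote the same region, which cannot
    form a tile with itself.\<close>
  have ct: "ct s" if "region ct East s i \<noteq> region ct West (s + 1) i" for s i using that by (auto simp: region_eq_iff)
  from c show "t \<in> range (unit_dimer ct) \<union> range (vertical_dimer ct) \<union> horizontal_dimer ct ` {c. ct (fst c)}"
  proof (elim disjE conjE)
    assume a: "s1 = s2" "i1 = i2" "(D1 \<in> {North, South}) \<noteq> (D2 \<in> {North, South})"
    have "\<exists>e. t = unit_dimer ct e"
      using unit_dimer_at[of ct s1 i1, THEN sym] a(3) unfolding t' a(1,2)[symmetric]
      by (cases D1; cases D2; simp add: insert_commute; metis)
    then show ?thesis by blast
  next
    assume a: "D1 = North" "D2 = South" "s1 = s2" "i1 = i2 + 1"
    then have "t = vertical_dimer ct (s2, i2)" by (simp add: t' vertical_dimer_def insert_commute)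
    then show ?thesis by blast
  next
    assume a: "D1 = South" "D2 = North" "s1 = s2" "i2 = i1 + 1"
    then have "t = vertical_dimer ct (s1, i1)" by (simp add: t' vertical_dimer_def)
    then show ?thesis by blast
  next
    assume a: "D1 = East" "D2 = West" "s2 = s1 + 1" "i1 = i2"
    then have "t = horizontal_dimer ct (s1, i1)" by (simp add: t' horizontal_dimer_def)
    moreover have "ct s1" using ct[of s1 i1] ne a unfolding r[symmetric] by simp
    ultimately show ?thesis by force
  next
    assume a: "D1 = West" "D2 = East" "s1 = s2 + 1" "i1 = i2"
    then have "t = horizontal_dimer ct (s2, i2)" by (simp add: t' horizontal_dimer_def insert_commute)
    moreover have "ct s2" using ct[of s2 i2] ne a unfolding r[symmetric] by fastforce
    ultimately show ?thesis by force
  qed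
next
  have E: "region ct D s i \<in> elementary_regions (grid_lines ct)" for D s i
    unfolding elementary_regions_grid_lines by blast
  have dI: "{c, c'} \<in> dimers (grid_lines ct)" if "c \<in> elementary_regions (grid_lines ct)" "c'
    \<in> elementary_regions (grid_lines ct)" "share_edge c c'" for c c'
    unfolding dimers_def using that by blast
  fix t assume "t \<in> range (unit_dimer ct) \<union> range (vertical_dimer ct) \<union> horizontal_dimer ct ` {c. ct (fst c)}"
  then consider e where "t = unit_dimer ct e" | c where "t = vertical_dimer ct c" | c where "t = horizontal_dimer ct c" "ct (fst c)" by blast
  then show "t \<in> dimers (grid_lines ct)"
  proof cases
    case (1 e)
    have "cell_region ct D c \<in> elementary_regions (grid_lines ct)" for D c by (cases c) (simp add: E)
    then show ?thesis unfolding 1 unit_dimer_def by (intro dI share_edge_hdir_vdir)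
  next
    case (2 c)
    show ?thesis unfolding 2 vertical_dimer_def
      using share_edge_North_South share_edge_commute by (intro dI E) blast
  next
    case (3 c)
    show ?thesis unfolding 3 horizontal_dimer_def by (intro dI E share_edge_East_West[of ct "fst c", OF 3(2)])
  qed
qed

section \<open>Halves of unit squares\<close>

type_synonym half = "dir \<times> pos"

text \<open>Leads to the other half of the same unit square. If the square is uncut, both halves are
  names of one region.\<close>

fun across :: "half \<Rightarrow> half" where
  "across (North, (s, i)) = (South, (s, i - 1))"
| "across (South, (s, i)) = (North, (s, i + 1))"
| "across (East, (s, i)) = (West, (s + 1, i))"
| "across (West, (s, i)) = (East, (s - 1, i))"

fun is_cut :: "(int \<Rightarrow> bool) \<Rightarrow> half \<Rightarrow> bool" where
  "is_cut ct (North, c) = True"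
| "is_cut ct (South, c) = True"
| "is_cut ct (East, c) = ct (fst c)"
| "is_cut ct (West, c) = ct (fst c - 1)"

definition half_region :: "(int \<Rightarrow> bool) \<Rightarrow> half \<Rightarrow> (real \<times> real) set" where
  "half_region ct h = region ct (fst h) (fst (snd h)) (snd (snd h))"

definition touches :: "pos \<Rightarrow> half \<Rightarrow> bool" where
  "touches e h \<longleftrightarrow> cell_of e = snd h \<and> fst h \<in> {hdir e, vdir e}"

definition covered :: "pos set \<Rightarrow> half \<Rightarrow> bool" where
  "covered M h \<longleftrightarrow> (\<exists>e\<in>M. touches e h)"

definition cut_dimer :: "(int \<Rightarrow> bool) \<Rightarrow> half \<Rightarrow> (real \<times> real) set set" where
  "cut_dimer ct h = {half_region ct h, half_region ct (across h)}"

lemma half_cases: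
  obtains s i where "h = (North, (s, i))" | s i where "h = (South, (s, i))"
  | s i where "h = (East, (s, i))" | s i where "h = (West, (s, i))"
proof -
  obtain D s i where h: "h = (D, (s, i))" by (metis surj_pair)
  show thesis using that unfolding h by (cases D) blast+
qed

lemma across_across [simp]: "across (across h) = h"
  by (cases h rule: half_cases) simp_all

lemma is_cut_across [simp]: "is_cut ct (across h) = is_cut ct h"
  by (cases h rule: half_cases) simp_all

lemma across_neq: "snd (across h) \<noteq> snd h" "across h \<noteq> h"
  by (cases h rule: half_cases; simp)+

lemma fst_across: "fst (across h) \<in> {North, South} \<longleftrightarrow> fst h \<in> {North, South}"
  by (cases h rule: half_cases) simp_all

lemma is_cut_vertical: "fst h \<in> {North, South} \<Longrightarrow> is_cut ct h"
  by (cases h rule: half_cases) simp_all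

lemma half_region_eq_iff: "half_region ct h = half_region ct h' \<longleftrightarrow> h' = h \<or> (\<not> is_cut ct h \<and> h' = across h)"
  by (cases h rule: half_cases; cases h' rule: half_cases) (auto simp: half_region_def region_eq_iff)

lemma hdir_vdir: "hdir e \<in> {East, West}" "vdir e \<in> {North, South}"
  by (auto simp: hdir_def vdir_def)

lemma unit_dimer_half_region: "unit_dimer ct e = {half_region ct (hdir e, cell_of e), half_region ct (vdir e, cell_of e)}"
  by (cases "cell_of e") (simp add: unit_dimer_def half_region_def)

lemma half_region_in_unit_dimer: "half_region ct h \<in> unit_dimer ct e \<longleftrightarrow> touches e h \<or> (\<not> is_cut ct h
  \<and> touches e (across h))"
proof -
  have "half_region ct h = half_region ct (D, cell_of e) \<longleftrightarrow> (fst h = D \<and> snd h = cell_of e) \<or> (\<not> is_cut ct h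
    \<and> fst (across h) = D \<and> snd (across h) = cell_of e)" for D
    unfolding half_region_eq_iff by (metis prod.collapse fst_conv snd_conv)
  then show ?thesis unfolding unit_dimer_half_region touches_def by auto
qed

lemma half_region_in_cut_dimer:
  assumes "is_cut ct h'"
  shows "half_region ct h \<in> cut_dimer ct h' \<longleftrightarrow> h = h' \<or> h = across h'"
  using assms half_region_eq_iff[of ct h' h] half_region_eq_iff[of ct "across h'" h] unfolding cut_dimer_def by auto

lemma edge_eqI:
  assumes "cell_of e = cell_of e'" "hdir e = hdir e'" "vdir e = vdir e'"
  shows "e = e'"
proof -
  have *: "a = b" if "(a + 1) div 2 = (b + 1) div 2" "odd a = odd b" for a b :: int using that by presburger
  have "odd (fst e) = odd (fst e')" "odd (snd e) = odd (snd e')"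
    using assms(2,3) by (auto simp: hdir_def vdir_def split: if_splits)
  moreover have c: "cell_of e = ((fst e + 1) div 2, (snd e + 1) div 2)" for e
    by (cases e) (simp add: cell_of.simps)
  have "(fst e + 1) div 2 = (fst e' + 1) div 2 \<and> (snd e + 1) div 2 = (snd e' + 1) div 2"
    using assms(1) unfolding c prod.inject .
  then have "(fst e + 1) div 2 = (fst e' + 1) div 2" "(snd e + 1) div 2 = (snd e' + 1) div 2" by blast+
  ultimately show ?thesis by (meson prod_eqI *)
qed

text \<open>The North or South end of an edge lies in a square that is always cut, so its region has
  only one name and fixes the cell. Within a cell the two ends determine the edge.\<close>

lemma inj_unit_dimer: "inj (unit_dimer ct)"
proof (rule injI)
  fix e e' assume eq: "unit_dimer ct e = unit_dimer ct e'"
  have "half_region ct (vdir e, cell_of e) \<in> unit_dimer ct e'" "half_region ct (hdir e, cell_of e) \<in> unit_dimer ct e'"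
    unfolding eq[symmetric] by (auto simp: unit_dimer_half_region)
  then have v: "touches e' (vdir e, cell_of e)" and
    h: "touches e' (hdir e, cell_of e) \<or> touches e' (across (hdir e, cell_of e))"
    using is_cut_vertical[of "(vdir e, cell_of e)"] hdir_vdir by (auto simp: half_region_in_unit_dimer)
  have c: "cell_of e' = cell_of e" using v by (simp add: touches_def)
  then have "\<not> touches e' (across (hdir e, cell_of e))"
    using across_neq(1)[of "(hdir e, cell_of e)"] by (auto simp: touches_def)
  with h have h: "touches e' (hdir e, cell_of e)" by simp
  have ne: "hdir e \<noteq> vdir e'" "vdir e \<noteq> hdir e'" by (simp_all add: hdir_def vdir_def)
  have "hdir e = hdir e' \<or> hdir e = vdir e'" using h by (simp add: touches_def)
  moreover have "vdir e = hdir e' \<or> vdir e = vdir e'" using v by (simp add: touches_def)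
  ultimately have "hdir e = hdir e'" "vdir e = vdir e'" using ne by simp_all
  then show "e = e'" by (rule edge_eqI[OF c[symmetric]])
qed

text \<open>A tile across a diagonal has two vertical or two horizontal ends, a tile across a
  lattice edge has one of each.\<close>

lemma unit_dimer_neq_cut_dimer:
  assumes "is_cut ct h"
  shows "unit_dimer ct e \<noteq> cut_dimer ct h"
proof
  assume "unit_dimer ct e = cut_dimer ct h"
  then have "half_region ct (hdir e, cell_of e) \<in> cut_dimer ct h" "half_region ct (vdir e, cell_of e) \<in> cut_dimer ct h"
    by (auto simp: unit_dimer_half_region)
  then have "(hdir e, cell_of e) = h \<or> (hdir e, cell_of e) = across h" "(vdir e, cell_of e) = h \<or> (vdir e, cell_of e) = across h"
    using assms by (simp_all add: half_region_in_cut_dimer)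
  then show False using hdir_vdir[of e] fst_across[of h] by (metis dir.distinct fst_conv insertE singletonD)
qed

lemma dimers_eq: "dimers (grid_lines ct) = range (unit_dimer ct) \<union> cut_dimer ct ` {h. is_cut ct h}"
proof -
  have "range (vertical_dimer ct) \<union> horizontal_dimer ct ` {c. ct (fst c)} = cut_dimer ct ` {h. is_cut ct h}"
  proof (intro equalityI subsetI)
    fix t assume "t \<in> range (vertical_dimer ct) \<union> horizontal_dimer ct ` {c. ct (fst c)}"
    then consider c where "t = vertical_dimer ct c" | c where "t = horizontal_dimer ct c" "ct (fst c)" by blast
    then show "t \<in> cut_dimer ct ` {h. is_cut ct h}"
    proof cases
      case (1 c)
      then have "t = cut_dimer ct (South, c)" by (cases c) (simp add: vertical_dimer_def cut_dimer_def half_region_def)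
      then show ?thesis by force
    next
      case (2 c)
      then have "t = cut_dimer ct (East, c)" by (cases c) (simp add: horizontal_dimer_def cut_dimer_def half_region_def)
      then show ?thesis using 2 by force
    qed
  next
    fix t assume "t \<in> cut_dimer ct ` {h. is_cut ct h}"
    then obtain h where t: "t = cut_dimer ct h" "is_cut ct h" by blast
    show "t \<in> range (vertical_dimer ct) \<union> horizontal_dimer ct ` {c. ct (fst c)}"
    proof (cases h rule: half_cases)
      case (1 s i)
      then have "t = vertical_dimer ct (s, i - 1)" by (simp add: t vertical_dimer_def cut_dimer_def half_region_def insert_commute)
      then show ?thesis by blast
    next
      case (2 s i)
      then have "t = vertical_dimer ct (s, i)" by (simp add: t vertical_dimer_def cut_dimer_def half_region_def)
      then show ?thesis by blast
    next
      case (3 s i)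
      then have "t = horizontal_dimer ct (s, i)" "ct s" using t by (simp_all add: horizontal_dimer_def cut_dimer_def half_region_def)
      then show ?thesis by force
    next
      case (4 s i)
      then have "t = horizontal_dimer ct (s - 1, i)" "ct (s - 1)" using t by (simp_all add: horizontal_dimer_def cut_dimer_def
        half_region_def insert_commute)
      then show ?thesis by force
    qed
  qed
  then show ?thesis unfolding dimers_grid_lines by blast
qed

lemma touches_iff:
  "touches e (North, (s, i)) \<longleftrightarrow> e = (2 * s - 1, 2 * i - 1) \<or> e = (2 * s, 2 * i - 1)"
  "touches e (East, (s, i)) \<longleftrightarrow> e = (2 * s, 2 * i - 1) \<or> e = (2 * s, 2 * i)"
  "touches e (South, (s, i)) \<longleftrightarrow> e = (2 * s - 1, 2 * i) \<or> e = (2 * s, 2 * i)"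
  "touches e (West, (s, i)) \<longleftrightarrow> e = (2 * s - 1, 2 * i - 1) \<or> e = (2 * s - 1, 2 * i)"
proof -
  have c: "cell_of e = (s, i) \<longleftrightarrow> e = (2 * s - 1, 2 * i - 1) \<or> e = (2 * s, 2 * i - 1) \<or> e = (2 * s, 2 * i)
    \<or> e = (2 * s - 1, 2 * i)"
    unfolding cell_edges_iff[symmetric] by simp
  show "touches e (North, (s, i)) \<longleftrightarrow> e = (2 * s - 1, 2 * i - 1) \<or> e = (2 * s, 2 * i - 1)"
    "touches e (East, (s, i)) \<longleftrightarrow> e = (2 * s, 2 * i - 1) \<or> e = (2 * s, 2 * i)"
    "touches e (South, (s, i)) \<longleftrightarrow> e = (2 * s - 1, 2 * i) \<or> e = (2 * s, 2 * i)"
    "touches e (West, (s, i)) \<longleftrightarrow> e = (2 * s - 1, 2 * i - 1) \<or> e = (2 * s - 1, 2 * i)"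
    unfolding touches_def snd_conv c by (auto simp: hdir_def vdir_def)
qed

lemma covered_iff: "covN M c = covered M (North, c)" "covE M c = covered M (East, c)" "covS M c = covered M (South, c)" "covW M c = covered
  M (West, c)"
proof -
  obtain s i where c: "c = (s, i)" by fastforce
  show "covN M c = covered M (North, c)" "covE M c = covered M (East, c)" "covS M c = covered M (South, c)" "covW M c = covered M (West, c)"
    unfolding c covered_def touches_iff covN.simps covE.simps covS.simps covW.simps by blast+
qed

lemma cell_matching_iff:
  "cell_matching M c \<longleftrightarrow> (\<forall>D. \<forall>e\<in>M. \<forall>e'\<in>M. touches e (D, c)
    \<longrightarrow> touches e' (D, c) \<longrightarrow> e = e')"
proof -
  obtain s i where c: "c = (s, i)" by fastforce
  have all: "(\<forall>D. Q D) \<longleftrightarrow> Q North \<and> Q East \<and> Q South \<and> Q West" for Q by (metis dir.exhaust)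
  have two: "(\<forall>e\<in>M. \<forall>e'\<in>M. e = a \<or> e = b \<longrightarrow> e' = a \<or> e' = b
    \<longrightarrow> e = e') \<longleftrightarrow> \<not> (a \<in> M \<and> b \<in> M)" if "a \<noteq> b" for a b :: pos
    using that by blast
  have "(2 * s - 1, 2 * i - 1) \<noteq> (2 * s, 2 * i - 1)" "(2 * s, 2 * i - 1) \<noteq> (2 * s, 2 * i)"
    "(2 * s - 1, 2 * i) \<noteq> (2 * s, 2 * i)" "(2 * s - 1, 2 * i - 1) \<noteq> (2 * s - 1, 2 * i)" by simp_all
  note t = this[THEN two]
  show ?thesis unfolding c all touches_iff t cell_matching.simps by blast
qed

text \<open>A direction-free form of the gluing rule, so that the comparison with pairings can treat
  all four sides of a cell alike.\<close>

lemma compatible_iff: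
  "compatible n P M \<longleftrightarrow> M \<subseteq> edge_box n \<and> (\<forall>c\<in>grid n. cell_matching M c) \<and>
    (\<forall>h. snd h \<in> grid n \<or> snd (across h) \<in> grid n \<longrightarrow> (covered M h \<noteq> (snd h
      \<in> P)) \<noteq> (covered M (across h) \<noteq> (snd (across h) \<in> P)))"
proof -
  let ?G = "\<lambda>h. (covered M h \<noteq> (snd h \<in> P)) \<noteq> (covered M (across h) \<noteq> (snd (across h) \<in> P))"
  have sym: "?G (across h) = ?G h" for h by auto
  have all: "(\<forall>h. Q h) \<longleftrightarrow> (\<forall>s i. Q (North, (s, i))) \<and> (\<forall>s i. Q (South, (s, i)))
    \<and> (\<forall>s i. Q (East, (s, i))) \<and> (\<forall>s i. Q (West, (s, i)))" for Q
    by (metis half_cases)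
  have "(\<forall>h. snd h \<in> grid n \<or> snd (across h) \<in> grid n \<longrightarrow> ?G h) \<longleftrightarrow>
      (\<forall>s i. (s, i) \<in> grid n \<or> (s, i + 1) \<in> grid n \<longrightarrow> ?G (South, (s, i))) \<and>
      (\<forall>s i. (s, i) \<in> grid n \<or> (s + 1, i) \<in> grid n \<longrightarrow> ?G (East, (s, i)))" (is "?l \<longleftrightarrow> ?r")
  proof
    assume l: ?l
    then show ?r using l[rule_format, of "(South, _)"] l[rule_format, of "(East, _)"] by simp
  next
    assume r: ?r
    show ?l
    proof (intro allI impI)
      fix h assume h: "snd h \<in> grid n \<or> snd (across h) \<in> grid n"
      show "?G h"
      proof (cases h rule: half_cases)
        case (1 s i)
        then have "(s, i - 1) \<in> grid n \<or> (s, i - 1 + 1) \<in> grid n" using h by auto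
        then have "?G (South, (s, i - 1))" by (rule r[THEN conjunct1, rule_format])
        then show ?thesis using sym[of h] unfolding 1 by simp
      next
        case (4 s i)
        then have "(s - 1, i) \<in> grid n \<or> (s - 1 + 1, i) \<in> grid n" using h by auto
        then have "?G (East, (s - 1, i))" by (rule r[THEN conjunct2, rule_format])
        then show ?thesis using sym[of h] unfolding 4 by simp
      next
        case (2 s i)
        then show ?thesis using h r[THEN conjunct1, rule_format, of s i] by simp
      next
        case (3 s i)
        then show ?thesis using h r[THEN conjunct2, rule_format, of s i] by simp
      qed
    qed
  qed
  moreover have "(\<forall>s i. (s, i) \<in> grid n \<or> (s, i + 1) \<in> grid n \<longrightarrow> Q s i)
    \<longleftrightarrow> (\<forall>s\<in>{1..n}. \<forall>i\<in>{0..n}. Q s i)"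
    "(\<forall>s i. (s, i) \<in> grid n \<or> (s + 1, i) \<in> grid n \<longrightarrow> Q s i)
      \<longleftrightarrow> (\<forall>s\<in>{0..n}. \<forall>i\<in>{1..n}. Q s i)" for Q
  proof -
    have g0: "(s, i) \<in> grid n \<or> (s, i + 1) \<in> grid n \<longleftrightarrow> s \<in> {1..n} \<and> i \<in> {0..n}" for s i
      by (auto simp: grid_def)
    show "(\<forall>s i. (s, i) \<in> grid n \<or> (s, i + 1) \<in> grid n \<longrightarrow> Q s i)
      \<longleftrightarrow> (\<forall>s\<in>{1..n}. \<forall>i\<in>{0..n}. Q s i)" unfolding g0 by blast
    have g1: "(s, i) \<in> grid n \<or> (s + 1, i) \<in> grid n \<longleftrightarrow> s \<in> {0..n} \<and> i \<in> {1..n}" for s i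
      by (auto simp: grid_def)
    show "(\<forall>s i. (s, i) \<in> grid n \<or> (s + 1, i) \<in> grid n \<longrightarrow> Q s i)
      \<longleftrightarrow> (\<forall>s\<in>{0..n}. \<forall>i\<in>{1..n}. Q s i)" unfolding g1 by blast
  qed
  ultimately have l: "(\<forall>h. snd h \<in> grid n \<or> snd (across h) \<in> grid n \<longrightarrow> ?G h) \<longleftrightarrow>
      (\<forall>s\<in>{1..n}. \<forall>i\<in>{0..n}. ?G (South, (s, i))) \<and> (\<forall>s\<in>{0..n}. \<forall>i\<in>{1..n}. ?G (East, (s, i)))"
    by (simp only:)
  show ?thesis unfolding compatible_def covered_iff l across.simps snd_conv by blast
qed

section \<open>From pairings to edge configurations\<close>

lemma cell_of_grid_iff: "cell_of e \<in> grid n \<longleftrightarrow> e \<in> edge_box n"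
proof -
  obtain s i where c: "cell_of e = (s, i)" by fastforce
  then have "e \<in> cell_edges (s, i)" by (simp only: cell_edges_iff)
  then show ?thesis unfolding c by (auto simp: grid_def edge_box_def)
qed

lemma cut_dimer_across: "cut_dimer ct (across h) = cut_dimer ct h"
  by (auto simp: cut_dimer_def)

text \<open>Membership in \<open>P\<close> changes across a cut, where the two halves must be
  covered from their cells alike, and stays the same across an uncut square, where exactly one of
  them must be. This is all that the comparison with pairings needs from the arrangement of
  lines.\<close>

locale fortress_graph =
  fixes ct :: "int \<Rightarrow> bool" and n :: int and P :: "pos set"
  assumes P_grid: "P \<subseteq> grid n"
    and cut_iff: "snd h \<in> grid n \<Longrightarrow> snd (across h) \<in> grid n \<Longrightarrow> is_cut ct h \<longleftrightarrow> (snd h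
      \<in> P) \<noteq> (snd (across h) \<in> P)"
    and cut_boundary: "snd h \<in> grid n \<Longrightarrow> snd (across h) \<notin> grid n \<Longrightarrow> is_cut ct h"
begin

text \<open>The second disjunct describes the regions attached outside the diamond.\<close>

definition in_fortress :: "half \<Rightarrow> bool" where
  "in_fortress h \<longleftrightarrow> snd h \<in> grid n \<or> snd (across h) \<in> P"

definition fortress_regions :: "(real \<times> real) set set" where
  "fortress_regions = half_region ct ` {h. in_fortress h}"

lemma uncut_grid:
  assumes "\<not> is_cut ct h" "in_fortress h \<or> in_fortress (across h)"
  shows "snd h \<in> grid n" "snd (across h) \<in> grid n" "(snd h \<in> P) = (snd (across h) \<in> P)"
proof -
  have "snd h \<in> grid n \<or> snd (across h) \<in> grid n" using assms(2) P_grid unfolding in_fortress_def by auto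
  then show 1: "snd h \<in> grid n" "snd (across h) \<in> grid n"
    using cut_boundary[of h] cut_boundary[of "across h"] assms(1) by auto
  show "(snd h \<in> P) = (snd (across h) \<in> P)" using cut_iff[OF 1] assms(1) by simp
qed

lemma half_region_in_fortress_regions: "half_region ct h \<in> fortress_regions \<longleftrightarrow> in_fortress h"
proof
  assume "half_region ct h \<in> fortress_regions"
  then obtain h' where h': "in_fortress h'" "half_region ct h = half_region ct h'" unfolding fortress_regions_def by blast
  show "in_fortress h"
  proof (cases "h' = h")
    case False
    then have nc: "\<not> is_cut ct h" and "h' = across h" using h'(2) unfolding half_region_eq_iff by blast+
    then have "in_fortress (across h)" using h'(1) by simp
    then have "snd h \<in> grid n" using uncut_grid(1)[OF nc] by blast
    then show ?thesis unfolding in_fortress_def by blast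
  qed (use h' in simp)
qed (simp add: fortress_regions_def)

text \<open>A cell outside the grid cannot face the grid both horizontally and vertically, since
  then both of its indices would be in range. So no tile straddling a lattice edge joins two
  attached regions.\<close>

lemma unit_dimer_subset_fortress_regions: "unit_dimer ct e \<subseteq> fortress_regions \<longleftrightarrow> e \<in> edge_box n"
proof
  assume "unit_dimer ct e \<subseteq> fortress_regions"
  then have in2: "in_fortress (hdir e, cell_of e)" "in_fortress (vdir e, cell_of e)" by (auto simp: unit_dimer_half_region
    half_region_in_fortress_regions)
  obtain s i where c: "cell_of e = (s, i)" by fastforce
  have "cell_of e \<in> grid n"
  proof (rule ccontr)
    assume "cell_of e \<notin> grid n"
    then have "snd (across (hdir e, (s, i))) \<in> grid n" "snd (across (vdir e, (s, i))) \<in> grid n"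
      using in2 P_grid unfolding in_fortress_def snd_conv c by blast+
    then have "s \<in> {1..n}" "i \<in> {1..n}"
      by (auto simp: hdir_def vdir_def grid_def split: if_splits)
    then show False using \<open>cell_of e \<notin> grid n\<close> unfolding c by (auto simp: grid_def)
  qed
  then show "e \<in> edge_box n" by (simp add: cell_of_grid_iff)
next
  assume "e \<in> edge_box n"
  then show "unit_dimer ct e \<subseteq> fortress_regions" by (auto simp: unit_dimer_half_region half_region_in_fortress_regions
    in_fortress_def cell_of_grid_iff)
qed

lemma pairings_iff:
  "\<M> \<in> pairings (grid_lines ct) fortress_regions \<longleftrightarrow>
    \<M> \<subseteq> dimers (grid_lines ct) \<and> (\<forall>t\<in>\<M>. t \<subseteq> fortress_regions)
      \<and> (\<forall>h. in_fortress h \<longrightarrow> (\<exists>!t. t \<in> \<M> \<and> half_region ct h \<in> t))" (is "?l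
        \<longleftrightarrow> ?r")
proof
  assume ?l
  then have M: "\<M> \<subseteq> dimers (grid_lines ct)" "\<Union>\<M> = fortress_regions" "pairwise disjnt \<M>" unfolding pairings_def by blast+
  have "\<exists>!t. t \<in> \<M> \<and> half_region ct h \<in> t" if h: "in_fortress h" for h
  proof (rule ex_ex1I)
    have "half_region ct h \<in> \<Union>\<M>" using h M(2) by (simp add: half_region_in_fortress_regions)
    then show "\<exists>t. t \<in> \<M> \<and> half_region ct h \<in> t" by blast
    fix t u assume "t \<in> \<M> \<and> half_region ct h \<in> t" "u \<in> \<M> \<and> half_region ct h \<in> u"
    then show "t = u" using M(3) by (meson disjnt_iff pairwise_def)
  qed
  moreover have "\<forall>t\<in>\<M>. t \<subseteq> fortress_regions" using M(2) by blast
  ultimately show ?r using M(1) by blast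
next
  assume r: ?r
  have ex: "\<exists>t\<in>\<M>. c \<in> t" if c: "c \<in> fortress_regions" for c
  proof -
    obtain h where h: "c = half_region ct h" "in_fortress h" using c unfolding fortress_regions_def by blast
    then have "\<exists>!t. t \<in> \<M> \<and> half_region ct h \<in> t" using r by blast
    then show ?thesis unfolding h(1) by blast
  qed
  have "\<Union>\<M> = fortress_regions"
  proof
    show "\<Union>\<M> \<subseteq> fortress_regions" using r by blast
    show "fortress_regions \<subseteq> \<Union>\<M>" using ex by blast
  qed
  moreover have "pairwise disjnt \<M>"
  proof (rule pairwiseI, rule ccontr)
    fix t u assume tu: "t \<in> \<M>" "u \<in> \<M>" "t \<noteq> u" "\<not> disjnt t u"
    then obtain c where c: "c \<in> t" "c \<in> u" by (auto simp: disjnt_iff)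
    then have "c \<in> fortress_regions" using r tu(1) by blast
    then obtain h where h: "c = half_region ct h" "in_fortress h" unfolding fortress_regions_def by blast
    then have "\<exists>!t. t \<in> \<M> \<and> half_region ct h \<in> t" using r by blast
    then show False using c tu(1-3) unfolding h(1) by blast
  qed
  ultimately show ?l unfolding pairings_def using r by blast
qed

definition unit_edges :: "(real \<times> real) set set set \<Rightarrow> pos set" where
  "unit_edges \<M> = {e. unit_dimer ct e \<in> \<M>}"

text \<open>A region not covered from its cell can only be completed by the tile across its
  diagonal, so the straddling tiles determine the rest.\<close>

definition pairing_of :: "pos set \<Rightarrow> (real \<times> real) set set set" where
  "pairing_of M = unit_dimer ct ` M \<union> cut_dimer ct ` {h. is_cut ct h \<and> in_fortress h \<and> in_fortress (across h)
    \<and> \<not> covered M h \<and> \<not> covered M (across h)}"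

context
  fixes \<M> assumes pairing: "\<M> \<in> pairings (grid_lines ct) fortress_regions"
begin

lemma dimer_cases:
  assumes "t \<in> \<M>"
  obtains e where "t = unit_dimer ct e" | h where "is_cut ct h" "t = cut_dimer ct h"
  using assms pairing unfolding pairings_iff dimers_eq by blast

lemma dimer_unique: "in_fortress h \<Longrightarrow> t \<in> \<M> \<Longrightarrow> u \<in> \<M> \<Longrightarrow> half_region ct h
  \<in> t \<Longrightarrow> half_region ct h \<in> u \<Longrightarrow> t = u"
  using pairing unfolding pairings_iff by blast

lemma dimer_exists: "in_fortress h \<Longrightarrow> \<exists>t\<in>\<M>. half_region ct h \<in> t"
  using pairing unfolding pairings_iff by blast

text \<open>A region in a cut square has no tiles other than those of its cell and the one across
  the diagonal, and exactly one of these covers it.\<close>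

lemma unit_edges_cut:
  assumes "is_cut ct h" "in_fortress h"
  shows "covered (unit_edges \<M>) h \<longleftrightarrow> cut_dimer ct h \<notin> \<M>"
proof
  assume "covered (unit_edges \<M>) h"
  then obtain e where e: "unit_dimer ct e \<in> \<M>" "touches e h" unfolding covered_def unit_edges_def by blast
  then have "half_region ct h \<in> unit_dimer ct e" by (simp add: half_region_in_unit_dimer)
  show "cut_dimer ct h \<notin> \<M>"
  proof
    assume "cut_dimer ct h \<in> \<M>"
    then have "unit_dimer ct e = cut_dimer ct h"
      using dimer_unique[OF assms(2) e(1) _ \<open>half_region ct h \<in> unit_dimer ct e\<close>] by (simp add: cut_dimer_def)
    then show False using unit_dimer_neq_cut_dimer assms(1) by blast
  qed
next
  assume nc: "cut_dimer ct h \<notin> \<M>"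
  obtain t where t: "t \<in> \<M>" "half_region ct h \<in> t" using dimer_exists[OF assms(2)] by blast
  from t(1) show "covered (unit_edges \<M>) h"
  proof (cases rule: dimer_cases)
    case (1 e)
    then have "e \<in> unit_edges \<M>" "touches e h" using t assms(1) by (simp_all add: half_region_in_unit_dimer unit_edges_def)
    then show ?thesis unfolding covered_def by blast
  next
    case (2 h')
    then have "h = h' \<or> h = across h'" using t by (simp add: half_region_in_cut_dimer)
    then have "t = cut_dimer ct h" using 2 by (auto simp: cut_dimer_across)
    then show ?thesis using t nc by simp
  qed
qed

text \<open>Both halves are the same region, so it must be covered from one of two cells, and being
  covered from both would take two different tiles.\<close>

lemma unit_edges_uncut:
  assumes "\<not> is_cut ct h" "in_fortress h"
  shows "covered (unit_edges \<M>) h \<noteq> covered (unit_edges \<M>) (across h)"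
proof -
  obtain t where t: "t \<in> \<M>" "half_region ct h \<in> t" using dimer_exists[OF assms(2)] by blast
  from t(1) have "covered (unit_edges \<M>) h \<or> covered (unit_edges \<M>) (across h)"
  proof (cases rule: dimer_cases)
    case (1 e)
    then have "e \<in> unit_edges \<M>" "touches e h \<or> touches e (across h)"
      using t assms(1) by (simp_all add: half_region_in_unit_dimer unit_edges_def)
    then show ?thesis unfolding covered_def by blast
  next
    case (2 h')
    then have "h = h' \<or> h = across h'" using t by (simp add: half_region_in_cut_dimer)
    then show ?thesis using 2 assms(1) by auto
  qed
  moreover have False if both: "covered (unit_edges \<M>) h" "covered (unit_edges \<M>) (across h)"
  proof -
    obtain e e' where e: "unit_dimer ct e \<in> \<M>" "touches e h" "unit_dimer ct e' \<in> \<M>" "touches e' (across h)"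
      using both unfolding covered_def unit_edges_def by blast
    then have "unit_dimer ct e = unit_dimer ct e'" using assms by (intro dimer_unique[of h]) (simp_all add: half_region_in_unit_dimer)
    then have "e = e'" using injD[OF inj_unit_dimer] by blast
    then show False using e across_neq(1)[of h] by (simp add: touches_def)
  qed
  ultimately show ?thesis by blast
qed

lemma unit_edges_box: "unit_edges \<M> \<subseteq> edge_box n"
proof
  fix e assume "e \<in> unit_edges \<M>"
  then have "unit_dimer ct e \<subseteq> fortress_regions" using pairing unfolding unit_edges_def pairings_iff by blast
  then show "e \<in> edge_box n" by (simp add: unit_dimer_subset_fortress_regions)
qed

lemma compatible_unit_edges: "compatible n P (unit_edges \<M>)"
  unfolding compatible_iff
proof (intro conjI ballI allI impI)
  show "unit_edges \<M> \<subseteq> edge_box n" by (rule unit_edges_box)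
next
  fix c assume c: "c \<in> grid n"
  show "cell_matching (unit_edges \<M>) c" unfolding cell_matching_iff
  proof (intro allI ballI impI)
    fix D e e' assume e: "e \<in> unit_edges \<M>" "e' \<in> unit_edges \<M>" "touches e (D, c)" "touches e' (D, c)"
    have "unit_dimer ct e = unit_dimer ct e'"
      by (rule dimer_unique[of "(D, c)"]) (use e c in \<open>simp_all add: in_fortress_def unit_edges_def half_region_in_unit_dimer\<close>)
    then show "e = e'" using injD[OF inj_unit_dimer] by blast
  qed
next
  fix h assume h: "snd h \<in> grid n \<or> snd (across h) \<in> grid n"
  let ?M = "unit_edges \<M>"
  have out: "\<not> covered ?M k" if "snd k \<notin> grid n" for k
    using that unit_edges_box unfolding covered_def touches_def by (metis cell_of_grid_iff subsetD)
  show "(covered ?M h \<noteq> (snd h \<in> P)) \<noteq> (covered ?M (across h) \<noteq> (snd (across h) \<in> P))"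
  proof (cases "is_cut ct h")
    case True
    let ?x = "cut_dimer ct h \<in> \<M>"
    have 1: "in_fortress h \<Longrightarrow> covered ?M h \<longleftrightarrow> \<not> ?x" using unit_edges_cut True by blast
    have 2: "in_fortress (across h) \<Longrightarrow> covered ?M (across h)
      \<longleftrightarrow> \<not> ?x" using unit_edges_cut[of "across h"] True by (simp add: cut_dimer_across)
    \<comment> \<open>A tile across the diagonal requires both halves to be in the fortress. Hence a
      border side without an attached region must be covered from its cell.\<close>
    have 3: "?x \<Longrightarrow> in_fortress h \<and> in_fortress (across h)"
      using pairing unfolding pairings_iff by (auto simp: cut_dimer_def simp flip: half_region_in_fortress_regions)
    show ?thesis
      using 1 2 3 out[of h] out[of "across h"] P_grid h cut_iff[of h] True unfolding in_fortress_def across_across by blast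
  next
    case False
    have i: "in_fortress h \<or> in_fortress (across h)" using h by (auto simp: in_fortress_def)
    show ?thesis using uncut_grid[OF False i] unit_edges_uncut[OF False] by (simp add: in_fortress_def)
  qed
qed

lemma pairing_of_unit_edges: "pairing_of (unit_edges \<M>) = \<M>"
proof (intro equalityI subsetI)
  fix t assume "t \<in> pairing_of (unit_edges \<M>)"
  then consider e where "unit_dimer ct e \<in> \<M>" "t = unit_dimer ct e"
    | h where "is_cut ct h" "in_fortress h" "\<not> covered (unit_edges \<M>) h" "t = cut_dimer ct h"
    unfolding pairing_of_def unit_edges_def by blast
  then show "t \<in> \<M>"
  proof cases
    case (2 h)
    then show ?thesis using unit_edges_cut[of h] by simp
  qed simp
next
  fix t assume t: "t \<in> \<M>"
  then show "t \<in> pairing_of (unit_edges \<M>)"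
  proof (cases rule: dimer_cases)
    case (1 e)
    then show ?thesis using t unfolding pairing_of_def unit_edges_def by blast
  next
    case (2 h)
    have "t \<subseteq> fortress_regions" using pairing t unfolding pairings_iff by blast
    then have "in_fortress h" "in_fortress (across h)" unfolding 2(2) cut_dimer_def by (simp_all add: half_region_in_fortress_regions)
    moreover from this have "\<not> covered (unit_edges \<M>) h" "\<not> covered (unit_edges \<M>) (across h)"
      using unit_edges_cut[of h] unit_edges_cut[of "across h"] 2 t by (simp_all add: cut_dimer_across)
    ultimately show ?thesis using 2 unfolding pairing_of_def by blast
  qed
qed

end

lemma unit_edges_pairing_of: "unit_edges (pairing_of M) = M"
proof -
  have "unit_dimer ct e \<in> pairing_of M \<longleftrightarrow> e \<in> M" for e
    unfolding pairing_of_def using unit_dimer_neq_cut_dimer injD[OF inj_unit_dimer] by blast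
  then show ?thesis by (simp add: unit_edges_def)
qed

lemma pairing_of_compatible:
  assumes "compatible n P M"
  shows "pairing_of M \<in> pairings (grid_lines ct) fortress_regions"
  unfolding pairings_iff
proof (intro conjI ballI allI impI)
  have box: "M \<subseteq> edge_box n" and cm: "\<And>c. c \<in> grid n \<Longrightarrow> cell_matching M c"
    and glue: "\<And>h. snd h \<in> grid n \<or> snd (across h) \<in> grid n \<Longrightarrow>
      (covered M h \<noteq> (snd h \<in> P)) \<noteq> (covered M (across h) \<noteq> (snd (across h) \<in> P))"
    using assms unfolding compatible_iff by blast+
  have out: "\<not> covered M k" if "snd k \<notin> grid n" for k
    using that box unfolding covered_def touches_def by (metis cell_of_grid_iff subsetD)
  have unique: "e = e'" if "e \<in> M" "e' \<in> M" "touches e h" "touches e' h" for e e' h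
  proof -
    have "snd h \<in> grid n" using out that unfolding covered_def by blast
    then show ?thesis using cm[of "snd h"] that unfolding cell_matching_iff by (metis prod.collapse)
  qed
  show "pairing_of M \<subseteq> dimers (grid_lines ct)" unfolding pairing_of_def dimers_eq by blast
  show "t \<subseteq> fortress_regions" if "t \<in> pairing_of M" for t
  proof -
    from that consider e where "e \<in> M" "t = unit_dimer ct e" | h where "in_fortress h" "in_fortress (across h)" "t = cut_dimer ct h"
      unfolding pairing_of_def by blast
    then show ?thesis
    proof cases
      case 1
      then show ?thesis using box unit_dimer_subset_fortress_regions by blast
    next
      case 2
      then show ?thesis by (simp add: cut_dimer_def half_region_in_fortress_regions)
    qed
  qed
  fix h assume h: "in_fortress h"
  have g: "snd h \<in> grid n \<or> snd (across h) \<in> grid n" using h P_grid by (auto simp: in_fortress_def)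
  show "\<exists>!t. t \<in> pairing_of M \<and> half_region ct h \<in> t"
  proof (cases "is_cut ct h")
    case True
    have cases_t: "(\<exists>e\<in>M. touches e h \<and> t = unit_dimer ct e) \<or> (\<not> covered M h \<and> t = cut_dimer ct h)"
      if t: "t \<in> pairing_of M" "half_region ct h \<in> t" for t
    proof -
      from t(1) consider e where "e \<in> M" "t = unit_dimer ct e"
        | h' where "is_cut ct h'" "\<not> covered M h'" "\<not> covered M (across h')" "t = cut_dimer ct h'"
        unfolding pairing_of_def by blast
      then show ?thesis
      proof cases
        case 1
        then have "touches e h" using t(2) True by (simp add: half_region_in_unit_dimer)
        then show ?thesis using 1 by blast
      next
        case 2
        then have "h = h' \<or> h = across h'" using t(2) by (simp add: half_region_in_cut_dimer)
        then show ?thesis using 2 by (auto simp: cut_dimer_across)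
      qed
    qed
    show ?thesis
    proof (cases "covered M h")
      case c: True
      then obtain e where e: "e \<in> M" "touches e h" unfolding covered_def by blast
      show ?thesis
      proof (rule ex1I[of _ "unit_dimer ct e"])
        show "unit_dimer ct e \<in> pairing_of M \<and> half_region ct h \<in> unit_dimer ct e"
          using e by (simp add: pairing_of_def half_region_in_unit_dimer)
        fix t assume "t \<in> pairing_of M \<and> half_region ct h \<in> t"
        then show "t = unit_dimer ct e" using cases_t[of t] c unique e by blast
      qed
    next
      case c: False
      \<comment> \<open>The gluing rule forces the partner of an uncovered half to exist and to be
        uncovered as well; at the border it does so through membership in \<open>P\<close>.\<close>
      have "in_fortress (across h) \<and> \<not> covered M (across h)"
        using h glue[OF g] c cut_iff[of h] True out[of "across h"] P_grid unfolding in_fortress_def across_across by blast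
      then have "cut_dimer ct h \<in> pairing_of M" using True h c unfolding pairing_of_def by blast
      moreover have "half_region ct h \<in> cut_dimer ct h" by (simp add: cut_dimer_def)
      moreover have "t = cut_dimer ct h" if "t \<in> pairing_of M" "half_region ct h \<in> t" for t
        using cases_t[OF that] c unfolding covered_def by blast
      ultimately show ?thesis by (intro ex1I[of _ "cut_dimer ct h"]) blast+
    qed
  next
    case False
    note u = uncut_grid[OF False disjI1[OF h]]
    have ne: "covered M h \<noteq> covered M (across h)" using glue[OF g] u(3) by blast
    have cases_t: "\<exists>e\<in>M. (touches e h \<or> touches e (across h)) \<and> t = unit_dimer ct e"
      if t: "t \<in> pairing_of M" "half_region ct h \<in> t" for t
    proof -
      from t(1) consider e where "e \<in> M" "t = unit_dimer ct e" | h' where "is_cut ct h'" "t = cut_dimer ct h'"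
        unfolding pairing_of_def by blast
      then show ?thesis
      proof cases
        case 1
        then have "touches e h \<or> touches e (across h)" using t(2) False by (simp add: half_region_in_unit_dimer)
        then show ?thesis using 1 by blast
      next
        case 2
        then have "h = h' \<or> h = across h'" using t(2) by (simp add: half_region_in_cut_dimer)
        then show ?thesis using 2 False by auto
      qed
    qed
    obtain e where e: "e \<in> M" "touches e h \<or> touches e (across h)" using ne unfolding covered_def by blast
    show ?thesis
    proof (rule ex1I[of _ "unit_dimer ct e"])
      show "unit_dimer ct e \<in> pairing_of M \<and> half_region ct h \<in> unit_dimer ct e"
        using e False by (auto simp: pairing_of_def half_region_in_unit_dimer)
      fix t assume "t \<in> pairing_of M \<and> half_region ct h \<in> t"
      then obtain e' where e': "e' \<in> M" "touches e' h \<or> touches e' (across h)" "t = unit_dimer ct e'" using cases_t by blast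
      have "e' = e" using e e'(1,2) ne unique unfolding covered_def by blast
      then show "t = unit_dimer ct e" using e'(3) by simp
    qed
  qed
qed

theorem card_pairings: "card (pairings (grid_lines ct) fortress_regions) = card {M. compatible n P M}"
proof (rule bij_betw_same_card)
  show "bij_betw unit_edges (pairings (grid_lines ct) fortress_regions) {M. compatible n P M}"
    by (rule bij_betw_byWitness[where f' = pairing_of])
      (auto simp: pairing_of_unit_edges unit_edges_pairing_of compatible_unit_edges pairing_of_compatible)
qed

end

section \<open>Generalized fortresses\<close>

lemma share_edge_across:
  assumes "is_cut ct h"
  shows "share_edge (half_region ct h) (half_region ct (across h))"
proof (cases h rule: half_cases)
  case (1 s i)
  then show ?thesis using share_edge_North_South[of ct s "i - 1"] by (simp add: half_region_def)
next
  case (2 s i)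
  then show ?thesis using share_edge_North_South[of ct s i] share_edge_commute by (simp add: half_region_def)
next
  case (3 s i)
  then show ?thesis using share_edge_East_West[of ct s i] assms by (simp add: half_region_def)
next
  case (4 s i)
  then show ?thesis using share_edge_East_West[of ct "s - 1" i] assms share_edge_commute by (simp add: half_region_def)
qed

lemma share_edge_half_region_cases:
  assumes "share_edge (half_region ct h) (half_region ct h')"
  obtains h1 h2 where "half_region ct h1 = half_region ct h" "half_region ct h2 = half_region ct h'" "snd h1 = snd h2 \<or> h2 = across h1"
proof -
  obtain D1 s1 i1 D2 s2 i2 where
      r: "region ct D1 s1 i1 = region ct (fst h) (fst (snd h)) (snd (snd h))"
      "region ct D2 s2 i2 = region ct (fst h') (fst (snd h')) (snd (snd h'))"
    and c: "(s1 = s2 \<and> i1 = i2 \<and> (D1 \<in> {North, South}) \<noteq> (D2 \<in> {North, South})) \<or>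
    (D1 = North \<and> D2 = South \<and> s1 = s2 \<and> i1 = i2 + 1) \<or> (D1 = South \<and> D2 = North \<and> s1 = s2 \<and> i2 = i1 + 1) \<or>
    (D1 = East \<and> D2 = West \<and> s2 = s1 + 1 \<and> i1 = i2) \<or> (D1 = West \<and> D2 = East \<and> s1 = s2 + 1 \<and> i1 = i2)"
    by (rule share_edge_region_cases[OF assms[unfolded half_region_def]])
  show thesis
  proof (rule that)
    show "half_region ct (D1, (s1, i1)) = half_region ct h" "half_region ct (D2, (s2, i2)) = half_region ct h'"
      unfolding half_region_def fst_conv snd_conv by (rule r)+
    show "snd (D1, (s1, i1)) = snd (D2, (s2, i2)) \<or> (D2, (s2, i2)) = across (D1, (s1, i1))"
      using c by (elim disjE conjE) simp_all
  qed
qed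

definition strip :: "int \<Rightarrow> int \<Rightarrow> int \<Rightarrow> int \<Rightarrow> (real \<times> real) set" where
  "strip a b p q = {(x, y). 2 * of_int a \<le> x + y \<and> x + y \<le> 2 * of_int b \<and> - 2 * of_int q \<le> y - x
    \<and> y - x \<le> - 2 * of_int p}"

lemma hopen_subset_hclosed: "hopen H \<subseteq> hclosed H"
  by (auto simp: hopen_def hclosed_def less_imp_le)

lemma int_less_of_real: "real_of_int a < real_of_int b + 1 \<Longrightarrow> a \<le> b"
proof -
  assume "real_of_int a < real_of_int b + 1"
  then have "real_of_int a < real_of_int (b + 1)" by simp
  then show ?thesis unfolding of_int_less_iff by simp
qed

text \<open>The strip ends at cuts, so no uncut square reaches across its ends and containment
  depends on the cell alone.\<close>

lemma half_region_subset_strip: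
  assumes "ct a" "ct b"
  shows "half_region ct h \<subseteq> strip a b p q \<longleftrightarrow> a < fst (snd h) \<and> fst (snd h) \<le> b \<and> p < snd (snd h)
    \<and> snd (snd h) \<le> q"
proof
  assume sub: "half_region ct h \<subseteq> strip a b p q"
  obtain D s i where h: "h = (D, (s, i))" by (metis surj_pair)
  have "inner_point D (of_int s) (of_int i) \<in> strip a b p q"
    using inner_point_in_hopen[of D s i ct] hopen_subset_hclosed sub unfolding h half_region_def by auto
  then have "real_of_int a < real_of_int (s - 1) + 1" "real_of_int s < real_of_int b + 1"
    "real_of_int p < real_of_int (i - 1) + 1" "real_of_int i < real_of_int q + 1"
    by (cases D; simp add: strip_def)+
  then have "a \<le> s - 1" "s \<le> b" "p \<le> i - 1" "i \<le> q" by (simp_all only: int_less_of_real)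
  then show "a < fst (snd h) \<and> fst (snd h) \<le> b \<and> p < snd (snd h) \<and> snd (snd h) \<le> q" by (simp add: h)
next
  assume r: "a < fst (snd h) \<and> fst (snd h) \<le> b \<and> p < snd (snd h) \<and> snd (snd h) \<le> q"
  obtain D s i where h: "h = (D, (s, i))" by (metis surj_pair)
  have "a \<le> s - 1" "s \<le> b" "p \<le> i - 1" "i \<le> q" using r by (auto simp: h)
  then have le: "real_of_int a \<le> of_int (s - 1)" "real_of_int s \<le> of_int b" "real_of_int p \<le> of_int (i - 1)" "real_of_int i
    \<le> of_int q"
    by (simp_all only: of_int_le_iff)
  have E: "real_of_int s + 1 \<le> of_int b" if "\<not> ct s"
  proof -
    have "s + 1 \<le> b" using that assms \<open>s \<le> b\<close> by (cases "s = b") auto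
    then have "real_of_int (s + 1) \<le> of_int b" by (simp only: of_int_le_iff)
    then show ?thesis by simp
  qed
  have W: "real_of_int a \<le> of_int s - 2" if "\<not> ct (s - 1)"
  proof -
    have "a \<le> s - 2" using that assms \<open>a \<le> s - 1\<close> by (cases "a = s - 1") auto
    then have "real_of_int a \<le> of_int (s - 2)" by (simp only: of_int_le_iff)
    then show ?thesis by simp
  qed
  show "half_region ct h \<subseteq> strip a b p q"
  proof
    fix z assume z: "z \<in> half_region ct h"
    obtain x y where xy: "z = (x, y)" by fastforce
    show "z \<in> strip a b p q"
      using z le E W unfolding xy h half_region_def fst_conv snd_conv
      by (cases D) (auto simp: region_iff strip_def split: if_splits)
  qed
qed

lemma psum_Suc: "psum d (Suc j) = psum d j + d (Suc j)"
  by (simp add: psum_def)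

lemma psum_0: "psum d 0 = 0"
  by (simp add: psum_def)

lemma psum_mono: "j \<le> j' \<Longrightarrow> psum d j \<le> psum d j'"
  by (rule lift_Suc_mono_le[of "psum d"]) (simp_all add: psum_Suc)

definition cutset :: "nat \<Rightarrow> (nat \<Rightarrow> nat) \<Rightarrow> int \<Rightarrow> bool" where
  "cutset m d s \<longleftrightarrow> (\<exists>j\<le>m. s = int (psum d j))"

text \<open>Column \<open>s\<close> is the part with \<open>x + y\<close> between
  \<open>2 * s - 2\<close> and \<open>2 * s\<close>. It therefore still belongs to block
  \<open>j\<close> when \<open>s\<close> equals \<open>psum d j\<close>, whence the weak
  inequality.\<close>

definition block_index :: "(nat \<Rightarrow> nat) \<Rightarrow> int \<Rightarrow> nat" where
  "block_index d s = (LEAST j. s \<le> int (psum d j))"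

lemma fortress_lines_eq: "fortress_lines m d = grid_lines (cutset m d)"
proof -
  have "(\<exists>j\<le>m. z = 2 * real (psum d j)) \<longleftrightarrow> (\<exists>s. cutset m d s \<and> z = 2 * of_int s)" for z
    unfolding cutset_def by (metis of_int_of_nat_eq)
  then show ?thesis by (simp add: fortress_lines_def grid_lines_def)
qed

locale generalized_fortress =
  fixes m :: nat and d :: "nat \<Rightarrow> nat" and par :: "nat \<Rightarrow> bool"
  assumes m_pos: "m \<ge> 1" and d_pos: "\<And>j. 1 \<le> j \<Longrightarrow> j \<le> m \<Longrightarrow> d j > 0"
    and par: "par = even \<or> par = odd"
begin

abbreviation ct :: "int \<Rightarrow> bool" where "ct \<equiv> cutset m d"
abbreviation n :: nat where "n \<equiv> psum d m"
abbreviation J :: "int \<Rightarrow> nat" where "J \<equiv> block_index d"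

text \<open>Whether row 1 of column \<open>s\<close> belongs to the selected blocks; the selection
  alternates along the column, so this bit describes all of it.\<close>

definition \<tau> :: "int \<Rightarrow> bool" where "\<tau> s = par (1 + J s)"
definition P :: "pos set" where "P = {(s, i) \<in> grid (int n). \<tau> s = odd i}"

lemma psum_less: "j < j' \<Longrightarrow> j' \<le> m \<Longrightarrow> psum d j < psum d j'"
proof -
  assume j: "j < j'" "j' \<le> m"
  then have "psum d j < psum d (Suc j)" using d_pos[of "Suc j"] by (simp add: psum_Suc)
  also have "\<dots> \<le> psum d j'" using j by (intro psum_mono) simp
  finally show ?thesis .
qed

lemma n_pos: "n \<ge> 1"
  using psum_less[of 0 m] m_pos by (simp add: psum_0)

lemma ct_0: "ct 0" and ct_n: "ct (int n)" and ct_psum: "j \<le> m \<Longrightarrow> ct (int (psum d j))"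
  unfolding cutset_def by (auto intro: exI[of _ 0] simp: psum_0)

lemma J_eq:
  assumes "1 \<le> j" "int (psum d (j - 1)) < s" "s \<le> int (psum d j)"
  shows "J s = j"
  unfolding block_index_def
proof (rule Least_equality)
  fix y assume "s \<le> int (psum d y)"
  show "j \<le> y"
  proof (rule ccontr)
    assume "\<not> j \<le> y"
    then have "psum d y \<le> psum d (j - 1)" by (intro psum_mono) simp
    then show False using assms \<open>s \<le> int (psum d y)\<close> by simp
  qed
qed (use assms in simp)

lemma J_props:
  assumes "1 \<le> s" "s \<le> int n"
  shows "1 \<le> J s" "J s \<le> m" "int (psum d (J s - 1)) < s" "s \<le> int (psum d (J s))"
proof -
  show le: "s \<le> int (psum d (J s))" unfolding block_index_def by (rule LeastI[of _ m]) (use assms in simp)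
  show "J s \<le> m" unfolding block_index_def by (rule Least_le) (use assms in simp)
  show "1 \<le> J s" using le assms(1) by (cases "J s") (simp_all add: psum_0)
  then have "J s - 1 < J s" by simp
  then have "\<not> s \<le> int (psum d (J s - 1))" by (subst (asm) (2) block_index_def) (rule not_less_Least)
  then show "int (psum d (J s - 1)) < s" by simp
qed

text \<open>All \<open>d j\<close> are positive, so no block is skipped at a cut and the parity of
  the block index changes there.\<close>

lemma J_Suc:
  assumes "1 \<le> s" "s + 1 \<le> int n"
  shows "J (s + 1) = (if ct s then J s + 1 else J s)"
proof -
  have s: "1 \<le> s" "s \<le> int n" using assms by auto
  note J = J_props[OF s]
  show ?thesis
  proof (cases "s = int (psum d (J s))")
    case True
    then have "J s \<noteq> m" using assms(2) by auto
    then have l: "J s < m" using J(2) by simp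
    then have "psum d (J s) < psum d (Suc (J s))" by (intro psum_less) auto
    then have "J (s + 1) = Suc (J s)" using True by (intro J_eq) auto
    moreover have "ct s" using True J(2) unfolding cutset_def by blast
    ultimately show ?thesis by simp
  next
    case False
    have "\<not> ct s"
    proof
      assume "ct s"
      then obtain j where j: "j \<le> m" "s = int (psum d j)" unfolding cutset_def by blast
      then have "j \<noteq> 0" using s(1) by (cases "j = 0") (simp_all add: psum_0)
      then have "psum d (j - 1) < psum d j" using j by (intro psum_less) auto
      then have "J s = j" using j \<open>j \<noteq> 0\<close> by (intro J_eq) auto
      then show False using False j by simp
    qed
    moreover have "J (s + 1) = J s" using J False by (intro J_eq) auto
    ultimately show ?thesis by simp
  qed
qed

lemma par_Suc: "par (Suc a) = (\<not> par a)"
  using par by auto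

lemma \<tau>_Suc:
  assumes "1 \<le> s" "s + 1 \<le> int n"
  shows "\<tau> (s + 1) = \<tau> s \<longleftrightarrow> \<not> ct s"
  using J_Suc[OF assms] by (simp add: \<tau>_def par_Suc)

lemma P_iff: "(s, i) \<in> P \<longleftrightarrow> 1 \<le> s \<and> s \<le> int n \<and> 1 \<le> i \<and> i \<le> int n \<and> \<tau> s = odd i"
  by (auto simp: P_def grid_def)

sublocale fortress_graph ct "int n" P
proof
  show "P \<subseteq> grid (int n)" by (auto simp: P_def)
next
  fix h assume h: "snd h \<in> grid (int n)" "snd (across h) \<in> grid (int n)"
  have EW: "ct s \<longleftrightarrow> ((s, i) \<in> P) \<noteq> ((s + 1, i) \<in> P)" if "(s, i) \<in> grid (int n)" "(s + 1, i)
    \<in> grid (int n)" for s i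
    using that \<tau>_Suc[of s] unfolding P_iff grid_def by auto
  have NS: "((s, i) \<in> P) \<noteq> ((s, i + 1) \<in> P)" if "(s, i) \<in> grid (int n)" "(s, i + 1) \<in> grid (int n)" for s i
    using that unfolding P_iff grid_def by auto
  show "is_cut ct h \<longleftrightarrow> (snd h \<in> P) \<noteq> (snd (across h) \<in> P)"
  proof (cases h rule: half_cases)
    case (1 s i)
    then show ?thesis using NS[of s "i - 1"] h by auto
  next
    case (2 s i)
    then show ?thesis using NS[of s i] h by auto
  next
    case (3 s i)
    then show ?thesis using EW[of s i] h by simp
  next
    case (4 s i)
    then show ?thesis using EW[of "s - 1" i] h by auto
  qed
next
  fix h assume h: "snd h \<in> grid (int n)" "snd (across h) \<notin> grid (int n)"
  show "is_cut ct h"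
  proof (cases h rule: half_cases)
    case (3 s i)
    then have "s = int n" using h by (auto simp: grid_def)
    then show ?thesis using ct_n 3 by simp
  next
    case (4 s i)
    then have "s = 1" using h by (auto simp: grid_def)
    then show ?thesis using ct_0 4 by simp
  qed simp_all
qed

lemma diamond_eq: "diamond n = strip 0 (int n) 0 (int n)"
  by (simp add: diamond_def strip_def)

lemma block_eq: "1 \<le> i \<Longrightarrow> block d i j = strip (int (psum d (j - 1))) (int (psum d j)) (int i - 1) (int i)"
  by (simp add: block_def strip_def)

lemma half_region_subset_diamond: "half_region ct h \<subseteq> diamond n \<longleftrightarrow> snd h \<in> grid (int n)"
  unfolding diamond_eq half_region_subset_strip[OF ct_0 ct_n] by (cases "snd h") (auto simp: grid_def)

lemma half_region_subset_block:
  "(\<exists>i\<in>{1..n}. \<exists>j\<in>{1..m}. par (i + j) \<and> half_region ct h \<subseteq> block d i j) \<longleftrightarrow> snd h \<in> P"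
proof -
  obtain D s i where h: "h = (D, (s, i))" by (metis surj_pair)
  have sub: "half_region ct h \<subseteq> block d i' j \<longleftrightarrow> int (psum d (j - 1)) < s \<and> s \<le> int (psum d j) \<and> i = int i'"
    if "i' \<in> {1..n}" "j \<in> {1..m}" for i' j
  proof -
    have b: "block d i' j = strip (int (psum d (j - 1))) (int (psum d j)) (int i' - 1) (int i')"
      using that by (intro block_eq) simp
    have c: "ct (int (psum d (j - 1)))" "ct (int (psum d j))" using ct_psum[of "j - 1"] ct_psum[of j] that by auto
    show ?thesis unfolding b half_region_subset_strip[OF c] h by auto
  qed
  have p: "par (i' + j) \<longleftrightarrow> (par (1 + j) \<longleftrightarrow> odd i')" for i' j using par by auto
  show ?thesis
  proof
    assume "\<exists>i\<in>{1..n}. \<exists>j\<in>{1..m}. par (i + j) \<and> half_region ct h \<subseteq> block d i j"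
    then obtain i' j where ij: "i' \<in> {1..n}" "j \<in> {1..m}" "par (i' + j)"
      and s: "int (psum d (j - 1)) < s" "s \<le> int (psum d j)" "i = int i'" using sub by blast
    then have "J s = j" by (intro J_eq) auto
    moreover have "psum d j \<le> n" using ij by (intro psum_mono) simp
    ultimately show "snd h \<in> P" using ij s p by (auto simp: h P_iff \<tau>_def)
  next
    assume "snd h \<in> P"
    then have s: "1 \<le> s" "s \<le> int n" "1 \<le> i" "i \<le> int n" "\<tau> s = odd i" by (simp_all add: h P_iff)
    note J = J_props[OF s(1,2)]
    have "nat i \<in> {1..n}" "J s \<in> {1..m}" "par (nat i + J s)"
      using s J p[of "nat i" "J s"] by (auto simp: \<tau>_def even_nat_iff)
    moreover have "half_region ct h \<subseteq> block d (nat i) (J s)" using calculation J s by (simp add: sub)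
    ultimately show "\<exists>i\<in>{1..n}. \<exists>j\<in>{1..m}. par (i + j) \<and> half_region ct h \<subseteq> block d i j" by blast
  qed
qed

lemma regions_eq: "elementary_regions (grid_lines ct) = range (half_region ct)"
  unfolding elementary_regions_grid_lines
proof (intro equalityI subsetI)
  fix c assume "c \<in> {region ct D s i | D s i. True}"
  then obtain D s i where "c = half_region ct (D, (s, i))" unfolding half_region_def fst_conv snd_conv by blast
  then show "c \<in> range (half_region ct)" by (rule range_eqI)
qed (use half_region_def in blast)

text \<open>Whether a region lies in the diamond depends only on its cell. So an outside region can
  share an edge with a selected block only across the diagonal of a square, never within one
  cell.\<close>

lemma fortress_of_eq: "fortress_of par m d = \<Union>fortress_regions"
proof -
  let ?E = "range (half_region ct)"
  have 1: "{c \<in> ?E. c \<subseteq> diamond n} = half_region ct ` {h. snd h \<in> grid (int n)}"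
    unfolding half_region_subset_diamond[symmetric] by blast
  have 2: "{c \<in> ?E. \<not> c \<subseteq> diamond n \<and> (\<exists>c'\<in>?E. share_edge c c' \<and>
      (\<exists>i\<in>{1..n}. \<exists>j\<in>{1..m}. par (i + j)
        \<and> c' \<subseteq> block d i j))} = half_region ct ` {h. snd h \<notin> grid (int n) \<and> snd (across h) \<in> P}"
    (is "?l = ?r")
  proof (intro equalityI subsetI)
    fix c assume "c \<in> ?l"
    then obtain h h' where h: "c = half_region ct h" "\<not> half_region ct h \<subseteq> diamond n" "share_edge (half_region ct h)
      (half_region ct h')"
      "\<exists>i\<in>{1..n}. \<exists>j\<in>{1..m}. par (i + j) \<and> half_region ct h' \<subseteq> block d i j" by blast
    obtain h1 h2 where h12: "half_region ct h1 = half_region ct h" "half_region ct h2 = half_region ct h'" "snd h1 = snd h2 \<or> h2 = across h1"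
      using share_edge_half_region_cases[OF h(3)] .
    have "snd h1 \<notin> grid (int n)" using h(2) unfolding h12(1)[symmetric] half_region_subset_diamond .
    moreover have "snd h2 \<in> P" using h(4) unfolding h12(2)[symmetric] half_region_subset_block .
    ultimately have "snd h1 \<notin> grid (int n) \<and> snd (across h1) \<in> P" using h12(3) P_grid by auto
    then show "c \<in> ?r" unfolding h(1) h12(1)[symmetric] by blast
  next
    fix c assume "c \<in> ?r"
    then obtain h where h: "c = half_region ct h" "snd h \<notin> grid (int n)" "snd (across h) \<in> P" by blast
    then have "is_cut ct h" using cut_boundary[of "across h"] P_grid by auto
    then have "share_edge (half_region ct h) (half_region ct (across h))" by (rule share_edge_across)
    then show "c \<in> ?l" using h half_region_subset_diamond half_region_subset_block[of "across h"] by blast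
  qed
  have "fortress_of par m d = \<Union>(half_region ct ` {h. snd h \<in> grid (int n)}) \<union>
      \<Union>(half_region ct ` {h. snd h \<notin> grid (int n) \<and> snd (across h) \<in> P})"
    unfolding fortress_of_def Let_def fortress_lines_eq regions_eq 1 2 ..
  also have "\<dots> = \<Union>fortress_regions"
    unfolding fortress_regions_def Union_Un_distrib[symmetric] image_Un[symmetric] in_fortress_def by (rule arg_cong[of _ _ "\<lambda>X.
      \<Union>(half_region ct ` X)"]) blast
  finally show ?thesis .
qed

section \<open>Evaluation of the number of tilings\<close>

lemma num_tilings_eq_dimer_sum: "real (num_tilings (fortress_lines m d) (fortress_of par m d)) = dimer_sum (int n) P (\<lambda>_. 1)"
proof -
  have sub: "fortress_regions \<subseteq> elementary_regions (grid_lines ct)" unfolding regions_eq fortress_regions_def by blast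
  have "num_tilings (fortress_lines m d) (fortress_of par m d) = card {M. compatible (int n) P M}"
    unfolding fortress_of_eq fortress_lines_eq num_tilings_eq_pairings[OF open_compl_grid_lines sub] by (rule card_pairings)
  then show ?thesis by (simp add: dimer_sum_def)
qed

text \<open>After the first round the half-columns of cell column \<open>s\<close> carry the phases
  of the old columns \<open>s\<close> and \<open>s + 1\<close>, which differ exactly at a cut. The
  order is then \<open>n - 1\<close>, so the distance to the far end is
  \<open>n - s\<close>.\<close>

lemma corner_product_eq:
  "corner_product (n - 1) \<tau> (\<lambda>s. \<tau> (s + 1)) = (5 / 4) ^ (\<Sum>j = 1..m. min (psum d j) (n - psum d j))"
proof -
  let ?f = "\<lambda>s::int. (5 / 4 :: real) ^ nat (min s (int n - s))"
  have "corner_product (n - 1) \<tau> (\<lambda>s. \<tau> (s + 1)) = (\<Prod>s\<in>{1..int n - 1}. if ct s then ?f s else 1)"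
    unfolding corner_product_def
  proof (rule prod.cong)
    show "{1..int (n - 1)} = {1..int n - 1}" using n_pos by (simp add: of_nat_diff)
    fix s assume "s \<in> {1..int n - 1}"
    then show "corner_factor (\<tau> s) (\<tau> (s + 1)) ^ nat (min s (int (n - 1) + 1 - s)) = (if ct s then ?f s else 1)"
      using \<tau>_Suc[of s] n_pos by (auto simp: corner_factor_def of_nat_diff)
  qed
  also have "\<dots> = (\<Prod>s\<in>{1..int n - 1} \<inter> {s. ct s}. ?f s)"
    by (subst prod.inter_restrict) simp_all
  also have "\<dots> = (\<Prod>j\<in>{1..m - 1}. ?f (int (psum d j)))"
  proof (rule prod.reindex_cong[of "\<lambda>j. int (psum d j)"])
    show "inj_on (\<lambda>j. int (psum d j)) {1..m - 1}"
      by (rule linorder_inj_onI') (use psum_less in \<open>fastforce\<close>)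
    show "{1..int n - 1} \<inter> {s. ct s} = (\<lambda>j. int (psum d j)) ` {1..m - 1}"
    proof (intro equalityI subsetI)
      fix s assume "s \<in> {1..int n - 1} \<inter> {s. ct s}"
      then obtain j where j: "j \<le> m" "s = int (psum d j)" "1 \<le> s" "s \<le> int n - 1" unfolding cutset_def by auto
      have "j \<noteq> 0" using j(2,3) by (cases "j = 0") (simp_all add: psum_0)
      moreover have "j \<noteq> m" using j(2,4) by auto
      ultimately have "j \<noteq> 0" "j \<noteq> m" by simp_all
      then show "s \<in> (\<lambda>j. int (psum d j)) ` {1..m - 1}" using j by auto
    next
      fix s assume "s \<in> (\<lambda>j. int (psum d j)) ` {1..m - 1}"
      then obtain j where j: "1 \<le> j" "j \<le> m - 1" "s = int (psum d j)" by auto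
      then have "j < m" using m_pos by linarith
      then show "s \<in> {1..int n - 1} \<inter> {s. ct s}"
        using j psum_less[of 0 j] psum_less[of j m] m_pos ct_psum[of j] by (simp add: psum_0)
    qed
  qed simp
  \<comment> \<open>The position for \<open>j = m\<close> is \<open>n\<close> itself and has
    exponent 0.\<close>
  also have "\<dots> = (\<Prod>j\<in>{1..m}. ?f (int (psum d j)))"
  proof (rule prod.mono_neutral_left)
    show "\<forall>j\<in>{1..m} - {1..m - 1}. ?f (int (psum d j)) = 1"
    proof
      fix j assume "j \<in> {1..m} - {1..m - 1}"
      then have "j = m" by auto
      then show "?f (int (psum d j)) = 1" by simp
    qed
  qed auto
  also have "\<dots> = (\<Prod>j\<in>{1..m}. (5 / 4) ^ min (psum d j) (n - psum d j))"
  proof (rule prod.cong[OF refl])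
    fix j assume "j \<in> {1..m}"
    then have "psum d j \<le> n" by (intro psum_mono) simp
    then have "nat (min (int (psum d j)) (int n - int (psum d j))) = min (psum d j) (n - psum d j)"
      by (auto simp: min_def)
    then show "?f (int (psum d j)) = (5 / 4) ^ min (psum d j) (n - psum d j)" by simp
  qed
  also have "\<dots> = (5 / 4) ^ (\<Sum>j = 1..m. min (psum d j) (n - psum d j))"
    by (rule power_sum[symmetric])
  finally show ?thesis .
qed

lemma num_tilings_even:
  assumes "n = 2 * k" "S = (\<Sum>j = 1..m. min (psum d j) (n - psum d j))"
  shows "real (num_tilings (fortress_lines m d) (fortress_of par m d)) = 2 ^ (2 * k ^ 2) * (5 / 4) ^ S"
proof -
  have "k \<ge> 1" using n_pos assms by simp
  then show ?thesis
    using dimer_sum_fortress_even[OF _ P_def[unfolded assms(1)]] corner_product_eq unfolding num_tilings_eq_dimer_sum assms(2) assms(1) by simp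
qed

lemma num_tilings_odd:
  assumes "n = 2 * k + 1" "S = (\<Sum>j = 1..m. min (psum d j) (n - psum d j))"
  shows "real (num_tilings (fortress_lines m d) (fortress_of par m d)) =
    2 ^ (k * (2 * k + 2)) * (if \<tau> (int k + 1) then 1 else 2) * (5 / 4) ^ S"
  using dimer_sum_fortress_odd[OF P_def[unfolded assms(1)]] corner_product_eq unfolding num_tilings_eq_dimer_sum assms(2) assms(1) by (simp
    add: half_unless_def)

text \<open>Translates the phase of the middle column into the interval condition of part
  (b).\<close>

lemma odd_block_iff:
  assumes "1 \<le> s" "s \<le> n"
  shows "odd (J (int s)) \<longleftrightarrow> (\<exists>j. 2 * j + 1 \<le> m \<and> psum d (2 * j) < s \<and> s \<le> psum d (2 * j + 1))"
proof
  assume "odd (J (int s))"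
  then obtain j where j: "J (int s) = 2 * j + 1" by (rule oddE)
  then show "\<exists>j. 2 * j + 1 \<le> m \<and> psum d (2 * j) < s \<and> s \<le> psum d (2 * j + 1)"
    using J_props[of "int s"] assms by (intro exI[of _ j]) auto
next
  assume "\<exists>j. 2 * j + 1 \<le> m \<and> psum d (2 * j) < s \<and> s \<le> psum d (2 * j + 1)"
  then obtain j where "psum d (2 * j) < s" "s \<le> psum d (2 * j + 1)" by blast
  then have "J (int s) = 2 * j + 1" by (intro J_eq) auto
  then show "odd (J (int s))" by simp
qed

end

text \<open>Each factor 5/4 costs two powers of two; the integer exponent avoids truncated
  subtraction.\<close>

lemma power_eq_powi: "(2::real) ^ a * (5 / 4) ^ S = 2 powi (int a - 2 * int S) * 5 ^ S"
proof -
  have "(4::real) ^ S = 2 ^ (2 * S)" by (simp add: power_mult)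
  moreover have "(2::real) powi (int a - int (2 * S)) = 2 ^ a / 2 ^ (2 * S)"
    by (subst power_int_diff) (simp_all add: power_int_of_nat del: of_nat_mult)
  ultimately show ?thesis by (simp add: power_divide)
qed

theorem theorem3p2:
  fixes m :: nat and d :: "nat \<Rightarrow> nat" and S :: nat
  assumes "m \<ge> 1"
    and "\<And>j. 1 \<le> j \<Longrightarrow> j \<le> m \<Longrightarrow> d j > 0"
    and "S = (\<Sum>j = 1..m. min (psum d j) (psum d m - psum d j))"
  shows
    "(\<forall>k::nat. psum d m = 2 * k \<longrightarrow>
        real (num_tilings (fortress_lines m d) (fortress m d))
          = 2 powi (2 * int k ^ 2 - 2 * int S) * 5 ^ S \<and>
        real (num_tilings (fortress_lines m d) (fortress_bar m d))
          = 2 powi (2 * int k ^ 2 - 2 * int S) * 5 ^ S) \<and>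
     (\<forall>(k::nat) (\<alpha>::int). psum d m = 2 * k + 1 \<longrightarrow>
        \<alpha> = (if \<exists>j::nat. 2 * j + 1 \<le> m \<and> psum d (2 * j) < k + 1 \<and> k + 1 \<le> psum d (2 * j + 1)
             then int k * (2 * int k + 2) - 2 * int S
             else int k * (2 * int k + 2) + 1 - 2 * int S) \<longrightarrow>
        real (num_tilings (fortress_lines m d) (fortress m d)) = 2 powi \<alpha> * 5 ^ S \<and>
        real (num_tilings (fortress_lines m d) (fortress_bar m d))
          = 2 powi ((2 * int k + 1) ^ 2 - 4 * int S - \<alpha>) * 5 ^ S)"
proof -
  interpret F: generalized_fortress m d even using assms(1,2) by unfold_locales auto
  interpret G: generalized_fortress m d odd using assms(1,2) by unfold_locales auto
  have a: "real (num_tilings (fortress_lines m d) (fortress m d)) = 2 powi (2 * int k ^ 2 - 2 * int S) * 5 ^ S \<and>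
      real (num_tilings (fortress_lines m d) (fortress_bar m d)) = 2 powi (2 * int k ^ 2 - 2 * int S) * 5 ^ S"
    if "psum d m = 2 * k" for k
    unfolding fortress_def fortress_bar_def F.num_tilings_even[OF that assms(3)] G.num_tilings_even[OF that assms(3)] power_eq_powi
    by simp
  have b: "real (num_tilings (fortress_lines m d) (fortress m d)) = 2 powi \<alpha> * 5 ^ S \<and>
      real (num_tilings (fortress_lines m d) (fortress_bar m d)) = 2 powi ((2 * int k + 1) ^ 2 - 4 * int S - \<alpha>) * 5 ^ S"
    if n: "psum d m = 2 * k + 1" and \<alpha>: "\<alpha> = (if \<exists>j::nat. 2 * j + 1 \<le> m \<and> psum d (2 * j) < k + 1 \<and> k + 1 \<le> psum d (2 * j + 1)
             then int k * (2 * int k + 2) - 2 * int S else int k * (2 * int k + 2) + 1 - 2 * int S)" for k \<alpha>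
  proof -
    have J: "odd (F.J (int (k + 1))) \<longleftrightarrow> (\<exists>j. 2 * j + 1 \<le> m \<and> psum d (2 * j) < k + 1 \<and> k + 1 \<le> psum d (2 * j + 1))"
      by (rule F.odd_block_iff) (use n in auto)
    have k: "int (k + 1) = int k + 1" by simp
    have e: "2 ^ (k * (2 * k + 2)) * 2 * (5 / 4) ^ S = 2 powi (int (Suc (k * (2 * k + 2))) - 2 * int S) * (5::real) ^ S"
      unfolding power_eq_powi[symmetric] by simp
    \<comment> \<open>The two regions have opposite phases in the middle column, so one of them gets
      the extra factor 2 exactly when the other does not.\<close>
    have \<tau>: "F.\<tau> (int k + 1) = odd (F.J (int (k + 1)))" "G.\<tau> (int k + 1) = even (F.J (int (k + 1)))"
      unfolding F.\<tau>_def G.\<tau>_def k by simp_all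
    show ?thesis
    proof (cases "odd (F.J (int (k + 1)))")
      case True
      then have \<alpha>': "\<alpha> = int (k * (2 * k + 2)) - 2 * int S" using \<alpha> J by (simp add: algebra_simps)
      \<comment> \<open>The exponents of the two regions add up as stated because twice
        \<open>k * (2 * k + 2)\<close> plus 1 is the square of \<open>2 * k + 1\<close>.\<close>
      then have "(2 * int k + 1) ^ 2 - 4 * int S - \<alpha> = int (Suc (k * (2 * k + 2))) - 2 * int S"
        by (simp add: power2_eq_square algebra_simps)
      then show ?thesis using True \<alpha>'
        unfolding fortress_def fortress_bar_def F.num_tilings_odd[OF n assms(3)] G.num_tilings_odd[OF n assms(3)] \<tau>
        by (simp only: power_eq_powi e if_True if_False not_True_eq_False mult_1_right simp_thms)
    next
      case False
      then have \<alpha>': "\<alpha> = int (Suc (k * (2 * k + 2))) - 2 * int S" using \<alpha> J by (simp add: algebra_simps)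
      then have "(2 * int k + 1) ^ 2 - 4 * int S - \<alpha> = int (k * (2 * k + 2)) - 2 * int S"
        by (simp add: power2_eq_square algebra_simps)
      then show ?thesis using False \<alpha>'
        unfolding fortress_def fortress_bar_def F.num_tilings_odd[OF n assms(3)] G.num_tilings_odd[OF n assms(3)] \<tau>
        by (simp only: power_eq_powi e if_True if_False not_True_eq_False mult_1_right simp_thms)
    qed
  qed
  show ?thesis using a b by blast
qed

end
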